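(* Let $X$ be a Banach space. The following assertions are equivalent: (i) $X$ has non-trivial Rademacher type; (ii) $X$ has non-trivial infratype; (iii) a no-dimensional Carathéodory theorem holds in $X$, i.e. $\operatorname{Car}_X(k)\to 0$ as $k\to\infty$; (iv) a no-dimensional colorful Radon theorem holds in $X$, i.e. $\operatorname{Radon}_X(2n,r)\to 0$ as $nr\to\infty$; (v) a no-dimensional colorful Tverberg theorem holds in $X$, i.e. for every $k\ge 2$, $\operatorname{Tv}_X(r,k)\to 0$ as $r\to\infty$; (vi) a no-dimensional selection lemma holds in $X$, i.e. there exist numbers $0<\theta_r<1$ ($r\in\mathbb N$) such that $\operatorname{Sel}_X(r,\theta_r)\to 0$ as $r\to\infty$; (vii) a no-dimensional weak $\varepsilon$-net theorem holds in $X$, i.e. for every $0<\varepsilon<1$ and every $\eta>0$ there is an integer $M=M_X(\varepsilon,\eta)$ such that $\operatorname{WeakNet}_X(\varepsilon,M)\le\eta$; (viii) a no-dimensional Helly theorem holds in $X$, i.e. $\operatorname{Helly}_X(k)\to 0$ as $k\to\infty$.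
   Context: Type and infratype. A Banach space $X$ has Rademacher type $p\in[1,2]$ if there is a constant $T<\infty$ such that for every finite sequence $x_1,\dots,x_m\in X$, $\left(\mathbb E\|\sum_{i=1}^m\epsilon_i x_i\|^p\right)^{1/p}\le T\left(\sum_{i=1}^m\|x_i\|^p\right)^{1/p}$, where $\epsilon_i$ are independent uniform $\pm1$ random variables. $X$ has infratype $p\in[1,2]$ if there is a constant $I<\infty$ such that for every finite sequence $x_1,\dots,x_m\in X$, $\min_{\theta_i=\pm1}\|\sum_{i=1}^m\theta_i x_i\|\le I\left(\sum_{i=1}^m\|x_i\|^p\right)^{1/p}$. Non-trivial type (infratype) means type (infratype) $p$ for some $p>1$. Notation. $\operatorname{conv}$ is the convex hull, $\operatorname{diam}$ the diameter, $\operatorname{dist}(A,B)=\inf\{\|a-b\|: a\in A,b\in B\}$ (a point is treated as a singleton), $[n]=\{1,\dots,n\}$, $\mathbf B_X$ is the closed unit ball of $X$, $\binom{P}{r}$ is the set of $r$-element subsets of $P$. Carathéodory. $\operatorname{conv}_k P=\{\sum_{i=1}^s\lambda_i x_i: 1\le s\le k,\ x_i\in P,\ \lambda_i\ge0,\ \sum\lambda_i=1\}$, and $\operatorname{Car}_X(k)=\sup_P\sup_{a\in\operatorname{conv}P}\frac{\operatorname{dist}(a,\operatorname{conv}_kP)}{\operatorname{diam}P}$, the supremum over bounded sets $P\subset X$ of positive diameter. Radon. For pairwise disjoint sets $Z_1,\dots,Z_r\subset X$, each of cardinality $2n$, put $S=\bigcup_j Z_j$, $D=\max_j\operatorname{diam}Z_j$.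 A balanced Radon split is a partition $S=Q_0\sqcup Q_1$ with $|Q_0\cap Z_j|=|Q_1\cap Z_j|=n$ for all $j\in[r]$. Then $\operatorname{Radon}_X(2n,r)=\sup_{Z_1,\dots,Z_r}\inf\frac{\operatorname{dist}(\operatorname{conv}Q_0,\operatorname{conv}Q_1)}{D}$, the infimum over balanced Radon splits. Tverberg. For pairwise disjoint $Z_1,\dots,Z_r\subset X$, each of cardinality $k\ge2$, with $S=\bigcup_jZ_j$ and $D=\max_j\operatorname{diam}Z_j$, a colorful $k$-partition is a partition $S=S_1\sqcup\dots\sqcup S_k$ with $|S_i\cap Z_j|=1$ for all $i\in[k],j\in[r]$. Then $\operatorname{Tv}_X(r,k)=\sup_{Z_1,\dots,Z_r}\inf\frac{\max_{i\in[k]}\operatorname{dist}(x,\operatorname{conv}S_i)}{D}$, the infimum over all points $x\in X$ and all colorful $k$-partitions. Selection. For $0<\theta<1$, $\operatorname{Sel}_X(r,\theta)$ is the supremum over finite $P\subset X$ with $|P|\ge r$ and positive diameter of the infimum over $x\in X$ of the infimum of all $\alpha>0$ such that at least $\theta\binom{|P|}{r}$ of the sets $A\in\binom{P}{r}$ satisfy $\operatorname{conv}A\cap(x+\alpha\operatorname{diam}(P)\mathbf B_X)\ne\emptyset$. Weak nets. $\operatorname{WeakNet}_X(\varepsilon,M)=\sup_P\ \inf_{F\subset X,\,|F|\le M}\ \sup_{Y\subset P,\,|Y|\ge\varepsilon|P|}\frac{\operatorname{dist}(F,\operatorname{conv}Y)}{\operatorname{diam}P}$, where $P$ ranges over finite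 subsets of $X$ of positive diameter. Helly. $\operatorname{Helly}_X(k)$ is the infimum of all $\alpha>0$ such that: for every finite family $\mathcal F$ of convex subsets of $\mathbf B_X$, if every subfamily of $\mathcal F$ of size at most $k$ has non-empty intersection, then there is $x\in X$ with $\operatorname{dist}(x,C)\le\alpha$ for every $C\in\mathcal F$. *)

theory Defs
  imports "HOL-Analysis.Analysis" "HOL-Probability.Probability"
begin

text \<open>
  All the moduli below take values in \<^typ>\<open>ennreal\<close>, where every supremum and infimum exists,
  the supremum of the empty set is 0 and the infimum of the empty set is \<open>\<infinity>\<close>.
\<close>

text \<open>
  This differs from \<^const>\<open>setdist\<close> only if one of the sets is empty: then \<^const>\<open>setdist\<close> is 0,
  whereas the infimum is \<open>\<infinity>\<close>.  The difference matters for weak nets, where the empty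
  net must not count as close to anything.
\<close>

definition set_edist :: "'a::metric_space set \<Rightarrow> 'a set \<Rightarrow> ennreal" where
  "set_edist A B = (INF a\<in>A. INF b\<in>B. ennreal (dist a b))"

lemma set_edist_eq_setdist:
  assumes "A \<noteq> {}" "B \<noteq> {}"
  shows "set_edist A B = ennreal (setdist A B)"
proof (rule antisym)
  show "ennreal (setdist A B) \<le> set_edist A B"
    unfolding set_edist_def by (intro INF_greatest ennreal_leI setdist_le_dist)
  show "set_edist A B \<le> ennreal (setdist A B)"
  proof (rule ennreal_le_epsilon)
    fix e :: real assume "0 < e"
    then have "setdist A B < setdist A B + e" by simp
    then obtain a b where ab: "a \<in> A" "b \<in> B" "dist a b < setdist A B + e"
      using assms setdist_ltE by metis
    have "set_edist A B \<le> ennreal (dist a b)"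
      unfolding set_edist_def using ab by (meson INF_lower2 order_refl)
    also have "\<dots> \<le> ennreal (setdist A B + e)" using ab by (intro ennreal_leI) simp
    also have "\<dots> = ennreal (setdist A B) + ennreal e"
      using \<open>0 < e\<close> by (simp add: ennreal_plus setdist_pos_le)
    finally show "set_edist A B \<le> ennreal (setdist A B) + ennreal e" .
  qed
qed

definition rademacher :: "nat \<Rightarrow> (nat \<Rightarrow> real) pmf" where
  "rademacher m = Pi_pmf {1..m} 0 (\<lambda>_. pmf_of_set {-1, 1})"

definition has_type :: "'a::real_normed_vector itself \<Rightarrow> real \<Rightarrow> bool" where
  "has_type _ p \<longleftrightarrow> p \<in> {1..2} \<and>
     (\<exists>T::real. \<forall>(m::nat) (x :: nat \<Rightarrow> 'a).
        (measure_pmf.expectation (rademacher m)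
           (\<lambda>\<epsilon>. norm (\<Sum>i=1..m. \<epsilon> i *\<^sub>R x i) powr p)) powr (1 / p)
        \<le> T * (\<Sum>i=1..m. norm (x i) powr p) powr (1 / p))"

definition has_infratype :: "'a::real_normed_vector itself \<Rightarrow> real \<Rightarrow> bool" where
  "has_infratype _ p \<longleftrightarrow> p \<in> {1..2} \<and>
     (\<exists>I::real. \<forall>(m::nat) (x :: nat \<Rightarrow> 'a).
        (MIN \<theta>\<in>{1..m} \<rightarrow>\<^sub>E {-1, 1::real}. norm (\<Sum>i=1..m. \<theta> i *\<^sub>R x i))
        \<le> I * (\<Sum>i=1..m. norm (x i) powr p) powr (1 / p))"

definition nontrivial_type :: "'a::real_normed_vector itself \<Rightarrow> bool" where
  "nontrivial_type X \<longleftrightarrow> (\<exists>p>1. has_type X p)"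

definition nontrivial_infratype :: "'a::real_normed_vector itself \<Rightarrow> bool" where
  "nontrivial_infratype X \<longleftrightarrow> (\<exists>p>1. has_infratype X p)"

definition conv_k :: "nat \<Rightarrow> 'a::real_vector set \<Rightarrow> 'a set" where
  "conv_k k P = {\<Sum>i=1..s. l i *\<^sub>R x i | (s::nat) (l :: nat \<Rightarrow> real) (x :: nat \<Rightarrow> 'a).
     1 \<le> s \<and> s \<le> k \<and> (\<forall>i\<in>{1..s}. x i \<in> P \<and> 0 \<le> l i) \<and> (\<Sum>i=1..s. l i) = 1}"

definition Car :: "'a::real_normed_vector itself \<Rightarrow> nat \<Rightarrow> ennreal" where
  "Car _ k = (SUP P\<in>{P :: 'a set. bounded P \<and> 0 < diameter P}.
     SUP a\<in>convex hull P. set_edist {a} (conv_k k P) / ennreal (diameter P))"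

definition colour_classes :: "nat \<Rightarrow> nat \<Rightarrow> (nat \<Rightarrow> 'a set) set" where
  "colour_classes r c = {Z. disjoint_family_on Z {1..r} \<and>
     (\<forall>j\<in>{1..r}. finite (Z j) \<and> card (Z j) = c)}"

definition max_diameter :: "nat \<Rightarrow> (nat \<Rightarrow> 'a::metric_space set) \<Rightarrow> real" where
  "max_diameter r Z = (MAX j\<in>{1..r}. diameter (Z j))"

definition balanced_splits :: "nat \<Rightarrow> nat \<Rightarrow> (nat \<Rightarrow> 'a set) \<Rightarrow> ('a set \<times> 'a set) set" where
  "balanced_splits n r Z = {(Q0, Q1). Q0 \<union> Q1 = (\<Union>j\<in>{1..r}. Z j) \<and> Q0 \<inter> Q1 = {} \<and>
     (\<forall>j\<in>{1..r}. card (Q0 \<inter> Z j) = n \<and> card (Q1 \<inter> Z j) = n)}"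

text \<open>\<open>Radon X n r\<close> is the modulus usually written \<open>Radon\<close> with arguments \<open>2n\<close> and \<open>r\<close>:
  the colour classes have \<open>2n\<close> points each.\<close>

definition Radon :: "'a::real_normed_vector itself \<Rightarrow> nat \<Rightarrow> nat \<Rightarrow> ennreal" where
  "Radon _ n r = (SUP Z\<in>(colour_classes r (2 * n) :: (nat \<Rightarrow> 'a set) set).
     INF (Q0, Q1)\<in>balanced_splits n r Z.
       set_edist (convex hull Q0) (convex hull Q1) / ennreal (max_diameter r Z))"

definition colourful_partitions :: "nat \<Rightarrow> nat \<Rightarrow> (nat \<Rightarrow> 'a set) \<Rightarrow> (nat \<Rightarrow> 'a set) set" where
  "colourful_partitions r k Z = {S. (\<Union>i\<in>{1..k}. S i) = (\<Union>j\<in>{1..r}. Z j) \<and>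
     disjoint_family_on S {1..k} \<and> (\<forall>i\<in>{1..k}. \<forall>j\<in>{1..r}. card (S i \<inter> Z j) = 1)}"

definition Tv :: "'a::real_normed_vector itself \<Rightarrow> nat \<Rightarrow> nat \<Rightarrow> ennreal" where
  "Tv _ r k = (SUP Z\<in>(colour_classes r k :: (nat \<Rightarrow> 'a set) set).
     INF x. INF S\<in>colourful_partitions r k Z.
       (MAX i\<in>{1..k}. set_edist {x} (convex hull (S i))) / ennreal (max_diameter r Z))"

definition Sel :: "'a::real_normed_vector itself \<Rightarrow> nat \<Rightarrow> real \<Rightarrow> ennreal" where
  "Sel _ r \<theta> = (SUP P\<in>{P :: 'a set. finite P \<and> r \<le> card P \<and> 0 < diameter P}.
     INF x. INF \<alpha>\<in>{\<alpha>::real. 0 < \<alpha> \<and>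
         \<theta> * real (card P choose r)
         \<le> real (card {A. A \<subseteq> P \<and> card A = r \<and>
                 convex hull A \<inter> cball x (\<alpha> * diameter P) \<noteq> {}})}.
       ennreal \<alpha>)"

definition WeakNet :: "'a::real_normed_vector itself \<Rightarrow> real \<Rightarrow> nat \<Rightarrow> ennreal" where
  "WeakNet _ \<epsilon> M = (SUP P\<in>{P :: 'a set. finite P \<and> 0 < diameter P}.
     INF F\<in>{F. finite F \<and> card F \<le> M}.
       SUP Y\<in>{Y. Y \<subseteq> P \<and> \<epsilon> * real (card P) \<le> real (card Y)}.
         set_edist F (convex hull Y) / ennreal (diameter P))"

definition Helly :: "'a::real_normed_vector itself \<Rightarrow> nat \<Rightarrow> ennreal" where
  "Helly _ k = (INF \<alpha>\<in>{\<alpha>::real. 0 < \<alpha> \<and>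
     (\<forall>\<F> :: 'a set set. finite \<F> \<longrightarrow> (\<forall>C\<in>\<F>. convex C \<and> C \<subseteq> cball 0 1) \<longrightarrow>
        (\<forall>\<G>\<subseteq>\<F>. card \<G> \<le> k \<longrightarrow> \<Inter>\<G> \<noteq> {}) \<longrightarrow>
        (\<exists>x. \<forall>C\<in>\<F>. set_edist {x} C \<le> ennreal \<alpha>))}.
     ennreal \<alpha>)"

end

theory Submission
  imports Defs
begin

text \<open>
  Every assertion is equivalent to B-convexity: for some \<open>n\<close> and \<open>\<delta> > 0\<close>, any \<open>n\<close> vectors of the
  unit ball admit signs whose signed sum has norm at most \<open>(1 - \<delta>) n\<close>.

  If \<open>X\<close> is B-convex, some quadratic average of signed sums of \<open>n\<close> vectors is below its trivial bound
  by a factor \<open>c < 1\<close>, and iterating over blocks gives the factor \<open>c ^ j\<close> for \<open>n ^ j\<close> vectors.  This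
  yields type \<open>p > 1\<close>, and by symmetrization it shows that the mean of many independent points is
  close to its expectation, which gives the Caratheodory, Radon, Tverberg, selection and weak net
  statements.  The Helly statement needs the dual inequality, which bounds the Rademacher
  coefficients of an \<open>X\<close>-valued function on the cube; it also self-improves over blocks, and this
  avoids the dual space and the Hahn-Banach theorem.

  If \<open>X\<close> is not B-convex, it contains copies of the \<open>l1\<close> spaces of all finite dimensions with a
  uniform constant, and each statement fails for a configuration of basis vectors.
\<close>

section \<open>Averages over product weights\<close>

text \<open>B-convexity supplies one good sign pattern, and only for vectors of comparable norm;
  neither feature survives the passage to blocks. The quadratic mean repairs both: if the norms are
  nearly equal, one good pattern lowers the average over all patterns by a fixed fraction, and if
  they are not, Cauchy-Schwarz already loses a fixed fraction. Sign flips preserve averages, so this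
  factor multiplies from block to block.

  For Helly the chosen point is an arbitrary function of the signs and not a signed sum. What is
  needed there is that most first-order Rademacher coefficients of a bounded function are small.
  Moreover, sampling handles only a fixed weighting of the family, and a separate argument merges
  the answers for many weightings into one point.

  In the converse direction the l1 estimate is used only through coefficients: points close to each
  other put nearly the same mass on every set of basis vectors, so each counterexample becomes a
  statement on probability vectors.\<close>

locale weights =
  fixes A :: "'a set" and w :: "'a \<Rightarrow> real"
  assumes finite_A: "finite A"
    and w_nonneg: "\<And>a. a \<in> A \<Longrightarrow> 0 \<le> w a"
    and w_sum: "(\<Sum>a\<in>A. w a) = 1"

text \<open>The expectation of \<open>F\<close> under independent coordinates of law
  \<open>w\<close>, as a finite sum: exchanging two averages is then \<open>sum.swap\<close>, and
  the values may lie in any real vector space.\<close>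

definition pavg :: "'i set \<Rightarrow> 'a set \<Rightarrow> ('a \<Rightarrow> real) \<Rightarrow> (('i \<Rightarrow> 'a) \<Rightarrow> 'b) \<Rightarrow> 'b::real_vector" where
  "pavg J A w F = (\<Sum>y\<in>J \<rightarrow>\<^sub>E A. (\<Prod>j\<in>J. w (y j)) *\<^sub>R F y)"

lemma pavg_cong: "(\<And>y. y \<in> J \<rightarrow>\<^sub>E A \<Longrightarrow> F y = G y) \<Longrightarrow> pavg J A w F = pavg J A w G"
  unfolding pavg_def by (rule sum.cong) auto

lemma pavg_add: "pavg J A w (\<lambda>y. F y + G y) = pavg J A w F + pavg J A w G"
  unfolding pavg_def by (simp add: scaleR_add_right sum.distrib)

lemma pavg_scaleR: "pavg J A w (\<lambda>y. c *\<^sub>R F y) = c *\<^sub>R pavg J A w F"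
  unfolding pavg_def by (simp add: scaleR_sum_right mult.commute)

lemma pavg_mult: "pavg J A w (\<lambda>y. c * F y) = c * pavg J A w F" for c :: real
  using pavg_scaleR[of J A w c F] by simp

lemma pavg_minus: "pavg J A w (\<lambda>y. - F y) = - pavg J A w F"
  using pavg_scaleR[of J A w "-1" F] by simp

lemma pavg_diff: "pavg J A w (\<lambda>y. F y - G y) = pavg J A w F - pavg J A w G"
  unfolding pavg_def by (simp add: scaleR_diff_right sum_subtractf)

lemma pavg_sum: "pavg J A w (\<lambda>y. \<Sum>k\<in>K. F k y) = (\<Sum>k\<in>K. pavg J A w (F k))"
  unfolding pavg_def by (simp add: scaleR_sum_right) (rule sum.swap)

lemma pavg_swap:
  "pavg J A w (\<lambda>y. pavg K B v (\<lambda>z. F y z)) = pavg K B v (\<lambda>z. pavg J A w (\<lambda>y. F y z))"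
  unfolding pavg_def scaleR_sum_right scaleR_scaleR
  by (subst sum.swap) (simp add: mult.commute)

lemma pavg_insert:
  assumes "finite J" "i \<notin> J" 
  shows "pavg (insert i J) A w F = (\<Sum>a\<in>A. w a *\<^sub>R pavg J A w (\<lambda>g. F (g(i := a))))"
proof -
  have inj: "inj_on (\<lambda>(y, g). g(i := y)) (A \<times> (J \<rightarrow>\<^sub>E A))"
    using inj_combinator[OF assms(2), of "\<lambda>_. A"] by simp
  have "pavg (insert i J) A w F
      = (\<Sum>(a, g)\<in>A \<times> (J \<rightarrow>\<^sub>E A). (\<Prod>j\<in>insert i J. w ((g(i := a)) j)) *\<^sub>R F (g(i := a)))"
    unfolding pavg_def PiE_insert_eq by (subst sum.reindex[OF inj]) (simp add: case_prod_unfold)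
  also have "\<dots> = (\<Sum>(a, g)\<in>A \<times> (J \<rightarrow>\<^sub>E A). w a *\<^sub>R (\<Prod>j\<in>J. w (g j)) *\<^sub>R F (g(i := a)))"
  proof -
    have "(\<Prod>j\<in>insert i J. w ((g(i := a)) j)) = w a * (\<Prod>j\<in>J. w (g j))" for a g
    proof -
      have "(\<Prod>j\<in>J. w ((g(i := a)) j)) = (\<Prod>j\<in>J. w (g j))"
        by (rule prod.cong) (use assms in auto)
      then show ?thesis using assms by simp
    qed
    then show ?thesis by simp
  qed
  also have "\<dots> = (\<Sum>a\<in>A. w a *\<^sub>R pavg J A w (\<lambda>g. F (g(i := a))))"
    unfolding pavg_def scaleR_sum_right by (rule sum.cartesian_product[symmetric])
  finally show ?thesis .
qed

context weights
begin

lemma prod_w_nonneg: "y \<in> J \<rightarrow>\<^sub>E A \<Longrightarrow> 0 \<le> (\<Prod>j\<in>J. w (y j))"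
  by (rule prod_nonneg) (auto intro: w_nonneg)

lemma sum_prod_w: "finite J \<Longrightarrow> (\<Sum>y\<in>J \<rightarrow>\<^sub>E A. \<Prod>j\<in>J. w (y j)) = 1"
  using prod_sum_PiE[of J "\<lambda>_. A" "\<lambda>_. w"] by (simp add: finite_A w_sum)

lemma pavg_const: "finite J \<Longrightarrow> pavg J A w (\<lambda>_. c) = c"
  unfolding pavg_def scaleR_sum_left[symmetric] by (simp add: sum_prod_w)

lemma pavg_mono:
  fixes F G :: "_ \<Rightarrow> real"
  assumes "\<And>y. y \<in> J \<rightarrow>\<^sub>E A \<Longrightarrow> F y \<le> G y"
  shows "pavg J A w F \<le> pavg J A w G"
  unfolding pavg_def by (rule sum_mono) (simp add: assms mult_left_mono prod_w_nonneg)

lemma pavg_le: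
  fixes F :: "_ \<Rightarrow> real"
  assumes "finite J" "\<And>y. y \<in> J \<rightarrow>\<^sub>E A \<Longrightarrow> F y \<le> c"
  shows "pavg J A w F \<le> c"
  using pavg_mono[of J F "\<lambda>_. c"] assms by (simp add: pavg_const)

lemma pavg_ge:
  fixes F :: "_ \<Rightarrow> real"
  assumes "finite J" "\<And>y. y \<in> J \<rightarrow>\<^sub>E A \<Longrightarrow> c \<le> F y"
  shows "c \<le> pavg J A w F"
  using pavg_mono[of J "\<lambda>_. c" F] assms by (simp add: pavg_const)

lemma pavg_nonneg:
  fixes F :: "_ \<Rightarrow> real"
  assumes "\<And>y. y \<in> J \<rightarrow>\<^sub>E A \<Longrightarrow> 0 \<le> F y"
  shows "0 \<le> pavg J A w F"
  unfolding pavg_def by (rule sum_nonneg) (simp add: assms prod_w_nonneg)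

lemma norm_pavg_le: "norm (pavg J A w F) \<le> pavg J A w (\<lambda>y. norm (F y))"
  unfolding pavg_def by (rule sum_norm_le) (simp add: prod_w_nonneg)

lemma pavg_component:
  assumes "finite J" "i \<in> J"
  shows "pavg J A w (\<lambda>y. f (y i)) = (\<Sum>a\<in>A. w a *\<^sub>R f a)"
proof -
  obtain K where "J = insert i K" "i \<notin> K" using assms by (metis mk_disjoint_insert)
  then show ?thesis using assms by (simp add: pavg_insert pavg_const)
qed

lemma exists_le_pavg:
  fixes F :: "_ \<Rightarrow> real"
  assumes "finite J" "pavg J A w F \<le> c"
  obtains y where "y \<in> J \<rightarrow>\<^sub>E A" "F y \<le> c"
proof (rule ccontr)
  assume "\<not> thesis"
  then have gt: "c < F y" if "y \<in> J \<rightarrow>\<^sub>E A" for y using that \<open>\<And>y. _ \<Longrightarrow> _ \<Longrightarrow> thesis\<close> by force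
  have fin: "finite (J \<rightarrow>\<^sub>E A)" using assms finite_A by (simp add: finite_PiE)
  \<comment> \<open>Weights may vanish, so strictness needs one \<open>y\<close> of positive weight;
    the total weight 1 provides it.\<close>
  have "\<exists>y\<in>J \<rightarrow>\<^sub>E A. (\<Prod>j\<in>J. w (y j)) > 0"
  proof (rule ccontr)
    assume "\<not> ?thesis"
    then have "(\<Sum>y\<in>J \<rightarrow>\<^sub>E A. \<Prod>j\<in>J. w (y j)) \<le> 0" by (intro sum_nonpos) force
    then show False using sum_prod_w[OF assms(1)] by simp
  qed
  then obtain y0 where y0: "y0 \<in> J \<rightarrow>\<^sub>E A" "(\<Prod>j\<in>J. w (y0 j)) > 0" by blast
  have "pavg J A w (\<lambda>_. c) < pavg J A w F"
    unfolding pavg_def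
  proof (rule sum_strict_mono_ex1[OF fin])
    show "\<forall>y\<in>J \<rightarrow>\<^sub>E A. (\<Prod>j\<in>J. w (y j)) *\<^sub>R c \<le> (\<Prod>j\<in>J. w (y j)) *\<^sub>R F y"
      using gt by (auto intro!: mult_left_mono prod_w_nonneg dest: less_imp_le)
    show "\<exists>y\<in>J \<rightarrow>\<^sub>E A. (\<Prod>j\<in>J. w (y j)) *\<^sub>R c < (\<Prod>j\<in>J. w (y j)) *\<^sub>R F y"
      using y0 gt[OF y0(1)] by (intro bexI[of _ y0]) auto
  qed
  then show False using assms by (simp add: pavg_const)
qed

lemma square_pavg_le:
  fixes F :: "_ \<Rightarrow> real"
  assumes "finite J"
  shows "(pavg J A w F)\<^sup>2 \<le> pavg J A w (\<lambda>y. (F y)\<^sup>2)"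
proof -
  define m where "m = pavg J A w F"
  have "0 \<le> pavg J A w (\<lambda>y. (F y - m)\<^sup>2)" by (rule pavg_nonneg) simp
  also have "\<dots> = pavg J A w (\<lambda>y. (F y)\<^sup>2 - (2 * m) * F y + m\<^sup>2)"
    by (rule pavg_cong) (simp add: power2_eq_square algebra_simps)
  also have "\<dots> = pavg J A w (\<lambda>y. (F y)\<^sup>2) - 2 * m * m + m\<^sup>2"
    using assms by (simp only: pavg_add pavg_diff pavg_mult pavg_const m_def)
  finally show ?thesis by (simp add: m_def power2_eq_square)
qed

lemma square_norm_pavg_le:
  assumes "finite J"
  shows "(norm (pavg J A w F))\<^sup>2 \<le> pavg J A w (\<lambda>y. (norm (F y))\<^sup>2)"
proof -
  have "(norm (pavg J A w F))\<^sup>2 \<le> (pavg J A w (\<lambda>y. norm (F y)))\<^sup>2"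
    by (intro power_mono norm_pavg_le) simp
  also have "\<dots> \<le> pavg J A w (\<lambda>y. (norm (F y))\<^sup>2)" by (rule square_pavg_le[OF assms])
  finally show ?thesis .
qed

lemma pavg_in_convex:
  assumes "finite J" "convex C" "\<And>y. y \<in> J \<rightarrow>\<^sub>E A \<Longrightarrow> F y \<in> C"
  shows "pavg J A w F \<in> C"
  unfolding pavg_def
  by (rule convex_sum) (use assms in \<open>auto simp: finite_A finite_PiE sum_prod_w prod_w_nonneg\<close>)

end

section \<open>Uniform averages over the sign cube\<close>

abbreviation signs :: "'i set \<Rightarrow> ('i \<Rightarrow> real) set" where
  "signs L \<equiv> L \<rightarrow>\<^sub>E {-1, 1}"

abbreviation savg :: "'i set \<Rightarrow> (('i \<Rightarrow> real) \<Rightarrow> 'b) \<Rightarrow> 'b::real_vector" where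
  "savg L F \<equiv> pavg L {-1, 1} (\<lambda>_. 1/2) F"

interpretation signs: weights "{-1, 1::real}" "\<lambda>_. 1/2"
  by unfold_locales auto

lemma abs_sign: "\<theta> \<in> signs L \<Longrightarrow> l \<in> L \<Longrightarrow> \<bar>\<theta> l\<bar> = 1"
  by (auto simp: PiE_iff)

lemma norm_sign_scaleR: "\<theta> \<in> signs L \<Longrightarrow> l \<in> L \<Longrightarrow> norm (\<theta> l *\<^sub>R z) = norm z"
  by (simp add: abs_sign)

lemma finite_signs: "finite L \<Longrightarrow> finite (signs L)"
  by (simp add: finite_PiE)

lemma card_signs: "finite L \<Longrightarrow> card (signs L) = 2 ^ card L"
  by (simp add: card_PiE numeral_2_eq_2)

lemma savg_eq_sum: "savg L F = (1/2) ^ card L *\<^sub>R (\<Sum>\<theta>\<in>signs L. F \<theta>)"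
  unfolding pavg_def by (simp add: scaleR_sum_right)

text \<open>Flipping fixed coordinates is an involution of the cube; the restriction to
  \<open>L\<close> keeps the flipped pattern extensional.\<close>

lemma savg_flip:
  assumes s: "\<And>l. l \<in> L \<Longrightarrow> s l \<in> {-1, 1::real}"
  shows "savg L (\<lambda>\<theta>. F (\<lambda>l\<in>L. s l * \<theta> l)) = savg L F"
proof -
  have ss: "s l * (s l * t) = t" if "l \<in> L" for l t using s[OF that] by auto
  have "(\<Sum>\<theta>\<in>signs L. F (\<lambda>l\<in>L. s l * \<theta> l)) = (\<Sum>\<theta>\<in>signs L. F \<theta>)"
    by (rule sum.reindex_bij_witness[where i = "\<lambda>\<theta>. \<lambda>l\<in>L. s l * \<theta> l" and j = "\<lambda>\<theta>. \<lambda>l\<in>L. s l * \<theta> l"])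
       (use s in \<open>fastforce simp: ss PiE_iff extensional_def fun_eq_iff\<close>)+
  then show ?thesis by (simp add: savg_eq_sum)
qed

lemma savg_insert:
  assumes "finite J" "i \<notin> J"
  shows "savg (insert i J) F
    = (1/2) *\<^sub>R savg J (\<lambda>\<theta>. F (\<theta>(i := 1))) + (1/2) *\<^sub>R savg J (\<lambda>\<theta>. F (\<theta>(i := -1)))"
  by (subst pavg_insert[OF assms]) simp

section \<open>B-convexity and its self-improvement\<close>

definition B_convex :: "'a::real_normed_vector itself \<Rightarrow> bool" where
  "B_convex _ \<longleftrightarrow> (\<exists>n\<ge>2. \<exists>\<delta>>0. \<forall>x :: nat \<Rightarrow> 'a. (\<forall>i\<in>{1..n}. norm (x i) \<le> 1) \<longrightarrow>
     (\<exists>\<theta>\<in>signs {1..n}. norm (\<Sum>i=1..n. \<theta> i *\<^sub>R x i) \<le> (1 - \<delta>) * real n))"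

lemma B_convexE:
  assumes "B_convex (X :: 'a::real_normed_vector itself)"
  obtains n \<delta> where "n \<ge> 2" "0 < \<delta>" "\<delta> \<le> 1"
    "\<forall>(x :: nat \<Rightarrow> 'a) t. (\<forall>i\<in>{1..n}. norm (x i) \<le> t) \<longrightarrow>
       (\<exists>\<theta>\<in>signs {1..n}. norm (\<Sum>i=1..n. \<theta> i *\<^sub>R x i) \<le> (1 - \<delta>) * real n * t)"
proof -
  obtain n \<delta> where n: "n \<ge> 2" "\<delta> > 0" and *: "\<And>x :: nat \<Rightarrow> 'a. (\<forall>i\<in>{1..n}. norm (x i) \<le> 1) \<Longrightarrow>
     (\<exists>\<theta>\<in>signs {1..n}. norm (\<Sum>i=1..n. \<theta> i *\<^sub>R x i) \<le> (1 - \<delta>) * real n)"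
    using assms unfolding B_convex_def by blast
  \<comment> \<open>The zero vectors show that the bound is nonnegative, which caps
    \<open>\<delta>\<close>.\<close>
  have "0 \<le> (1 - \<delta>) * real n" using *[of "\<lambda>_. 0"] by auto
  then have "\<delta> \<le> 1" using n by (auto simp: zero_le_mult_iff)
  show ?thesis
  proof (rule that[OF n \<open>\<delta> \<le> 1\<close>], intro allI impI)
    fix x :: "nat \<Rightarrow> 'a" and t assume "\<forall>i\<in>{1..n}. norm (x i) \<le> t"
    then have le: "norm (x i) \<le> t" if "i \<in> {1..n}" for i using that by blast
    have "0 \<le> t" using order_trans[OF norm_ge_zero le[of 1]] n by simp
    show "\<exists>\<theta>\<in>signs {1..n}. norm (\<Sum>i=1..n. \<theta> i *\<^sub>R x i) \<le> (1 - \<delta>) * real n * t"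
    proof (cases "t = 0")
      case True
      then have "\<And>i. i \<in> {1..n} \<Longrightarrow> x i = 0" using le by fastforce
      moreover have "(\<lambda>i\<in>{1..n}. 1) \<in> signs {1..n}" by auto
      ultimately show ?thesis using True by (intro bexI[of _ "\<lambda>i\<in>{1..n}. 1"]) auto
    next
      case False
      then have t: "t > 0" using \<open>0 \<le> t\<close> by simp
      obtain \<theta> where \<theta>: "\<theta> \<in> signs {1..n}"
        "norm (\<Sum>i=1..n. \<theta> i *\<^sub>R (x i /\<^sub>R t)) \<le> (1 - \<delta>) * real n"
        using *[of "\<lambda>i. x i /\<^sub>R t"] le t by (auto simp: field_simps)
      have "(\<Sum>i=1..n. \<theta> i *\<^sub>R (x i /\<^sub>R t)) = (\<Sum>i=1..n. \<theta> i *\<^sub>R x i) /\<^sub>R t"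
        by (simp add: scaleR_sum_right mult.commute)
      then show ?thesis using \<theta> t by (intro bexI[OF _ \<theta>(1)]) (simp add: field_simps)
    qed
  qed
qed

text \<open>Stability of Cauchy-Schwarz: with \<open>q\<close> the quadratic mean, the sum of the
  \<open>(t i - q)\<^sup>2\<close> is \<open>2 * q\<close> times the amount by which the sum of the
  \<open>t i\<close> falls short of \<open>card S * q\<close>. A single term far above
  \<open>q\<close> therefore forces a deficit.\<close>

lemma sum_le_of_quadratic_mean:
  fixes t :: "'i \<Rightarrow> real"
  assumes "finite S" "s \<in> S" "0 \<le> \<gamma>" "0 \<le> q" "(1 + \<gamma>) * q < t s"
    and sq: "(\<Sum>i\<in>S. (t i)\<^sup>2) = real (card S) * q\<^sup>2"
  shows "(\<Sum>i\<in>S. t i) \<le> (real (card S) - \<gamma>\<^sup>2 / 2) * q"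
proof -
  have q: "q \<noteq> 0"
  proof
    assume "q = 0"
    then have "\<forall>i\<in>S. (t i)\<^sup>2 = 0" using sq sum_nonneg_eq_0_iff[OF assms(1), of "\<lambda>i. (t i)\<^sup>2"] by simp
    then show False using assms \<open>q = 0\<close> by auto
  qed
  then have q: "q > 0" using assms by simp
  have "(\<gamma> * q)\<^sup>2 \<le> (t s - q)\<^sup>2" using assms by (intro power_mono) (auto simp: algebra_simps)
  also have "\<dots> \<le> (\<Sum>i\<in>S. (t i - q)\<^sup>2)" using assms by (intro member_le_sum) auto
  also have "\<dots> = (\<Sum>i\<in>S. (t i)\<^sup>2 + q\<^sup>2 - 2 * q * t i)"
    by (rule sum.cong) (auto simp: power2_eq_square algebra_simps)
  also have "\<dots> = 2 * real (card S) * q\<^sup>2 - 2 * q * (\<Sum>i\<in>S. t i)"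
    by (simp add: sum.distrib sum_subtractf sq sum_distrib_left)
  finally have "2 * q * (\<Sum>i\<in>S. t i) \<le> 2 * q * ((real (card S) - \<gamma>\<^sup>2 / 2) * q)"
    by (simp add: power2_eq_square algebra_simps)
  then show ?thesis using q by simp
qed

text \<open>This is where one good pattern, of probability \<open>1 / 2 ^ card L\<close>, becomes a
  gain for the whole average.\<close>

lemma savg_le_improve:
  fixes F :: "_ \<Rightarrow> real"
  assumes "finite L" "\<theta> \<in> signs L" "F \<theta> \<le> m" "\<And>\<eta>. \<eta> \<in> signs L \<Longrightarrow> F \<eta> \<le> M"
  shows "savg L F \<le> M - (M - m) / 2 ^ card L"
proof -
  have "sum F (signs L) = F \<theta> + sum F (signs L - {\<theta>})"
    using assms by (simp add: sum.remove finite_signs)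
  also have "\<dots> \<le> m + real (card (signs L - {\<theta>})) * M"
    using assms by (intro add_mono sum_bounded_above) auto
  also have "real (card (signs L - {\<theta>})) = 2 ^ card L - 1"
    using assms by (simp add: card_signs finite_signs)
  finally have "(1/2) ^ card L * sum F (signs L) \<le> (1/2) ^ card L * (m + (2 ^ card L - 1) * M)"
    by (intro mult_left_mono) auto
  then show ?thesis by (simp add: savg_eq_sum field_simps power_divide)
qed

lemma norm_signed_sum_le:
  assumes "\<theta> \<in> signs L" "J \<subseteq> L"
  shows "norm (\<Sum>i\<in>J. \<theta> i *\<^sub>R x i) \<le> (\<Sum>i\<in>J. norm (x i))"
  by (rule sum_norm_le) (use assms in \<open>auto simp: norm_sign_scaleR[OF assms(1)] simp del: norm_scaleR\<close>)

text \<open>Compare the norms with their quadratic mean \<open>q\<close>. If none exceeds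
  \<open>(1 + \<delta>/2) * q\<close>, B-convexity with that radius gives a good pattern, while all
  others obey the Cauchy-Schwarz bound \<open>real n * q\<close>. If some norm exceeds it, the sum
  of the norms is itself below \<open>real n * q\<close> by a fixed factor, and this serves every
  pattern.\<close>

lemma B_convex_quadratic:
  assumes "B_convex (X :: 'a::real_normed_vector itself)"
  obtains n c where "n \<ge> 2" "1/4 \<le> c" "c < 1"
    "\<And>x :: nat \<Rightarrow> 'a. savg {1..n} (\<lambda>\<theta>. (norm (\<Sum>i=1..n. \<theta> i *\<^sub>R x i))\<^sup>2)
       \<le> c * real n * (\<Sum>i=1..n. (norm (x i))\<^sup>2)"
proof -
  obtain n \<delta> where n: "n \<ge> 2" "0 < \<delta>" "\<delta> \<le> 1" and B:
    "\<forall>(x :: nat \<Rightarrow> 'a) t. (\<forall>i\<in>{1..n}. norm (x i) \<le> t) \<longrightarrow>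
       (\<exists>\<theta>\<in>signs {1..n}. norm (\<Sum>i=1..n. \<theta> i *\<^sub>R x i) \<le> (1 - \<delta>) * real n * t)"
    using B_convexE[OF assms] by blast
  \<comment> \<open>The last two terms are the factors of the two cases: a gain of
    \<open>\<delta>/2\<close> at one pattern among \<open>2 ^ n\<close>, and the deficit of
    \<open>sum_le_of_quadratic_mean\<close> at \<open>\<gamma> = \<delta>/2\<close>. The floor
    \<open>1/4\<close> keeps \<open>ln (sqrt c)\<close> meaningful when the type exponent is
    chosen.\<close>
  define c where "c = max (1/4) (max (1 - \<delta> / 2 ^ (n + 1)) (1 - \<delta>\<^sup>2 / (8 * real n)))"
  have c: "1/4 \<le> c" "c < 1" using n by (auto simp: c_def)
  show ?thesis
  proof (rule that[OF n(1) c])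
    fix x :: "nat \<Rightarrow> 'a"
    define q where "q = sqrt ((\<Sum>i=1..n. (norm (x i))\<^sup>2) / real n)"
    have q0: "q \<ge> 0" by (simp add: q_def sum_nonneg)
    have q: "(\<Sum>i=1..n. (norm (x i))\<^sup>2) = real (card {1..n}) * q\<^sup>2"
      using n by (simp add: q_def sum_nonneg)
    define Y where "Y \<theta> = norm (\<Sum>i=1..n. \<theta> i *\<^sub>R x i)" for \<theta> :: "nat \<Rightarrow> real"
    have Y0: "Y \<theta> \<ge> 0" for \<theta> by (simp add: Y_def)
    have Yle: "Y \<theta> \<le> (\<Sum>i=1..n. norm (x i))" if "\<theta> \<in> signs {1..n}" for \<theta>
      unfolding Y_def by (rule norm_signed_sum_le[OF that]) simp
    have "savg {1..n} (\<lambda>\<theta>. (Y \<theta>)\<^sup>2) \<le> c * (real n * q)\<^sup>2"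
    proof (cases "\<forall>i\<in>{1..n}. norm (x i) \<le> (1 + \<delta>/2) * q")
      case True
      then obtain \<theta> where \<theta>: "\<theta> \<in> signs {1..n}"
        and le: "Y \<theta> \<le> (1 - \<delta>) * real n * ((1 + \<delta>/2) * q)"
        using B[rule_format, of x "(1 + \<delta>/2) * q"] by (auto simp: Y_def)
      \<comment> \<open>The threshold is tied to half of the gain, so enlarging the radius still
        leaves a gain of \<open>\<delta>/2\<close>.\<close>
      have "(1 - \<delta>) * (1 + \<delta>/2) \<le> 1 - \<delta>/2" using n by (simp add: algebra_simps)
      then have "(1 - \<delta>) * (1 + \<delta>/2) * (real n * q) \<le> (1 - \<delta>/2) * (real n * q)"
        using q0 by (intro mult_right_mono) auto
      with le have "Y \<theta> \<le> (1 - \<delta>/2) * (real n * q)" by (simp add: ac_simps)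
      then have "(Y \<theta>)\<^sup>2 \<le> ((1 - \<delta>/2) * (real n * q))\<^sup>2" by (intro power_mono Y0)
      also have "\<dots> = (1 - \<delta>/2)\<^sup>2 * (real n * q)\<^sup>2" by (simp add: power_mult_distrib)
      also have "\<dots> \<le> (1 - \<delta>/2) * (real n * q)\<^sup>2"
        using n by (intro mult_right_mono) (auto simp: power2_eq_square intro: mult_left_le)
      finally have 1: "(Y \<theta>)\<^sup>2 \<le> (1 - \<delta>/2) * (real n * q)\<^sup>2" .
      have "(\<Sum>i=1..n. norm (x i))\<^sup>2 \<le> real n * (\<Sum>i=1..n. (norm (x i))\<^sup>2)"
        using sum_squared_le_sum_of_squares[of "\<lambda>i. norm (x i)" "{1..n}"] n by (simp add: mult.commute)
      then have "(\<Sum>i=1..n. norm (x i))\<^sup>2 \<le> (real n * q)\<^sup>2"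
        unfolding q by (simp add: power_mult_distrib power2_eq_square[of "real n"] ac_simps)
      then have 2: "(Y \<eta>)\<^sup>2 \<le> (real n * q)\<^sup>2" if "\<eta> \<in> signs {1..n}" for \<eta>
        using power_mono[OF Yle[OF that] Y0, of 2] by simp
      have "savg {1..n} (\<lambda>\<theta>. (Y \<theta>)\<^sup>2)
          \<le> (real n * q)\<^sup>2 - ((real n * q)\<^sup>2 - (1 - \<delta>/2) * (real n * q)\<^sup>2) / 2 ^ card {1..n}"
        by (rule savg_le_improve[where F = "\<lambda>\<theta>. (Y \<theta>)\<^sup>2", OF _ \<theta> 1 2]) auto
      also have "\<dots> = (1 - \<delta> / 2 ^ (n + 1)) * (real n * q)\<^sup>2" by (simp add: field_simps)
      also have "\<dots> \<le> c * (real n * q)\<^sup>2" by (intro mult_right_mono) (auto simp: c_def)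
      finally show ?thesis .
    next
      case False
      then obtain s where s: "s \<in> {1..n}" "(1 + \<delta>/2) * q < norm (x s)" by force
      have *: "(\<Sum>i=1..n. norm (x i)) \<le> (real (card {1..n}) - (\<delta>/2)\<^sup>2 / 2) * q"
        by (rule sum_le_of_quadratic_mean[where t = "\<lambda>i. norm (x i)", OF _ s(1) _ q0 s(2) q])
          (use n in auto)
      define k where "k = 1 - \<delta>\<^sup>2 / (8 * real n)"
      have "\<delta>\<^sup>2 \<le> 1" using n by (simp add: power_le_one)
      then have k: "0 \<le> k" "k \<le> 1" using n by (auto simp: k_def field_simps)
      have le: "(\<Sum>i=1..n. norm (x i)) \<le> k * (real n * q)"
      proof -
        have eq: "(real (card {1..n}) - (\<delta>/2)\<^sup>2 / 2) * q = k * (real n * q)"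
          using n by (simp add: k_def field_simps power2_eq_square)
        show ?thesis using * unfolding eq .
      qed
      have "(Y \<theta>)\<^sup>2 \<le> c * (real n * q)\<^sup>2" if "\<theta> \<in> signs {1..n}" for \<theta>
      proof -
        have "(Y \<theta>)\<^sup>2 \<le> (k * (real n * q))\<^sup>2"
          using Yle[OF that] le by (intro power_mono Y0) simp
        also have "\<dots> = k * k * (real n * q)\<^sup>2" by (simp add: power_mult_distrib power2_eq_square)
        also have "\<dots> \<le> c * (real n * q)\<^sup>2"
        proof (rule mult_right_mono)
          have "k * k \<le> k" using k by (simp add: mult_left_le)
          also have "k \<le> c" by (simp add: c_def k_def)
          finally show "k * k \<le> c" .
        qed simp
        finally show ?thesis .
      qed
      then show ?thesis by (intro signs.pavg_le) auto
    qed
    also have "\<dots> = c * real n * (\<Sum>i=1..n. (norm (x i))\<^sup>2)"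
      unfolding q by (simp add: power_mult_distrib power2_eq_square[of "real n"])
    finally show "savg {1..n} (\<lambda>\<theta>. (norm (\<Sum>i=1..n. \<theta> i *\<^sub>R x i))\<^sup>2)
       \<le> c * real n * (\<Sum>i=1..n. (norm (x i))\<^sup>2)" by (simp add: Y_def)
  qed
qed

text \<open>Number \<open>J\<close> and divide the numbers by \<open>s\<close>: stretches of length
  \<open>s\<close> become the blocks, labelled by \<open>H\<close>. Blocks may be short or empty,
  which lets index sets of any size be treated like full powers.\<close>

lemma exists_block_map:
  assumes "finite J" "finite H" "card J \<le> card H * s"
  obtains b where "b \<in> J \<rightarrow> H" "\<And>a. a \<in> H \<Longrightarrow> card {l \<in> J. b l = a} \<le> s"
proof (cases "s = 0")
  case True
  then have "J = {}" using assms by simp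
  then show ?thesis using that[of "\<lambda>_. undefined"] by simp
next
  case False
  obtain h where h: "bij_betw h J {0..<card J}" using ex_bij_betw_finite_nat[OF assms(1)] by blast
  obtain g where g: "bij_betw g {0..<card H} H" using ex_bij_betw_nat_finite[OF assms(2)] by blast
  have lt: "h l div s < card H" if "l \<in> J" for l
  proof -
    have "h l < card H * s" using bij_betwE[OF h] that assms(3) by fastforce
    then show ?thesis by (simp add: less_mult_imp_div_less)
  qed
  show ?thesis
  proof (rule that[of "\<lambda>l. g (h l div s)"])
    show "(\<lambda>l. g (h l div s)) \<in> J \<rightarrow> H" using lt bij_betwE[OF g] by auto
    fix a assume "a \<in> H"
    then obtain i where i: "i < card H" "g i = a" using g by (force simp: bij_betw_def)
    have "h ` {l \<in> J. g (h l div s) = a} \<subseteq> {i * s..<i * s + s}"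
    proof clarsimp
      fix l assume l: "l \<in> J" "a = g (h l div s)"
      then have "h l div s = i" using i lt[OF l(1)] g by (auto simp: bij_betw_def inj_on_def)
      then show "i * s \<le> h l \<and> h l < i * s + s"
        using False by (metis add.commute div_mult_mod_eq le_add1 mod_less_divisor nat_add_left_cancel_less neq0_conv)
    qed
    moreover have "inj_on h {l \<in> J. g (h l div s) = a}"
      using h by (auto simp: bij_betw_def inj_on_def)
    ultimately show "card {l \<in> J. g (h l div s) = a} \<le> s"
      using card_inj_on_le[of h _ "{i * s..<i * s + s}"] by simp
  qed
qed

text \<open>Flipping the signs blockwise does not change the average, so the inner sums over the
  blocks may be regarded as \<open>n\<close> fixed vectors with fresh signs.\<close>

lemma quadratic_bound_power:
  fixes x :: "'i \<Rightarrow> 'a::real_normed_vector"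
  assumes c: "0 \<le> c" and base: "\<And>y :: nat \<Rightarrow> 'a.
      savg {1..n} (\<lambda>\<theta>. (norm (\<Sum>i=1..n. \<theta> i *\<^sub>R y i))\<^sup>2) \<le> c * real n * (\<Sum>i=1..n. (norm (y i))\<^sup>2)"
    and "finite L" "J \<subseteq> L" "card J \<le> n ^ j" "\<And>l. l \<in> J \<Longrightarrow> norm (x l) \<le> D"
  shows "savg L (\<lambda>\<theta>. (norm (\<Sum>l\<in>J. \<theta> l *\<^sub>R x l))\<^sup>2) \<le> (c * (real n)\<^sup>2) ^ j * D\<^sup>2"
  using assms(5-6,4)
\<comment> \<open>The signs live on the fixed set \<open>L\<close> while \<open>J\<close> shrinks to
  a block, so all blocks are averaged over one cube.\<close>
proof (induction j arbitrary: J)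
  case 0
  have fJ: "finite J" using 0 \<open>finite L\<close> finite_subset by blast
  have "(norm (\<Sum>l\<in>J. \<theta> l *\<^sub>R x l))\<^sup>2 \<le> D\<^sup>2" if \<theta>: "\<theta> \<in> signs L" for \<theta>
  proof (cases "J = {}")
    case False
    then have "card J = 1" using 0 fJ by (simp add: le_Suc_eq)
    then obtain l where l: "J = {l}" by (auto simp: card_1_singleton_iff)
    have "\<bar>\<theta> l\<bar> = 1" using abs_sign[OF \<theta>, of l] l 0(3) by simp
    moreover have "norm (x l) \<le> D" using l 0(2)[of l] by simp
    ultimately show ?thesis using l by (simp add: power_mono)
  qed simp
  then show ?case using \<open>finite L\<close> by (intro signs.pavg_le) auto
next
  case (Suc j)
  have fJ: "finite J" using Suc \<open>finite L\<close> finite_subset by blast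
  obtain b where b: "b \<in> J \<rightarrow> {1..n}" and card: "\<And>a. a \<in> {1..n} \<Longrightarrow> card {l \<in> J. b l = a} \<le> n ^ j"
    using exists_block_map[OF fJ, of "{1..n}" "n ^ j"] Suc.prems by auto
  define Y where "Y a \<theta> = (\<Sum>l\<in>{l \<in> J. b l = a}. \<theta> l *\<^sub>R x l)" for a \<theta>
  have group: "(\<Sum>l\<in>J. f l) = (\<Sum>a=1..n. \<Sum>l\<in>{l \<in> J. b l = a}. f l)" for f :: "'i \<Rightarrow> 'a"
    by (rule sum.group[symmetric]) (use fJ b in auto)
  have "savg L (\<lambda>\<theta>. (norm (\<Sum>l\<in>J. \<theta> l *\<^sub>R x l))\<^sup>2)
      = savg {1..n} (\<lambda>\<delta>. savg L (\<lambda>\<theta>. (norm (\<Sum>l\<in>J. \<theta> l *\<^sub>R x l))\<^sup>2))"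
    by (simp add: signs.pavg_const)
  also have "\<dots> = savg {1..n} (\<lambda>\<delta>. savg L (\<lambda>\<theta>. (norm (\<Sum>a=1..n. \<delta> a *\<^sub>R Y a \<theta>))\<^sup>2))"
  proof (rule pavg_cong)
    fix \<delta> :: "nat \<Rightarrow> real" assume \<delta>: "\<delta> \<in> signs {1..n}"
    define s where "s l = (if l \<in> J then \<delta> (b l) else 1)" for l
    have s: "s l \<in> {-1, 1}" for l using \<delta> b by (auto simp: s_def PiE_iff Pi_iff)
    have eq: "(\<Sum>l\<in>J. (\<lambda>l\<in>L. s l * \<theta> l) l *\<^sub>R x l) = (\<Sum>a=1..n. \<delta> a *\<^sub>R Y a \<theta>)" for \<theta>
      unfolding group Y_def scaleR_sum_right
      using Suc.prems by (intro sum.cong) (auto simp: s_def)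
    show "savg L (\<lambda>\<theta>. (norm (\<Sum>l\<in>J. \<theta> l *\<^sub>R x l))\<^sup>2)
        = savg L (\<lambda>\<theta>. (norm (\<Sum>a=1..n. \<delta> a *\<^sub>R Y a \<theta>))\<^sup>2)"
      using savg_flip[of L s "\<lambda>\<theta>. (norm (\<Sum>l\<in>J. \<theta> l *\<^sub>R x l))\<^sup>2"] s
      unfolding eq by metis
  qed
  also have "\<dots> = savg L (\<lambda>\<theta>. savg {1..n} (\<lambda>\<delta>. (norm (\<Sum>a=1..n. \<delta> a *\<^sub>R Y a \<theta>))\<^sup>2))"
    by (rule pavg_swap)
  also have "\<dots> \<le> savg L (\<lambda>\<theta>. c * real n * (\<Sum>a=1..n. (norm (Y a \<theta>))\<^sup>2))"
    by (intro signs.pavg_mono base)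
  also have "\<dots> = c * real n * (\<Sum>a=1..n. savg L (\<lambda>\<theta>. (norm (Y a \<theta>))\<^sup>2))"
    by (simp only: pavg_mult pavg_sum)
  also have "\<dots> \<le> c * real n * (\<Sum>a=1..n. (c * (real n)\<^sup>2) ^ j * D\<^sup>2)"
  proof (intro mult_left_mono sum_mono)
    fix a assume "a \<in> {1..n}"
    then show "savg L (\<lambda>\<theta>. (norm (Y a \<theta>))\<^sup>2) \<le> (c * (real n)\<^sup>2) ^ j * D\<^sup>2"
      unfolding Y_def using Suc.prems by (intro Suc.IH card) auto
  qed (use c in auto)
  also have "\<dots> = (c * (real n)\<^sup>2) ^ Suc j * D\<^sup>2" by (simp add: power2_eq_square ac_simps)
  finally show ?case .
qed

section \<open>The dual inequality for Rademacher coefficients\<close>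

text \<open>With the sign vectors \<open>\<eta>\<close> themselves as index set, the coordinate maps \<open>t l = (\<lambda>\<eta>. \<eta> l)\<close> are
  sign vectors.  If all the coefficients were nearly maximal, then so would be the norm of
  \<open>\<Sum>l. \<eta> l *\<^sub>R x (t l)\<close> for every \<open>\<eta>\<close>, against B-convexity.\<close>

lemma B_convex_Rademacher_projection:
  assumes "B_convex (X :: 'a::real_normed_vector itself)"
  obtains H :: "(nat \<Rightarrow> real) set" and c where "finite H" "card H \<ge> 2" "0 \<le> c" "c < 1"
    "\<And>x :: ((nat \<Rightarrow> real) \<Rightarrow> real) \<Rightarrow> 'a. (\<Sum>\<eta>\<in>H. (norm (savg H (\<lambda>\<theta>. \<theta> \<eta> *\<^sub>R x \<theta>)))\<^sup>2)
       \<le> c * real (card H) * savg H (\<lambda>\<theta>. (norm (x \<theta>))\<^sup>2)"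
proof -
  obtain n \<delta> where n: "n \<ge> 2" "0 < \<delta>" "\<delta> \<le> 1" and B:
    "\<forall>(x :: nat \<Rightarrow> 'a) t. (\<forall>i\<in>{1..n}. norm (x i) \<le> t) \<longrightarrow>
       (\<exists>\<theta>\<in>signs {1..n}. norm (\<Sum>i=1..n. \<theta> i *\<^sub>R x i) \<le> (1 - \<delta>) * real n * t)"
    using B_convexE[OF assms] by blast
  define H :: "(nat \<Rightarrow> real) set" where "H = signs {1..n}"
  have fH: "finite H" by (simp add: H_def finite_signs)
  define m where "m = real (card H)"
  have cH: "card H = 2 ^ n" by (simp add: H_def card_signs)
  have "(2::nat) ^ 1 \<le> 2 ^ n" using n by (intro power_increasing) auto
  then have cH2: "card H \<ge> 2" using cH by simp
  then have m: "m > 0" by (simp add: m_def)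
  define N :: real where "N = 2 ^ card H"
  have N0: "N > 0" by (simp add: N_def)
  have cS: "real (card (signs H)) = N" using fH by (simp add: N_def card_signs)
  have ncS: "n \<le> card (signs H)"
  proof -
    have "n \<le> card H" by (simp add: cH less_imp_le)
    also have "\<dots> \<le> 2 ^ card H" by (simp add: less_imp_le)
    finally show ?thesis using fH by (simp add: card_signs)
  qed
  then have nN: "real n \<le> N" using cS by linarith
  \<comment> \<open>Tuned to \<open>\<gamma> * N = \<delta> * real n / 4\<close>: inflating all
    \<open>N\<close> terms by \<open>1 + \<gamma>\<close> costs at most a quarter of the saving
    \<open>\<delta> * real n\<close> made on \<open>n\<close> of them.\<close>
  define \<gamma> where "\<gamma> = \<delta> * real n / (4 * N)"
  have \<gamma>: "0 < \<gamma>" "\<gamma> \<le> 1" "\<gamma> * N = \<delta> * real n / 4"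
    using n N0 nN mult_mono[of \<delta> 1 "real n" N] by (auto simp: \<gamma>_def field_simps)
  define k1 where "k1 = 1 - \<delta> * real n / (2 * N)"
  define k2 where "k2 = 1 - \<gamma>\<^sup>2 / (2 * N)"
  have "1 \<le> N" by (simp add: N_def)
  have "\<gamma>\<^sup>2 \<le> 1" using \<gamma> by (simp add: power_le_one)
  then have k2: "0 \<le> k2" "k2 < 1" using \<gamma> \<open>1 \<le> N\<close> by (auto simp: k2_def field_simps)
  have k1: "0 \<le> k1" "k1 < 1" using n N0 nN mult_mono[of \<delta> 1 "real n" N] by (auto simp: k1_def field_simps)
  \<comment> \<open>In the first case below only one of the \<open>m\<close> coefficients drops, to
    the factor \<open>k1\<close>; in the second all of them drop to \<open>k2\<close>.\<close>
  define c where "c = max (1 - (1 - k1) / m) k2"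
  have c: "0 \<le> c" "c < 1" using k1 k2 m by (auto simp: c_def)
  show ?thesis
  proof (rule that[OF fH cH2 c])
    fix x :: "((nat \<Rightarrow> real) \<Rightarrow> real) \<Rightarrow> 'a"
    define q where "q = sqrt (savg H (\<lambda>\<theta>. (norm (x \<theta>))\<^sup>2))"
    have q2: "savg H (\<lambda>\<theta>. (norm (x \<theta>))\<^sup>2) = q\<^sup>2" by (simp add: q_def signs.pavg_nonneg)
    have q0: "0 \<le> q" by (simp add: q_def signs.pavg_nonneg)
    have sumsq: "(\<Sum>\<theta>\<in>signs H. (norm (x \<theta>))\<^sup>2) = real (card (signs H)) * q\<^sup>2"
      using q2[symmetric] unfolding cS by (simp add: savg_eq_sum N_def power_divide)
    define y where "y \<eta> = savg H (\<lambda>\<theta>. \<theta> \<eta> *\<^sub>R x \<theta>)" for \<eta>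
    have ysum: "N * norm (y \<eta>) = norm (\<Sum>\<theta>\<in>signs H. \<theta> \<eta> *\<^sub>R x \<theta>)" for \<eta>
      by (simp add: y_def savg_eq_sum N_def power_divide)
    have yle: "N * norm (y \<eta>) \<le> (\<Sum>\<theta>\<in>signs H. norm (x \<theta>))" if "\<eta> \<in> H" for \<eta>
      unfolding ysum by (rule sum_norm_le) (simp add: norm_sign_scaleR that del: norm_scaleR)
    have ysq: "(norm (y \<eta>))\<^sup>2 \<le> q\<^sup>2" if "\<eta> \<in> H" for \<eta>
    proof -
      have "(norm (y \<eta>))\<^sup>2 \<le> savg H (\<lambda>\<theta>. (norm (\<theta> \<eta> *\<^sub>R x \<theta>))\<^sup>2)"
        unfolding y_def by (rule signs.square_norm_pavg_le[OF fH])
      also have "\<dots> = savg H (\<lambda>\<theta>. (norm (x \<theta>))\<^sup>2)"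
        by (rule pavg_cong) (simp add: norm_sign_scaleR that del: norm_scaleR)
      finally show ?thesis by (simp add: q2)
    qed
    have "(\<Sum>\<eta>\<in>H. (norm (y \<eta>))\<^sup>2) \<le> c * m * q\<^sup>2"
    proof (cases "\<forall>\<theta>\<in>signs H. norm (x \<theta>) \<le> (1 + \<gamma>) * q")
      case True
      define t where "t l = (\<lambda>\<eta>\<in>H. \<eta> l)" for l :: nat
      have t: "t l \<in> signs H" if "l \<in> {1..n}" for l
        using that by (auto simp: t_def H_def PiE_iff)
      have inj: "inj_on t {1..n}"
      proof (rule inj_onI, rule ccontr)
        fix l l' assume l: "l \<in> {1..n}" "l' \<in> {1..n}" "t l = t l'" "l \<noteq> l'"
        define \<eta> where "\<eta> = (\<lambda>i\<in>{1..n}. if i = l then 1 else - 1 :: real)"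
        have "\<eta> \<in> H" by (auto simp: H_def \<eta>_def)
        then have "\<eta> l = \<eta> l'" using fun_cong[OF l(3), of \<eta>] by (simp add: t_def)
        then show False using l by (simp add: \<eta>_def)
      qed
      have tsub: "t ` {1..n} \<subseteq> signs H" using t by blast
      \<comment> \<open>The pattern that B-convexity selects for the vectors \<open>x (t i)\<close>
        is a member of \<open>H\<close>, hence the index of a coefficient, and
        \<open>t i \<eta> = \<eta> i\<close> makes the short signed sum a part of that coefficient.
        The remaining terms get the trivial bound.\<close>
      obtain \<eta> where \<eta>: "\<eta> \<in> H"
        and le: "norm (\<Sum>i=1..n. \<eta> i *\<^sub>R x (t i)) \<le> (1 - \<delta>) * real n * ((1 + \<gamma>) * q)"
        using B[rule_format, of "\<lambda>i. x (t i)" "(1 + \<gamma>) * q"] True t by (auto simp: H_def)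
      have "(\<Sum>\<theta>\<in>signs H. \<theta> \<eta> *\<^sub>R x \<theta>)
          = (\<Sum>\<theta>\<in>signs H - t ` {1..n}. \<theta> \<eta> *\<^sub>R x \<theta>) + (\<Sum>\<theta>\<in>t ` {1..n}. \<theta> \<eta> *\<^sub>R x \<theta>)"
        using tsub fH by (intro sum.subset_diff) (auto simp: finite_signs)
      also have "(\<Sum>\<theta>\<in>t ` {1..n}. \<theta> \<eta> *\<^sub>R x \<theta>) = (\<Sum>i=1..n. \<eta> i *\<^sub>R x (t i))"
        by (subst sum.reindex[OF inj]) (simp add: t_def \<eta>)
      finally have split: "(\<Sum>\<theta>\<in>signs H. \<theta> \<eta> *\<^sub>R x \<theta>)
          = (\<Sum>\<theta>\<in>signs H - t ` {1..n}. \<theta> \<eta> *\<^sub>R x \<theta>) + (\<Sum>i=1..n. \<eta> i *\<^sub>R x (t i))" .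
      have "card (signs H - t ` {1..n}) = card (signs H) - n"
        using card_Diff_subset[OF finite_subset[OF tsub finite_signs[OF fH]] tsub] card_image[OF inj] by simp
      then have cdiff: "real (card (signs H - t ` {1..n})) = N - real n"
        using ncS cS by (simp add: of_nat_diff)
      have "N * norm (y \<eta>) \<le> norm (\<Sum>\<theta>\<in>signs H - t ` {1..n}. \<theta> \<eta> *\<^sub>R x \<theta>)
          + norm (\<Sum>i=1..n. \<eta> i *\<^sub>R x (t i))"
        unfolding ysum split by (rule norm_triangle_ineq)
      also have "norm (\<Sum>\<theta>\<in>signs H - t ` {1..n}. \<theta> \<eta> *\<^sub>R x \<theta>)
          \<le> (\<Sum>\<theta>\<in>signs H - t ` {1..n}. (1 + \<gamma>) * q)"
        by (rule sum_norm_le) (use True \<eta> abs_sign in fastforce)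
      also have "\<dots> = (N - real n) * ((1 + \<gamma>) * q)"
        using cdiff by simp
      also note le
      finally have "N * norm (y \<eta>) \<le> (N - \<delta> * real n) * (1 + \<gamma>) * q"
        by (simp add: algebra_simps)
      also have "\<dots> \<le> (N - \<delta> * real n / 2) * q"
      proof (rule mult_right_mono[OF _ q0])
        have "(N - \<delta> * real n) * (1 + \<gamma>) = N - \<delta> * real n + \<gamma> * N - \<gamma> * (\<delta> * real n)"
          by (simp add: algebra_simps)
        also have "\<dots> \<le> N - \<delta> * real n + \<delta> * real n / 4"
        proof -
          have "0 \<le> \<gamma> * (\<delta> * real n)" using \<gamma> n by simp
          with \<gamma>(3) show ?thesis by linarith
        qed
        also have "\<dots> \<le> N - \<delta> * real n / 2" using n by simp
        finally show "(N - \<delta> * real n) * (1 + \<gamma>) \<le> N - \<delta> * real n / 2" .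
      qed
      also have "\<dots> = N * (k1 * q)" using N0 by (simp add: k1_def field_simps)
      finally have "norm (y \<eta>) \<le> k1 * q" using N0 by simp
      then have "(norm (y \<eta>))\<^sup>2 \<le> (k1 * q)\<^sup>2" by (intro power_mono) auto
      also have "\<dots> \<le> k1 * q\<^sup>2"
        unfolding power_mult_distrib using k1
        by (intro mult_right_mono) (auto simp: power2_eq_square intro: mult_left_le)
      finally have 1: "(norm (y \<eta>))\<^sup>2 \<le> k1 * q\<^sup>2" .
      have "(\<Sum>\<eta>\<in>H. (norm (y \<eta>))\<^sup>2) = (norm (y \<eta>))\<^sup>2 + (\<Sum>\<eta>\<in>H - {\<eta>}. (norm (y \<eta>))\<^sup>2)"
        using fH \<eta> by (rule sum.remove)
      also have "\<dots> \<le> k1 * q\<^sup>2 + real (card (H - {\<eta>})) * q\<^sup>2"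
        by (intro add_mono 1 sum_bounded_above ysq) auto
      also have "real (card (H - {\<eta>})) = m - 1" using fH \<eta> cH2 by (simp add: m_def of_nat_diff)
      also have "k1 * q\<^sup>2 + (m - 1) * q\<^sup>2 = (1 - (1 - k1) / m) * m * q\<^sup>2"
        using m by (simp add: field_simps)
      also have "\<dots> \<le> c * m * q\<^sup>2"
        using m by (intro mult_right_mono) (auto simp: c_def)
      finally show ?thesis .
    next
      case False
      then obtain \<theta> where \<theta>: "\<theta> \<in> signs H" "(1 + \<gamma>) * q < norm (x \<theta>)"
        unfolding Ball_def not_all not_imp not_le by blast
      have "(\<Sum>\<theta>\<in>signs H. norm (x \<theta>)) \<le> (real (card (signs H)) - \<gamma>\<^sup>2 / 2) * q"
        by (rule sum_le_of_quadratic_mean[where t = "\<lambda>\<theta>. norm (x \<theta>)", OF _ \<theta>(1) _ q0 \<theta>(2) sumsq])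
          (use fH \<gamma> in \<open>auto simp: finite_signs\<close>)
      also have "\<dots> = N * (k2 * q)" using N0 unfolding cS by (simp add: k2_def field_simps)
      finally have *: "(\<Sum>\<theta>\<in>signs H. norm (x \<theta>)) \<le> N * (k2 * q)" .
      have "(norm (y \<eta>))\<^sup>2 \<le> k2 * q\<^sup>2" if "\<eta> \<in> H" for \<eta>
      proof -
        have "norm (y \<eta>) \<le> k2 * q" using order_trans[OF yle[OF that] *] N0 by simp
        then have "(norm (y \<eta>))\<^sup>2 \<le> (k2 * q)\<^sup>2" by (intro power_mono) auto
        also have "\<dots> = k2\<^sup>2 * q\<^sup>2" by (simp add: power_mult_distrib)
        also have "\<dots> \<le> k2 * q\<^sup>2"
          using k2 by (intro mult_right_mono) (auto simp: power2_eq_square intro: mult_left_le)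
        finally show ?thesis .
      qed
      then have "(\<Sum>\<eta>\<in>H. (norm (y \<eta>))\<^sup>2) \<le> m * (k2 * q\<^sup>2)"
        unfolding m_def by (rule sum_bounded_above)
      also have "\<dots> = k2 * (m * q\<^sup>2)" by simp
      also have "\<dots> \<le> c * (m * q\<^sup>2)" using m by (intro mult_right_mono) (auto simp: c_def)
      finally show ?thesis by simp
    qed
    then show "(\<Sum>\<eta>\<in>H. (norm (savg H (\<lambda>\<theta>. \<theta> \<eta> *\<^sub>R x \<theta>)))\<^sup>2)
       \<le> c * real (card H) * savg H (\<lambda>\<theta>. (norm (x \<theta>))\<^sup>2)"
      by (simp add: y_def m_def q2)
  qed
qed

text \<open>For a block map \<open>b\<close>, let \<open>u a\<close> be the coefficient at
  \<open>a\<close> of \<open>x\<close> as a function of the block flips \<open>\<delta>\<close>.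
  Flips preserve averages, so \<open>u (b l)\<close> has the same coefficient at \<open>l\<close> as
  \<open>x\<close>. The induction hypothesis bounds the coefficients within a block by the square
  mean of \<open>u a\<close>, and \<open>base\<close>, applied in \<open>\<delta>\<close> for fixed
  \<open>\<theta>\<close>, bounds the sum of these square means.\<close>

lemma Rademacher_projection_power:
  fixes x :: "('i \<Rightarrow> real) \<Rightarrow> 'a::real_normed_vector" and H :: "'h set"
  assumes c: "0 \<le> c" and "finite H" and base: "\<And>y :: ('h \<Rightarrow> real) \<Rightarrow> 'a.
      (\<Sum>\<eta>\<in>H. (norm (savg H (\<lambda>\<theta>. \<theta> \<eta> *\<^sub>R y \<theta>)))\<^sup>2)
        \<le> c * real (card H) * savg H (\<lambda>\<theta>. (norm (y \<theta>))\<^sup>2)"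
    and "finite L" "J \<subseteq> L" "card J \<le> card H ^ j"
  shows "(\<Sum>l\<in>J. (norm (savg L (\<lambda>\<theta>. \<theta> l *\<^sub>R x \<theta>)))\<^sup>2)
      \<le> (c * real (card H)) ^ j * savg L (\<lambda>\<theta>. (norm (x \<theta>))\<^sup>2)"
  using assms(6,5)
proof (induction j arbitrary: J x)
  case 0
  have fJ: "finite J" using 0 \<open>finite L\<close> finite_subset by blast
  show ?case
  proof (cases "J = {}")
    case False
    then have "card J = 1" using 0 fJ by (simp add: le_Suc_eq)
    then obtain l where l: "J = {l}" by (auto simp: card_1_singleton_iff)
    have "(norm (savg L (\<lambda>\<theta>. \<theta> l *\<^sub>R x \<theta>)))\<^sup>2 \<le> savg L (\<lambda>\<theta>. (norm (\<theta> l *\<^sub>R x \<theta>))\<^sup>2)"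
      by (rule signs.square_norm_pavg_le[OF \<open>finite L\<close>])
    also have "\<dots> = savg L (\<lambda>\<theta>. (norm (x \<theta>))\<^sup>2)"
      by (rule pavg_cong) (use l 0(2) in \<open>simp add: norm_sign_scaleR del: norm_scaleR\<close>)
    finally show ?thesis using l by simp
  qed (simp add: signs.pavg_nonneg)
next
  case (Suc j)
  have fJ: "finite J" using Suc \<open>finite L\<close> finite_subset by blast
  obtain b where b: "b \<in> J \<rightarrow> H" and card: "\<And>a. a \<in> H \<Longrightarrow> card {l \<in> J. b l = a} \<le> card H ^ j"
    using exists_block_map[OF fJ \<open>finite H\<close>, of "card H ^ j"] Suc.prems by auto
  define s where "s \<delta> l = (if l \<in> J then \<delta> (b l) else 1)" for \<delta> :: "'h \<Rightarrow> real" and l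
  define fl where "fl \<delta> \<theta> = (\<lambda>l\<in>L. s \<delta> l * \<theta> l)" for \<delta> \<theta>
  have flip: "savg L (\<lambda>\<theta>. F (fl \<delta> \<theta>)) = savg L F"
    if "\<delta> \<in> signs H" for \<delta> and F :: "('i \<Rightarrow> real) \<Rightarrow> 'b::real_vector"
    unfolding fl_def by (rule savg_flip) (use that b in \<open>auto simp: s_def PiE_iff Pi_iff\<close>)
  define u where "u a \<theta> = savg H (\<lambda>\<delta>. \<delta> a *\<^sub>R x (fl \<delta> \<theta>))" for a \<theta>
  \<comment> \<open>Since \<open>b l = a\<close>, the product \<open>\<theta> l * \<delta> a\<close>
    is the \<open>l\<close>-th sign after the flip, and the flip can be undone under the
    average.\<close>
  have eq: "savg L (\<lambda>\<theta>. \<theta> l *\<^sub>R u a \<theta>) = savg L (\<lambda>\<theta>. \<theta> l *\<^sub>R x \<theta>)"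
    if l: "l \<in> J" "b l = a" for a l
  proof -
    have "savg L (\<lambda>\<theta>. \<theta> l *\<^sub>R u a \<theta>) = savg L (\<lambda>\<theta>. savg H (\<lambda>\<delta>. (fl \<delta> \<theta>) l *\<^sub>R x (fl \<delta> \<theta>)))"
      using l Suc.prems unfolding u_def
      by (subst pavg_scaleR[symmetric]) (auto simp: fl_def s_def mult.commute intro!: pavg_cong)
    also have "\<dots> = savg H (\<lambda>\<delta>. savg L (\<lambda>\<theta>. (fl \<delta> \<theta>) l *\<^sub>R x (fl \<delta> \<theta>)))" by (rule pavg_swap)
    also have "\<dots> = savg H (\<lambda>\<delta>. savg L (\<lambda>\<theta>. \<theta> l *\<^sub>R x \<theta>))"
      by (rule pavg_cong, rule flip)
    finally show ?thesis using \<open>finite H\<close> by (simp add: signs.pavg_const)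
  qed
  have "(\<Sum>l\<in>J. (norm (savg L (\<lambda>\<theta>. \<theta> l *\<^sub>R x \<theta>)))\<^sup>2)
      = (\<Sum>a\<in>H. \<Sum>l\<in>{l \<in> J. b l = a}. (norm (savg L (\<lambda>\<theta>. \<theta> l *\<^sub>R x \<theta>)))\<^sup>2)"
    by (rule sum.group[symmetric]) (use fJ \<open>finite H\<close> b in auto)
  also have "\<dots> = (\<Sum>a\<in>H. \<Sum>l\<in>{l \<in> J. b l = a}. (norm (savg L (\<lambda>\<theta>. \<theta> l *\<^sub>R u a \<theta>)))\<^sup>2)"
    by (intro sum.cong) (auto simp: eq)
  also have "\<dots> \<le> (\<Sum>a\<in>H. (c * real (card H)) ^ j * savg L (\<lambda>\<theta>. (norm (u a \<theta>))\<^sup>2))"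
    using Suc.prems by (intro sum_mono Suc.IH card) auto
  also have "\<dots> = (c * real (card H)) ^ j * savg L (\<lambda>\<theta>. \<Sum>a\<in>H. (norm (u a \<theta>))\<^sup>2)"
    by (simp only: pavg_sum sum_distrib_left)
  also have "\<dots> \<le> (c * real (card H)) ^ j *
      savg L (\<lambda>\<theta>. c * real (card H) * savg H (\<lambda>\<delta>. (norm (x (fl \<delta> \<theta>)))\<^sup>2))"
    unfolding u_def using c by (intro mult_left_mono signs.pavg_mono base) auto
  also have "\<dots> = (c * real (card H)) ^ Suc j * savg L (\<lambda>\<theta>. savg H (\<lambda>\<delta>. (norm (x (fl \<delta> \<theta>)))\<^sup>2))"
    by (simp add: pavg_mult)
  also have "savg L (\<lambda>\<theta>. savg H (\<lambda>\<delta>. (norm (x (fl \<delta> \<theta>)))\<^sup>2))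
      = savg H (\<lambda>\<delta>. savg L (\<lambda>\<theta>. (norm (x (fl \<delta> \<theta>)))\<^sup>2))" by (rule pavg_swap)
  also have "\<dots> = savg H (\<lambda>\<delta>. savg L (\<lambda>\<theta>. (norm (x \<theta>))\<^sup>2))"
    by (rule pavg_cong, rule flip)
  also have "\<dots> = savg L (\<lambda>\<theta>. (norm (x \<theta>))\<^sup>2)" using \<open>finite H\<close> by (simp add: signs.pavg_const)
  finally show ?case .
qed

section \<open>Smallness for large index sets\<close>

lemma exists_power_bracket:
  fixes n k :: nat
  assumes "2 \<le> n" "n ^ i \<le> k"
  obtains j where "i \<le> j" "k \<le> n ^ j" "n ^ j \<le> n * k"
proof -
  have "k < 2 ^ k" by simp
  also have "(2::nat) ^ k \<le> n ^ k" using assms by (simp add: power_mono)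
  finally have ex: "k \<le> n ^ k" by simp
  define j where "j = (LEAST j. k \<le> n ^ j)"
  have j: "k \<le> n ^ j" unfolding j_def using ex by (rule LeastI)
  have "n ^ i \<le> n ^ j" using assms j by linarith
  then have "i \<le> j" using assms(1) power_le_imp_le_exp[of n i j] by linarith
  moreover have "n ^ j \<le> n * k"
  proof (cases j)
    case 0
    have "1 \<le> n ^ i" using assms by simp
    then have "1 \<le> k" using assms by linarith
    then show ?thesis using 0 assms by simp
  next
    case (Suc j')
    then have "\<not> k \<le> n ^ j'" unfolding j_def using not_less_Least[of j' "\<lambda>j. k \<le> n ^ j"] by simp
    then show ?thesis using Suc by simp
  qed
  ultimately show ?thesis using that j by blast
qed

lemma B_convex_sign_average:
  assumes "B_convex (X :: 'a::real_normed_vector itself)" "0 < e"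
  shows "\<exists>N\<ge>1. \<forall>(J :: 'i set) (u :: 'i \<Rightarrow> 'a) D. finite J \<longrightarrow> N \<le> card J \<longrightarrow> 0 \<le> D \<longrightarrow>
    (\<forall>j\<in>J. norm (u j) \<le> D) \<longrightarrow>
    savg J (\<lambda>\<theta>. norm (\<Sum>j\<in>J. \<theta> j *\<^sub>R u j)) \<le> e * D * real (card J)"
proof -
  obtain n c where n: "n \<ge> 2" and c: "1/4 \<le> c" "c < 1" and base: "\<And>x :: nat \<Rightarrow> 'a.
      savg {1..n} (\<lambda>\<theta>. (norm (\<Sum>i=1..n. \<theta> i *\<^sub>R x i))\<^sup>2) \<le> c * real n * (\<Sum>i=1..n. (norm (x i))\<^sup>2)"
    by (rule B_convex_quadratic[OF assms(1)]) blast
  have "sqrt c < 1" using c by simp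
  \<comment> \<open>The spare factor \<open>1 / real n\<close> pays for rounding
    \<open>card J\<close> up to a power of \<open>n\<close>.\<close>
  then obtain i where i: "sqrt c ^ i < e / real n"
    using real_arch_pow_inv[of "e / real n" "sqrt c"] assms n by auto
  show ?thesis
  proof (intro exI[of _ "n ^ i"] conjI allI impI)
    show "1 \<le> n ^ i" using n by simp
    fix J :: "'i set" and u :: "'i \<Rightarrow> 'a" and D :: real
    assume J: "finite J" "n ^ i \<le> card J" and D: "0 \<le> D" "\<forall>j\<in>J. norm (u j) \<le> D"
    obtain j where j: "i \<le> j" "card J \<le> n ^ j" "n ^ j \<le> n * card J"
      using exists_power_bracket[OF n J(2)] by blast
    define Y where "Y \<theta> = norm (\<Sum>j\<in>J. \<theta> j *\<^sub>R u j)" for \<theta>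
    have "(savg J Y)\<^sup>2 \<le> savg J (\<lambda>\<theta>. (Y \<theta>)\<^sup>2)" by (rule signs.square_pavg_le[OF J(1)])
    also have "\<dots> \<le> (c * (real n)\<^sup>2) ^ j * D\<^sup>2"
      unfolding Y_def by (rule quadratic_bound_power[OF _ base J(1) subset_refl j(2)]) (use c D in auto)
    also have "\<dots> = (sqrt c ^ j * real n ^ j * D)\<^sup>2"
    proof -
      have "c ^ j = (sqrt c ^ j)\<^sup>2" using c by (simp add: power_mult[symmetric] mult.commute[of j] power_mult)
      then show ?thesis by (simp add: power_mult_distrib power_mult[symmetric] mult.commute)
    qed
    finally have "savg J Y \<le> sqrt c ^ j * real n ^ j * D"
      by (rule power2_le_imp_le) (use c D in auto)
    also have "\<dots> \<le> (e / real n) * (real n * real (card J)) * D"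
    proof (intro mult_right_mono mult_mono D)
      have "sqrt c ^ j \<le> sqrt c ^ i" using c j by (intro power_decreasing) auto
      then show "sqrt c ^ j \<le> e / real n" using i by simp
      show "real n ^ j \<le> real n * real (card J)" using j(3) by (metis of_nat_le_iff of_nat_mult of_nat_power)
    qed (use assms in auto)
    also have "\<dots> = e * D * real (card J)" using n by simp
    finally show "savg J (\<lambda>\<theta>. norm (\<Sum>j\<in>J. \<theta> j *\<^sub>R u j)) \<le> e * D * real (card J)"
      by (simp add: Y_def[abs_def])
  qed
qed

text \<open>Cauchy-Schwarz passes from the squares of the coefficients to their sum. Helly needs
  just one dimension \<open>m\<close> for each \<open>e\<close>, so \<open>m\<close> is taken to be
  an exact power of \<open>card H\<close>.\<close>

lemma B_convex_Rademacher_projection_small: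
  assumes "B_convex (X :: 'a::real_normed_vector itself)" "0 < e"
  obtains m where "1 \<le> m" "\<And>x :: (nat \<Rightarrow> real) \<Rightarrow> 'a. (\<And>\<theta>. \<theta> \<in> signs {1..m} \<Longrightarrow> norm (x \<theta>) \<le> 1) \<Longrightarrow>
    (\<Sum>l=1..m. norm (savg {1..m} (\<lambda>\<theta>. \<theta> l *\<^sub>R x \<theta>))) \<le> e * real m"
proof -
  obtain H :: "(nat \<Rightarrow> real) set" and c where H: "finite H" "card H \<ge> 2" and c: "0 \<le> c" "c < 1" and base:
    "\<And>x :: ((nat \<Rightarrow> real) \<Rightarrow> real) \<Rightarrow> 'a. (\<Sum>\<eta>\<in>H. (norm (savg H (\<lambda>\<theta>. \<theta> \<eta> *\<^sub>R x \<theta>)))\<^sup>2)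
       \<le> c * real (card H) * savg H (\<lambda>\<theta>. (norm (x \<theta>))\<^sup>2)"
    by (rule B_convex_Rademacher_projection[OF assms(1)]) blast
  have "sqrt c < 1" using c by simp
  then obtain j where j: "sqrt c ^ j < e" using real_arch_pow_inv[OF assms(2)] by blast
  define m where "m = card H ^ j"
  show ?thesis
  proof (rule that[of m])
    show "1 \<le> m" using H by (simp add: m_def)
    fix x :: "(nat \<Rightarrow> real) \<Rightarrow> 'a" assume x: "\<And>\<theta>. \<theta> \<in> signs {1..m} \<Longrightarrow> norm (x \<theta>) \<le> 1"
    define y where "y l = norm (savg {1..m} (\<lambda>\<theta>. \<theta> l *\<^sub>R x \<theta>))" for l
    have "(\<Sum>l=1..m. y l)\<^sup>2 \<le> (\<Sum>l=1..m. (y l)\<^sup>2) * real (card {1..m})"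
      by (rule sum_squared_le_sum_of_squares)
    also have "\<dots> = (\<Sum>l\<in>{1..m}. (y l)\<^sup>2) * real m" by simp
    also have "\<dots> \<le> (c * real (card H)) ^ j * 1 * real m"
    proof (rule mult_right_mono)
      have "(\<Sum>l\<in>{1..m}. (y l)\<^sup>2) \<le> (c * real (card H)) ^ j * savg {1..m} (\<lambda>\<theta>. (norm (x \<theta>))\<^sup>2)"
        unfolding y_def
        by (rule Rademacher_projection_power[OF c(1) H(1) base]) (auto simp: m_def)
      also have "\<dots> \<le> (c * real (card H)) ^ j * 1"
      proof (intro mult_left_mono signs.pavg_le)
        fix \<theta> assume "\<theta> \<in> signs {1..m}"
        then show "(norm (x \<theta>))\<^sup>2 \<le> 1" using x by (simp add: power_le_one)
      qed (use c in auto)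
      finally show "(\<Sum>l\<in>{1..m}. (y l)\<^sup>2) \<le> (c * real (card H)) ^ j * 1" .
    qed simp
    also have "\<dots> = (sqrt c ^ j * real m)\<^sup>2"
    proof -
      have "c ^ j = (sqrt c ^ j)\<^sup>2" using c by (simp add: power_mult[symmetric] mult.commute[of j] power_mult)
      then show ?thesis by (simp add: power_mult_distrib m_def power2_eq_square)
    qed
    finally have "(\<Sum>l=1..m. y l) \<le> sqrt c ^ j * real m"
      by (rule power2_le_imp_le) (use c in auto)
    also have "\<dots> \<le> e * real m" using j by (intro mult_right_mono) auto
    finally show "(\<Sum>l=1..m. norm (savg {1..m} (\<lambda>\<theta>. \<theta> l *\<^sub>R x \<theta>))) \<le> e * real m"
      by (simp add: y_def)
  qed
qed

section \<open>Type and infratype\<close>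

lemma L2_set_norm_sum_le:
  assumes "finite K"
  shows "L2_set (\<lambda>t. norm (\<Sum>k\<in>K. Y k t)) S \<le> (\<Sum>k\<in>K. L2_set (\<lambda>t. norm (Y k t)) S)"
  using assms
proof (induction K)
  case empty
  then show ?case by (simp add: L2_set_def)
next
  case (insert k K)
  have "L2_set (\<lambda>t. norm (\<Sum>k\<in>insert k K. Y k t)) S
      \<le> L2_set (\<lambda>t. norm (Y k t) + norm (\<Sum>k\<in>K. Y k t)) S"
    using insert by (intro L2_set_mono) (auto intro: norm_triangle_ineq)
  also have "\<dots> \<le> L2_set (\<lambda>t. norm (Y k t)) S + L2_set (\<lambda>t. norm (\<Sum>k\<in>K. Y k t)) S"
    by (rule L2_set_triangle_ineq)
  finally show ?case using insert by simp
qed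

lemma sqrt_savg_square: "sqrt (savg L (\<lambda>\<theta>. (F \<theta>)\<^sup>2)) = sqrt ((1/2) ^ card L) * L2_set F (signs L)"
  by (simp add: savg_eq_sum L2_set_def real_sqrt_mult real_sqrt_divide)

text \<open>Young's inequality bounds \<open>F y powr p\<close> by the tangent, at
  \<open>q\<^sup>2\<close>, of the concave function \<open>t powr (p/2)\<close> of
  \<open>t = (F y)\<^sup>2\<close>; the tangent is affine in the square and can be averaged.\<close>

lemma (in weights) pavg_powr_le:
  fixes p q :: real
  assumes "finite J" "0 < q" "0 < p" "p \<le> 2"
    and F: "\<And>y. 0 \<le> F y" and sq: "pavg J A w (\<lambda>y. (F y)\<^sup>2) \<le> q\<^sup>2"
  shows "pavg J A w (\<lambda>y. F y powr p) \<le> q powr p"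
proof -
  have le: "F y powr p \<le> (p/2) * q powr (p - 2) * (F y)\<^sup>2 + (1 - p/2) * q powr p" for y
  proof (cases "F y = 0")
    case False
    then have Fy: "F y > 0" using F[of y] by simp
    have "(F y)\<^sup>2 powr (p/2) * q\<^sup>2 powr (1 - p/2) \<le> (p/2) * (F y)\<^sup>2 + (1 - p/2) * q\<^sup>2"
      by (rule Youngs_inequality_0) (use assms Fy in auto)
    also have "(F y)\<^sup>2 powr (p/2) = F y powr p" using Fy by (simp add: powr_powr flip: powr_numeral)
    also have "q\<^sup>2 powr (1 - p/2) = q powr (2 - p)"
      using assms by (simp add: powr_powr algebra_simps flip: powr_numeral)
    finally have "q powr (p - 2) * (F y powr p * q powr (2 - p))
        \<le> q powr (p - 2) * ((p/2) * (F y)\<^sup>2 + (1 - p/2) * q\<^sup>2)"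
      by (rule mult_left_mono) simp
    moreover have "q powr (p - 2) * q powr (2 - p) = 1" using assms by (simp flip: powr_add)
    moreover have "q powr (p - 2) * q\<^sup>2 = q powr p" using assms by (simp flip: powr_numeral powr_add)
    ultimately show ?thesis by (simp add: algebra_simps)
  qed (use assms in auto)
  have "pavg J A w (\<lambda>y. F y powr p)
      \<le> pavg J A w (\<lambda>y. (p/2) * q powr (p - 2) * (F y)\<^sup>2 + (1 - p/2) * q powr p)"
    by (rule pavg_mono) (rule le)
  also have "\<dots> = (p/2) * q powr (p - 2) * pavg J A w (\<lambda>y. (F y)\<^sup>2) + (1 - p/2) * q powr p"
    using assms by (simp only: pavg_add pavg_mult pavg_const)
  also have "\<dots> \<le> (p/2) * q powr (p - 2) * q\<^sup>2 + (1 - p/2) * q powr p"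
    using assms by (intro add_right_mono mult_left_mono sq) auto
  also have "q powr (p - 2) * q\<^sup>2 = q powr p" using assms by (simp flip: powr_numeral powr_add)
  then have "(p/2) * q powr (p - 2) * q\<^sup>2 + (1 - p/2) * q powr p = q powr p"
    by (simp add: algebra_simps)
  finally show ?thesis .
qed

text \<open>Outside \<open>{1..m}\<close> the samples of \<open>rademacher\<close> are 0, whereas
  sign functions are \<open>undefined\<close>; the condition on \<open>f\<close> bridges the two
  conventions.\<close>

lemma expectation_rademacher:
  fixes f :: "(nat \<Rightarrow> real) \<Rightarrow> real"
  assumes f: "\<And>\<epsilon> \<epsilon>'. (\<And>i. i \<in> {1..m} \<Longrightarrow> \<epsilon> i = \<epsilon>' i) \<Longrightarrow> f \<epsilon> = f \<epsilon>'"
  shows "measure_pmf.expectation (rademacher m) f = savg {1..m} f"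
proof -
  let ?p = "\<lambda>_::nat. pmf_of_set {-1, 1::real}"
  have "Pi_pmf {1..m} undefined ?p = pmf_of_set (PiE_dflt {1..m} undefined (\<lambda>_. {-1, 1}))"
    by (rule Pi_pmf_of_set) auto
  also have "PiE_dflt {1..m} undefined (\<lambda>_. {-1, 1}) = signs {1..m}"
    by (auto simp: PiE_dflt_def PiE_def extensional_def)
  finally have eq: "Pi_pmf {1..m} undefined ?p = pmf_of_set (signs {1..m})" .
  have "measure_pmf.expectation (rademacher m) f
      = measure_pmf.expectation (pmf_of_set (signs {1..m})) (\<lambda>\<epsilon>. f (\<lambda>x. if x \<in> {1..m} then \<epsilon> x else 0))"
    unfolding rademacher_def Pi_pmf_default_swap[OF finite_atLeastAtMost, of 1 m 0 undefined ?p, symmetric] eq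
    by simp
  also have "\<dots> = measure_pmf.expectation (pmf_of_set (signs {1..m})) f"
    by (intro arg_cong[where f = "measure_pmf.expectation _"] ext f) auto
  also have "\<dots> = sum f (signs {1..m}) / real (card (signs {1..m}))"
  proof (rule integral_pmf_of_set)
    have "(\<lambda>i\<in>{1..m}. 1) \<in> signs {1..m}" by auto
    then show "signs {1..m} \<noteq> {}" by blast
  qed (simp add: finite_signs)
  also have "\<dots> = savg {1..m} f" by (simp add: savg_eq_sum card_signs power_divide)
  finally show ?thesis .
qed

lemma nontrivial_infratype_if_type:
  assumes "nontrivial_type (X :: 'a::real_normed_vector itself)"
  shows "nontrivial_infratype X"
proof -
  obtain p T where p: "1 < p" "p \<in> {1..2}" and T: "\<And>m (x :: nat \<Rightarrow> 'a).
      (measure_pmf.expectation (rademacher m) (\<lambda>\<epsilon>. norm (\<Sum>i=1..m. \<epsilon> i *\<^sub>R x i) powr p)) powr (1 / p)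
        \<le> T * (\<Sum>i=1..m. norm (x i) powr p) powr (1 / p)"
    using assms unfolding nontrivial_type_def has_type_def by blast
  have "(MIN \<theta>\<in>signs {1..m}. norm (\<Sum>i=1..m. \<theta> i *\<^sub>R x i))
        \<le> T * (\<Sum>i=1..m. norm (x i) powr p) powr (1 / p)" for m and x :: "nat \<Rightarrow> 'a"
  proof -
    define Y where "Y \<theta> = norm (\<Sum>i=1..m. \<theta> i *\<^sub>R x i)" for \<theta> :: "nat \<Rightarrow> real"
    define \<mu> where "\<mu> = (MIN \<theta>\<in>signs {1..m}. Y \<theta>)"
    have fin: "finite (Y ` signs {1..m})" by (simp add: finite_signs)
    have "(\<lambda>i\<in>{1..m}. 1) \<in> signs {1..m}" by auto
    then have ne: "Y ` signs {1..m} \<noteq> {}" by blast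
    have "\<mu> \<in> Y ` signs {1..m}" unfolding \<mu>_def by (rule Min_in[OF fin ne])
    then have \<mu>0: "0 \<le> \<mu>" by (auto simp: Y_def)
    have "\<mu> powr p \<le> savg {1..m} (\<lambda>\<theta>. Y \<theta> powr p)"
      by (rule signs.pavg_ge) (use fin \<mu>0 p in \<open>auto simp: \<mu>_def intro!: powr_mono2 Min_le\<close>)
    also have "\<dots> = measure_pmf.expectation (rademacher m) (\<lambda>\<epsilon>. Y \<epsilon> powr p)"
      by (rule expectation_rademacher[symmetric]) (auto simp: Y_def intro!: arg_cong2[where f = "(powr)"]
          arg_cong[where f = norm] sum.cong)
    finally have "(\<mu> powr p) powr (1 / p)
        \<le> (measure_pmf.expectation (rademacher m) (\<lambda>\<epsilon>. Y \<epsilon> powr p)) powr (1 / p)"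
      using p by (intro powr_mono2) auto
    also have "\<dots> \<le> T * (\<Sum>i=1..m. norm (x i) powr p) powr (1 / p)"
      unfolding Y_def by (rule T)
    also have "(\<mu> powr p) powr (1 / p) = \<mu>" using \<mu>0 p by (simp add: powr_powr)
    finally show ?thesis by (simp add: \<mu>_def Y_def)
  qed
  then show ?thesis unfolding nontrivial_infratype_def has_infratype_def using p by blast
qed

text \<open>For \<open>n\<close> vectors of the unit ball infratype gives a bound of order
  \<open>n powr (1/p)\<close>, which falls below \<open>n/2\<close> for large \<open>n\<close>
  because \<open>1/p < 1\<close>.\<close>

lemma B_convex_if_infratype:
  assumes "nontrivial_infratype (X :: 'a::real_normed_vector itself)"
  shows "B_convex X"
proof -
  obtain p I where p: "1 < p" "p \<in> {1..2}" and I: "\<And>m (x :: nat \<Rightarrow> 'a).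
      (MIN \<theta>\<in>signs {1..m}. norm (\<Sum>i=1..m. \<theta> i *\<^sub>R x i))
        \<le> I * (\<Sum>i=1..m. norm (x i) powr p) powr (1 / p)"
    using assms unfolding nontrivial_infratype_def has_infratype_def by blast
  define s where "s = 1 - 1 / p"
  have s: "s > 0" using p by (simp add: s_def)
  have "filterlim (\<lambda>n. real n powr s) at_top sequentially"
    using s by real_asymp
  then have "\<forall>\<^sub>F n in sequentially. 2 * \<bar>I\<bar> \<le> real n powr s"
    unfolding filterlim_at_top by blast
  then obtain n0 where n0: "\<And>n. n \<ge> n0 \<Longrightarrow> 2 * \<bar>I\<bar> \<le> real n powr s"
    unfolding eventually_sequentially by blast
  define n where "n = max 2 n0"
  have n: "n \<ge> 2" "2 * \<bar>I\<bar> \<le> real n powr s" using n0 by (auto simp: n_def)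
  have "\<exists>\<theta>\<in>signs {1..n}. norm (\<Sum>i=1..n. \<theta> i *\<^sub>R x i) \<le> (1 - 1/2) * real n"
    if x: "\<forall>i\<in>{1..n}. norm (x i) \<le> 1" for x :: "nat \<Rightarrow> 'a"
  proof -
    define Y where "Y \<theta> = norm (\<Sum>i=1..n. \<theta> i *\<^sub>R x i)" for \<theta> :: "nat \<Rightarrow> real"
    have fin: "finite (Y ` signs {1..n})" by (simp add: finite_signs)
    have "(\<lambda>i\<in>{1..n}. 1) \<in> signs {1..n}" by auto
    then have ne: "Y ` signs {1..n} \<noteq> {}" by blast
    have "Min (Y ` signs {1..n}) \<in> Y ` signs {1..n}" by (rule Min_in[OF fin ne])
    then obtain \<theta> where \<theta>: "\<theta> \<in> signs {1..n}" "Y \<theta> = Min (Y ` signs {1..n})" by auto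
    have "Y \<theta> \<le> I * (\<Sum>i=1..n. norm (x i) powr p) powr (1 / p)"
      unfolding \<theta>(2) unfolding Y_def by (rule I)
    also have "\<dots> \<le> \<bar>I\<bar> * real n powr (1 / p)"
    proof (rule mult_mono)
      have "(\<Sum>i=1..n. norm (x i) powr p) \<le> real (card {1..n}) * 1"
        by (rule sum_bounded_above) (use x p in \<open>auto intro!: powr_le1\<close>)
      then show "(\<Sum>i=1..n. norm (x i) powr p) powr (1 / p) \<le> real n powr (1 / p)"
        using p by (intro powr_mono2) (auto intro: sum_nonneg)
    qed auto
    also have "\<dots> \<le> (real n powr s / 2) * real n powr (1 / p)"
      using n by (intro mult_right_mono) auto
    also have "\<dots> = (1 - 1/2) * real n" using n by (simp add: s_def flip: powr_add)
    finally show ?thesis using \<theta>(1) by (auto simp: Y_def)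
  qed
  then show ?thesis unfolding B_convex_def using n(1) by (intro exI[of _ n] conjI exI[of _ "1/2"]) auto
qed

text \<open>With \<open>S\<close> the sum of the \<open>norm (x i) powr p\<close>, sort the vectors
  by the largest power \<open>n ^ k\<close> not exceeding \<open>S / norm (x i) powr p\<close>.
  Level \<open>k\<close> holds at most \<open>n ^ Suc k\<close> vectors, of norm at most
  \<open>S powr (1/p) * n powr (- k/p)\<close>, so the block bound makes its quadratic mean at most
  \<open>A * S powr (1/p) * \<rho> ^ k\<close>. Minkowski's inequality then sums a geometric
  series.\<close>

lemma nontrivial_type_if_B_convex:
  assumes "B_convex (X :: 'a::real_normed_vector itself)"
  shows "nontrivial_type X"
proof -
  obtain n c where n: "n \<ge> 2" and c: "1/4 \<le> c" "c < 1" and base: "\<And>x :: nat \<Rightarrow> 'a.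
      savg {1..n} (\<lambda>\<theta>. (norm (\<Sum>i=1..n. \<theta> i *\<^sub>R x i))\<^sup>2) \<le> c * real n * (\<Sum>i=1..n. (norm (x i))\<^sup>2)"
    by (rule B_convex_quadratic[OF assms(1)]) blast
  define r where "r = sqrt c"
  have r: "0 < r" "r < 1" using c by (auto simp: r_def)
  have ln_n: "ln (real n) > 0" using n by simp
  \<comment> \<open>Half of the critical exponent at which \<open>r * real n powr s\<close> would
    reach 1; the cap \<open>1/2\<close> keeps \<open>p\<close> at most 2.\<close>
  define s where "s = min (1/2) (- ln r / (2 * ln (real n)))"
  have s: "0 < s" "s \<le> 1/2" using r ln_n by (auto simp: s_def intro!: divide_neg_pos)
  define p where "p = 1 / (1 - s)"
  have p: "1 < p" "p \<le> 2" using s by (auto simp: p_def field_simps)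
  define \<rho> where "\<rho> = r * real n powr s"
  have \<rho>: "0 < \<rho>" "\<rho> < 1"
  proof -
    show "0 < \<rho>" using r n by (simp add: \<rho>_def)
    have "s * ln (real n) \<le> - ln r / (2 * ln (real n)) * ln (real n)"
      using ln_n by (intro mult_right_mono) (auto simp: s_def)
    also have "\<dots> = - ln r / 2" using ln_n by simp
    also have "\<dots> < - ln r" using r by simp
    finally have "ln r + s * ln (real n) < 0" by simp
    then have "ln \<rho> < 0" using r n by (simp add: \<rho>_def ln_mult ln_powr)
    then show "\<rho> < 1" using \<open>0 < \<rho>\<close> by simp
  qed
  define A where "A = r * real n"
  have A: "A > 0" using r n by (simp add: A_def)
  define T where "T = A / (1 - \<rho>)"
  have T: "T > 0" using A \<rho> by (simp add: T_def)
  have "(measure_pmf.expectation (rademacher m) (\<lambda>\<epsilon>. norm (\<Sum>i=1..m. \<epsilon> i *\<^sub>R x i) powr p)) powr (1 / p)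
        \<le> T * (\<Sum>i=1..m. norm (x i) powr p) powr (1 / p)" for m and x :: "nat \<Rightarrow> 'a"
  proof -
    define Y where "Y \<theta> = norm (\<Sum>i=1..m. \<theta> i *\<^sub>R x i)" for \<theta> :: "nat \<Rightarrow> real"
    have Y0: "0 \<le> Y \<theta>" for \<theta> by (simp add: Y_def)
    define S where "S = (\<Sum>i=1..m. norm (x i) powr p)"
    have S0: "0 \<le> S" by (simp add: S_def sum_nonneg)
    have le_S: "norm (x i) powr p \<le> S" if "i \<in> {1..m}" for i
      unfolding S_def using that by (intro member_le_sum) auto
    have "savg {1..m} (\<lambda>\<theta>. Y \<theta> powr p) \<le> (T * S powr (1 / p)) powr p"
    proof (cases "S = 0")
      case True
      have "x i = 0" if "i \<in> {1..m}" for i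
        using le_S[OF that] True by (simp add: powr_def split: if_splits)
      then have "Y \<theta> = 0" for \<theta> by (simp add: Y_def)
      then show ?thesis using p by (simp add: signs.pavg_const)
    next
      case False
      then have S: "S > 0" using S0 by simp
      define q where "q = T * S powr (1 / p)"
      have q: "q > 0" using T S by (simp add: q_def)
      \<comment> \<open>Zero vectors belong to no level and contribute nothing to the sums.\<close>
      define I where "I = {i \<in> {1..m}. x i \<noteq> 0}"
      have "\<exists>k. real n ^ k * norm (x i) powr p \<le> S \<and> S < real n ^ Suc k * norm (x i) powr p"
        if "i \<in> I" for i
      proof -
        have pos: "norm (x i) powr p > 0" using that by (simp add: I_def)
        have "real n > 1" using n by simp
        then obtain K where "S / norm (x i) powr p < real n ^ K" using real_arch_pow by blast
        then have ex: "S < real n ^ K * norm (x i) powr p" using pos by (simp add: field_simps)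
        define K0 where "K0 = (LEAST K. S < real n ^ K * norm (x i) powr p)"
        have K0: "S < real n ^ K0 * norm (x i) powr p" unfolding K0_def using ex by (rule LeastI)
        have "K0 \<noteq> 0"
        proof
          assume "K0 = 0"
          then show False using K0 le_S[of i] that by (simp add: I_def)
        qed
        then obtain k where k: "K0 = Suc k" by (cases K0) auto
        then have "\<not> S < real n ^ k * norm (x i) powr p"
          unfolding K0_def using not_less_Least[of k "\<lambda>K. S < real n ^ K * norm (x i) powr p"] by simp
        then show ?thesis using K0 k by (intro exI[of _ k]) (simp del: power_Suc)
      qed
      then obtain \<kappa> where \<kappa>: "\<And>i. i \<in> I \<Longrightarrow> real n ^ \<kappa> i * norm (x i) powr p \<le> S"
          "\<And>i. i \<in> I \<Longrightarrow> S < real n ^ Suc (\<kappa> i) * norm (x i) powr p"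
        by metis
      have fI: "finite I" by (simp add: I_def)
      define I' where "I' k = {i \<in> I. \<kappa> i = k}" for k
      define D where "D k = S powr (1 / p) * real n powr (- real k / p)" for k :: nat
      have D0: "0 \<le> D k" for k by (simp add: D_def)
      have normle: "norm (x i) \<le> D k" if "i \<in> I' k" for i k
      proof -
        have "norm (x i) powr p \<le> S * real n powr (- real k)"
          using \<kappa>(1)[of i] that n by (simp add: I'_def powr_minus powr_realpow field_simps)
        then have "(norm (x i) powr p) powr (1 / p) \<le> (S * real n powr (- real k)) powr (1 / p)"
          using p by (intro powr_mono2) auto
        then show ?thesis using p S by (simp add: powr_powr powr_mult D_def)
      qed
      have card: "card (I' k) \<le> n ^ Suc k" for k
      proof -
        have "real (card (I' k)) * S = (\<Sum>i\<in>I' k. S)" by simp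
        also have "\<dots> \<le> (\<Sum>i\<in>I' k. real n ^ Suc k * norm (x i) powr p)"
          by (rule sum_mono) (use \<kappa>(2) in \<open>auto simp: I'_def simp del: power_Suc intro: less_imp_le\<close>)
        also have "\<dots> = real n ^ Suc k * (\<Sum>i\<in>I' k. norm (x i) powr p)" by (simp add: sum_distrib_left)
        also have "\<dots> \<le> real n ^ Suc k * S"
          unfolding S_def by (intro mult_left_mono sum_mono2) (auto simp: I'_def I_def)
        finally have "real (card (I' k)) \<le> real n ^ Suc k" using S by (simp del: power_Suc)
        then show ?thesis by (metis of_nat_le_iff of_nat_power)
      qed
      define Z where "Z k \<theta> = (\<Sum>i\<in>I' k. \<theta> i *\<^sub>R x i)" for k and \<theta> :: "nat \<Rightarrow> real"
      define K where "K = \<kappa> ` I"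
      have fK: "finite K" by (simp add: K_def fI)
      have YZ: "Y \<theta> = norm (\<Sum>k\<in>K. Z k \<theta>)" for \<theta>
      proof -
        have "(\<Sum>i=1..m. \<theta> i *\<^sub>R x i) = (\<Sum>i\<in>I. \<theta> i *\<^sub>R x i)"
          by (rule sum.mono_neutral_right) (auto simp: I_def)
        also have "\<dots> = (\<Sum>k\<in>K. Z k \<theta>)"
          unfolding Z_def I'_def K_def by (rule sum.group[symmetric]) (auto simp: fI)
        finally show ?thesis by (simp add: Y_def)
      qed
      have Zle: "sqrt (savg {1..m} (\<lambda>\<theta>. (norm (Z k \<theta>))\<^sup>2)) \<le> A * S powr (1 / p) * \<rho> ^ k" for k
      proof -
        have "savg {1..m} (\<lambda>\<theta>. (norm (Z k \<theta>))\<^sup>2) \<le> (c * (real n)\<^sup>2) ^ Suc k * (D k)\<^sup>2"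
          unfolding Z_def
          by (rule quadratic_bound_power[OF _ base _ _ card normle]) (use c in \<open>auto simp: I'_def I_def\<close>)
        also have "c * (real n)\<^sup>2 = A\<^sup>2" using c by (simp add: A_def r_def power_mult_distrib)
        also have "(A\<^sup>2) ^ Suc k * (D k)\<^sup>2 = (A ^ Suc k * D k)\<^sup>2"
          by (simp add: power_mult_distrib power_mult[symmetric] mult.commute)
        finally have "sqrt (savg {1..m} (\<lambda>\<theta>. (norm (Z k \<theta>))\<^sup>2)) \<le> A ^ Suc k * D k"
          using A D0 by (intro real_le_lsqrt) (auto simp: signs.pavg_nonneg)
        also have "\<dots> = A * S powr (1 / p) * (A ^ k * real n powr (- real k / p))"
          by (simp add: D_def)
        \<comment> \<open>Here \<open>1/p = 1 - s\<close>, so per level the gain \<open>r\<close>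
          competes with a growth of only \<open>real n powr s\<close>.\<close>
        also have "A ^ k * real n powr (- real k / p) = \<rho> ^ k"
        proof -
          have "real n powr (- real k / p) = (real n powr (s - 1)) ^ k"
            using n by (simp add: p_def powr_realpow[symmetric] powr_powr algebra_simps)
          then have "A ^ k * real n powr (- real k / p) = (r * (real n * real n powr (s - 1))) ^ k"
            by (simp add: A_def power_mult_distrib)
          also have "real n * real n powr (s - 1) = real n powr s" using n by (simp add: powr_diff)
          finally show ?thesis by (simp add: \<rho>_def)
        qed
        finally show ?thesis .
      qed
      have "sqrt (savg {1..m} (\<lambda>\<theta>. (Y \<theta>)\<^sup>2)) \<le> (\<Sum>k\<in>K. sqrt (savg {1..m} (\<lambda>\<theta>. (norm (Z k \<theta>))\<^sup>2)))"
        unfolding YZ sqrt_savg_square sum_distrib_left[symmetric]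
        by (intro mult_left_mono L2_set_norm_sum_le fK) auto
      also have "\<dots> \<le> (\<Sum>k\<in>K. A * S powr (1 / p) * \<rho> ^ k)" by (intro sum_mono Zle)
      also have "\<dots> = A * S powr (1 / p) * (\<Sum>k\<in>K. \<rho> ^ k)" by (simp add: sum_distrib_left)
      also have "\<dots> \<le> A * S powr (1 / p) * (1 / (1 - \<rho>))"
      proof (rule mult_left_mono)
        have "(\<Sum>k\<in>K. \<rho> ^ k) \<le> (\<Sum>k. \<rho> ^ k)"
          using fK \<rho> by (intro sum_le_suminf) (auto simp: summable_geometric)
        then show "(\<Sum>k\<in>K. \<rho> ^ k) \<le> 1 / (1 - \<rho>)" using \<rho> by (simp add: suminf_geometric)
      qed (use A in auto)
      also have "\<dots> = q" by (simp add: q_def T_def)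
      finally have "savg {1..m} (\<lambda>\<theta>. (Y \<theta>)\<^sup>2) \<le> q\<^sup>2"
        by (rule sqrt_le_D)
      then show ?thesis
        unfolding q_def[symmetric] using q p Y0 by (intro signs.pavg_powr_le) auto
    qed
    then have "(savg {1..m} (\<lambda>\<theta>. Y \<theta> powr p)) powr (1 / p) \<le> ((T * S powr (1 / p)) powr p) powr (1 / p)"
      using p by (intro powr_mono2) (auto simp: signs.pavg_nonneg)
    also have "\<dots> = T * S powr (1 / p)" using p T by (simp add: powr_powr)
    also have "savg {1..m} (\<lambda>\<theta>. Y \<theta> powr p) = measure_pmf.expectation (rademacher m) (\<lambda>\<epsilon>. Y \<epsilon> powr p)"
      by (rule expectation_rademacher[symmetric]) (auto simp: Y_def intro!: arg_cong2[where f = "(powr)"]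
          arg_cong[where f = norm] sum.cong)
    finally show ?thesis by (simp add: Y_def S_def)
  qed
  then show ?thesis unfolding nontrivial_type_def has_type_def using p by (intro exI[of _ p]) auto
qed

lemma nontrivial_type_iff_B_convex: "nontrivial_type X \<longleftrightarrow> B_convex X"
  using nontrivial_infratype_if_type B_convex_if_infratype nontrivial_type_if_B_convex by blast

lemma nontrivial_infratype_iff_B_convex: "nontrivial_infratype X \<longleftrightarrow> B_convex X"
  using nontrivial_infratype_if_type B_convex_if_infratype nontrivial_type_if_B_convex by blast

section \<open>Symmetrization\<close>

text \<open>Subtracting an independent copy \<open>y'\<close> can only increase the average, by
  Jensen's inequality. Exchanging \<open>y j\<close> with \<open>y' j\<close> where
  \<open>\<theta> j = -1\<close> preserves the product weights and multiplies the
  \<open>j\<close>-th difference by \<open>\<theta> j\<close>, so the sign bound applies to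
  differences of values. Hence \<open>D\<close> bounds a diameter and not a norm.\<close>

lemma (in weights) symmetrization:
  fixes v :: "'i \<Rightarrow> 'a \<Rightarrow> 'b::real_normed_vector"
  assumes J: "finite J"
    and sign: "\<And>u :: 'i \<Rightarrow> 'b. (\<And>j. j \<in> J \<Longrightarrow> norm (u j) \<le> D) \<Longrightarrow> savg J (\<lambda>\<theta>. norm (\<Sum>j\<in>J. \<theta> j *\<^sub>R u j)) \<le> B"
    and D: "\<And>j a a'. j \<in> J \<Longrightarrow> a \<in> A \<Longrightarrow> a' \<in> A \<Longrightarrow> norm (v j a - v j a') \<le> D"
  shows "pavg J A w (\<lambda>y. norm (\<Sum>j\<in>J. v j (y j) - (\<Sum>a\<in>A. w a *\<^sub>R v j a))) \<le> B"
proof -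
  define c where "c j = (\<Sum>a\<in>A. w a *\<^sub>R v j a)" for j
  define S where "S \<theta> y y' = norm (\<Sum>j\<in>J. \<theta> j *\<^sub>R (v j (y j) - v j (y' j)))" for \<theta> y y'
  define O1 where "O1 = (\<lambda>_::'i. 1::real)"
  have "pavg J A w (\<lambda>y. norm (\<Sum>j\<in>J. v j (y j) - c j)) \<le> pavg J A w (\<lambda>y. pavg J A w (\<lambda>y'. S O1 y y'))"
  proof (rule pavg_mono)
    fix y
    have "(\<Sum>j\<in>J. v j (y j) - c j) = (\<Sum>j\<in>J. pavg J A w (\<lambda>y'. v j (y j) - v j (y' j)))"
      by (rule sum.cong) (simp_all add: pavg_diff pavg_const J pavg_component[OF J, of _ "v _"] c_def)
    also have "\<dots> = pavg J A w (\<lambda>y'. \<Sum>j\<in>J. v j (y j) - v j (y' j))" by (rule pavg_sum[symmetric])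
    finally show "norm (\<Sum>j\<in>J. v j (y j) - c j) \<le> pavg J A w (\<lambda>y'. S O1 y y')"
      by (simp add: S_def O1_def norm_pavg_le)
  qed
  also have "\<dots> = savg J (\<lambda>\<theta>. pavg J A w (\<lambda>y. pavg J A w (\<lambda>y'. S O1 y y')))"
    by (simp add: signs.pavg_const J)
  also have "\<dots> = savg J (\<lambda>\<theta>. pavg J A w (\<lambda>y. pavg J A w (\<lambda>y'. S \<theta> y y')))"
  proof (rule pavg_cong)
    fix \<theta> :: "'i \<Rightarrow> real" assume \<theta>: "\<theta> \<in> signs J"
    define P where "P = (J \<rightarrow>\<^sub>E A) \<times> (J \<rightarrow>\<^sub>E A)"
    define sw where "sw = (\<lambda>(y :: 'i \<Rightarrow> 'a, y' :: 'i \<Rightarrow> 'a).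
      (\<lambda>j\<in>J. if \<theta> j = 1 then y j else y' j, \<lambda>j\<in>J. if \<theta> j = 1 then y' j else y j))"
    \<comment> \<open>\<open>sw\<close> mixes the two copies, so the iterated average is rewritten
      as one sum over pairs before reindexing.\<close>
    have pair: "pavg J A w (\<lambda>y. pavg J A w (\<lambda>y'. F y y'))
        = (\<Sum>(y, y')\<in>P. (\<Prod>j\<in>J. w (y j) * w (y' j)) *\<^sub>R F y y')" for F :: "_ \<Rightarrow> _ \<Rightarrow> real"
      unfolding pavg_def scaleR_sum_right P_def
      by (simp add: sum.cartesian_product prod.distrib mult.assoc)
    have sw_sw: "sw (sw z) = z" if "z \<in> P" for z
      using that by (auto simp: sw_def P_def PiE_iff extensional_def fun_eq_iff)
    have sw_P: "sw z \<in> P" if "z \<in> P" for z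
      using that by (auto simp: sw_def P_def PiE_iff extensional_def fun_eq_iff)
    show "pavg J A w (\<lambda>y. pavg J A w (\<lambda>y'. S O1 y y')) = pavg J A w (\<lambda>y. pavg J A w (\<lambda>y'. S \<theta> y y'))"
      unfolding pair
    proof (rule sum.reindex_bij_witness[where i = sw and j = sw])
      fix z assume z: "z \<in> P"
      obtain y y' where yy: "z = (y, y')" by (cases z)
      have w: "(\<Prod>j\<in>J. w (fst (sw z) j) * w (snd (sw z) j)) = (\<Prod>j\<in>J. w (y j) * w (y' j))"
        by (rule prod.cong) (auto simp: sw_def yy)
      have "S \<theta> (fst (sw z)) (snd (sw z)) = S O1 y y'"
        unfolding S_def
      proof (intro arg_cong[where f = norm] sum.cong refl)
        fix j assume j: "j \<in> J"
        have "\<theta> j = 1 \<or> \<theta> j = -1" using \<theta> j by (auto simp: PiE_iff)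
        then show "\<theta> j *\<^sub>R (v j (fst (sw z) j) - v j (snd (sw z) j)) = O1 j *\<^sub>R (v j (y j) - v j (y' j))"
          using j by (auto simp: sw_def yy O1_def)
      qed
      with w show "(case sw z of (y, y') \<Rightarrow> (\<Prod>j\<in>J. w (y j) * w (y' j)) *\<^sub>R S \<theta> y y')
          = (case z of (y, y') \<Rightarrow> (\<Prod>j\<in>J. w (y j) * w (y' j)) *\<^sub>R S O1 y y')"
        by (simp add: case_prod_unfold yy)
    qed (use sw_sw sw_P in auto)
  qed
  also have "\<dots> = pavg J A w (\<lambda>y. savg J (\<lambda>\<theta>. pavg J A w (\<lambda>y'. S \<theta> y y')))" by (rule pavg_swap)
  also have "\<dots> = pavg J A w (\<lambda>y. pavg J A w (\<lambda>y'. savg J (\<lambda>\<theta>. S \<theta> y y')))"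
    by (rule pavg_cong, rule pavg_swap)
  also have "\<dots> \<le> B"
  proof (rule pavg_le[OF J], rule pavg_le[OF J])
    fix y y' assume "y \<in> J \<rightarrow>\<^sub>E A" "y' \<in> J \<rightarrow>\<^sub>E A"
    then have "norm (v j (y j) - v j (y' j)) \<le> D" if "j \<in> J" for j
      using that by (intro D) auto
    then show "savg J (\<lambda>\<theta>. S \<theta> y y') \<le> B" unfolding S_def by (rule sign)
  qed
  finally show ?thesis by (simp add: c_def)
qed

text \<open>\<open>N\<close> precedes the weights and the values, so one threshold serves laws with
  arbitrarily many atoms.\<close>

lemma B_convex_weighted_average:
  assumes "B_convex (X :: 'b::real_normed_vector itself)" "0 < e"
  shows "\<exists>N\<ge>1. \<forall>(J :: 'i set) A (w :: 'a \<Rightarrow> real) (v :: 'i \<Rightarrow> 'a \<Rightarrow> 'b) D.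
    finite J \<longrightarrow> N \<le> card J \<longrightarrow> weights A w \<longrightarrow> 0 \<le> D \<longrightarrow>
    (\<forall>j\<in>J. \<forall>a\<in>A. \<forall>a'\<in>A. norm (v j a - v j a') \<le> D) \<longrightarrow>
    pavg J A w (\<lambda>y. norm (\<Sum>j\<in>J. v j (y j) - (\<Sum>a\<in>A. w a *\<^sub>R v j a))) \<le> e * D * real (card J)"
proof -
  from B_convex_sign_average[OF assms, where ?'i = 'i] obtain N where
    N: "N \<ge> 1 \<and> (\<forall>(J :: 'i set) (u :: 'i \<Rightarrow> 'b) D. finite J \<longrightarrow> N \<le> card J \<longrightarrow> 0 \<le> D \<longrightarrow>
      (\<forall>j\<in>J. norm (u j) \<le> D) \<longrightarrow>
      savg J (\<lambda>\<theta>. norm (\<Sum>j\<in>J. \<theta> j *\<^sub>R u j)) \<le> e * D * real (card J))" ..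
  show ?thesis
  proof (intro exI[of _ N] conjI allI impI)
    show "1 \<le> N" using N by (rule conjunct1)
    fix J :: "'i set" and A and w :: "'a \<Rightarrow> real" and v :: "'i \<Rightarrow> 'a \<Rightarrow> 'b" and D
    assume *: "finite J" "N \<le> card J" "weights A w" "0 \<le> D"
      "\<forall>j\<in>J. \<forall>a\<in>A. \<forall>a'\<in>A. norm (v j a - v j a') \<le> D"
    show "pavg J A w (\<lambda>y. norm (\<Sum>j\<in>J. v j (y j) - (\<Sum>a\<in>A. w a *\<^sub>R v j a))) \<le> e * D * real (card J)"
    proof (rule weights.symmetrization[OF *(3,1)])
      fix u :: "'i \<Rightarrow> 'b" assume "\<And>j. j \<in> J \<Longrightarrow> norm (u j) \<le> D"
      then show "savg J (\<lambda>\<theta>. norm (\<Sum>j\<in>J. \<theta> j *\<^sub>R u j)) \<le> e * D * real (card J)"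
        using N[THEN conjunct2, rule_format, OF *(1,2,4)] by blast
    qed (use *(5) in blast)
  qed
qed

section \<open>Caratheodory, Radon, Tverberg, selection and weak nets\<close>

lemma ennreal_tendsto_zeroI:
  assumes "\<And>e::real. 0 < e \<Longrightarrow> \<forall>\<^sub>F x in F. f x \<le> ennreal e"
  shows "(f \<longlongrightarrow> 0) F"
proof (rule tendsto_zero_ennreal)
  fix e :: real assume e: "0 < e"
  then have "\<forall>\<^sub>F x in F. f x \<le> ennreal (e/2)" by (intro assms) simp
  moreover have "ennreal (e/2) < ennreal e" using e by (simp add: ennreal_less_iff)
  ultimately show "\<forall>\<^sub>F x in F. f x < ennreal e"
    by (auto elim!: eventually_mono)
qed

lemma ennreal_divide_le:
  assumes "x \<le> ennreal (e * d)" "0 < d" "0 \<le> e"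
  shows "x / ennreal d \<le> ennreal e"
proof -
  have "x / ennreal d \<le> ennreal (e * d) / ennreal d" by (rule divide_right_mono_ennreal[OF assms(1)])
  also have "\<dots> = ennreal e" using assms by (simp add: divide_ennreal)
  finally show ?thesis .
qed

lemma set_edist_le: "a \<in> A \<Longrightarrow> b \<in> B \<Longrightarrow> dist a b \<le> d \<Longrightarrow> set_edist A B \<le> ennreal d"
  unfolding set_edist_def by (meson INF_lower2 ennreal_leI)

lemma dist_le_diameter: "finite P \<Longrightarrow> x \<in> P \<Longrightarrow> y \<in> P \<Longrightarrow> dist x y \<le> diameter P"
  by (simp add: diameter_bounded_bound finite_imp_bounded)

lemma diameter_pos:
  assumes "finite P" "2 \<le> card P"
  shows "0 < diameter P"
proof -
  have "\<not> card P \<le> 1" using assms by simp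
  then obtain x y where "x \<in> P" "y \<in> P" "x \<noteq> y"
    using card_le_Suc0_iff_eq[OF assms(1)] by (metis One_nat_def)
  then have "0 < dist x y" "dist x y \<le> diameter P" using dist_le_diameter[OF assms(1)] by auto
  then show ?thesis by linarith
qed

lemma diameter_le_max_diameter: "j \<in> {1..r} \<Longrightarrow> diameter (Z j) \<le> max_diameter r Z"
  unfolding max_diameter_def by (intro Max_ge) auto

lemma max_diameter_pos:
  assumes "Z \<in> colour_classes r c" "2 \<le> c" "1 \<le> r"
  shows "0 < max_diameter r Z"
proof -
  have "1 \<in> {1..r}" using assms by simp
  then have "0 < diameter (Z 1)" using assms unfolding colour_classes_def by (intro diameter_pos) auto
  also have "\<dots> \<le> max_diameter r Z" using assms by (intro diameter_le_max_diameter) auto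
  finally show ?thesis .
qed

lemma colour_classes_dist_le:
  assumes "Z \<in> colour_classes r c" "j \<in> {1..r}" "x \<in> Z j" "y \<in> Z j"
  shows "dist x y \<le> max_diameter r Z"
proof -
  have "dist x y \<le> diameter (Z j)"
    using assms unfolding colour_classes_def by (intro dist_le_diameter) auto
  also have "\<dots> \<le> max_diameter r Z" by (rule diameter_le_max_diameter[OF assms(2)])
  finally show ?thesis .
qed

section \<open>Means of independent choices\<close>

lemma weights_uniform: "finite A \<Longrightarrow> A \<noteq> {} \<Longrightarrow> weights A (\<lambda>_. 1 / real (card A))"
  by unfold_locales auto

lemma mean_in_convex_hull:
  assumes "finite J" "J \<noteq> {}" "\<And>j. j \<in> J \<Longrightarrow> g j \<in> C"
  shows "(1 / real (card J)) *\<^sub>R (\<Sum>j\<in>J. g j) \<in> convex hull C"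
  unfolding scaleR_sum_right
  by (rule convex_sum) (use assms in \<open>auto intro: hull_inc\<close>)

lemma B_convex_selection:
  assumes "B_convex (X :: 'b::real_normed_vector itself)" "0 < e"
  shows "\<exists>N\<ge>1. \<forall>(J :: 'i set) A (w :: 'a \<Rightarrow> real) (v :: 'i \<Rightarrow> 'a \<Rightarrow> 'b) D.
    finite J \<longrightarrow> N \<le> card J \<longrightarrow> weights A w \<longrightarrow> 0 \<le> D \<longrightarrow>
    (\<forall>j\<in>J. \<forall>a\<in>A. \<forall>a'\<in>A. norm (v j a - v j a') \<le> D) \<longrightarrow>
    (\<exists>y\<in>J \<rightarrow>\<^sub>E A. norm (\<Sum>j\<in>J. v j (y j) - (\<Sum>a\<in>A. w a *\<^sub>R v j a)) \<le> e * D * real (card J))"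
proof -
  from B_convex_weighted_average[OF assms, where ?'i = 'i and ?'a = 'a] obtain N where
    N: "N \<ge> 1 \<and> (\<forall>(J :: 'i set) A (w :: 'a \<Rightarrow> real) (v :: 'i \<Rightarrow> 'a \<Rightarrow> 'b) D.
    finite J \<longrightarrow> N \<le> card J \<longrightarrow> weights A w \<longrightarrow> 0 \<le> D \<longrightarrow>
    (\<forall>j\<in>J. \<forall>a\<in>A. \<forall>a'\<in>A. norm (v j a - v j a') \<le> D) \<longrightarrow>
    pavg J A w (\<lambda>y. norm (\<Sum>j\<in>J. v j (y j) - (\<Sum>a\<in>A. w a *\<^sub>R v j a))) \<le> e * D * real (card J))" ..
  show ?thesis
  proof (intro exI[of _ N] conjI allI impI)
    show "1 \<le> N" using N by (rule conjunct1)
    fix J :: "'i set" and A and w :: "'a \<Rightarrow> real" and v :: "'i \<Rightarrow> 'a \<Rightarrow> 'b" and D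
    assume *: "finite J" "N \<le> card J" "weights A w" "0 \<le> D"
      "\<forall>j\<in>J. \<forall>a\<in>A. \<forall>a'\<in>A. norm (v j a - v j a') \<le> D"
    show "\<exists>y\<in>J \<rightarrow>\<^sub>E A. norm (\<Sum>j\<in>J. v j (y j) - (\<Sum>a\<in>A. w a *\<^sub>R v j a)) \<le> e * D * real (card J)"
      by (rule weights.exists_le_pavg[OF *(3,1) N[THEN conjunct2, rule_format, OF *(1-4)]])
         (use *(5) in auto)
  qed
qed

text \<open>Maurey's empirical method: the coefficients of a convex combination form a law with mean
  \<open>a\<close>, and the mean of \<open>k\<close> independent draws lies in
  \<open>conv_k k P\<close>. Some outcome is as close to \<open>a\<close> as the average
  promises.\<close>

lemma Car_tendsto_zero_if_B_convex:
  assumes "B_convex (X :: 'a::real_normed_vector itself)"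
  shows "(\<lambda>k. Car X k) \<longlonglongrightarrow> 0"
proof (rule ennreal_tendsto_zeroI)
  fix e :: real assume e: "0 < e"
  from B_convex_selection[OF assms e, where ?'i = nat and ?'a = 'a] obtain N where
    N: "N \<ge> 1 \<and> (\<forall>(J :: nat set) A (w :: 'a \<Rightarrow> real) (v :: nat \<Rightarrow> 'a \<Rightarrow> 'a) D.
    finite J \<longrightarrow> N \<le> card J \<longrightarrow> weights A w \<longrightarrow> 0 \<le> D \<longrightarrow>
    (\<forall>j\<in>J. \<forall>a\<in>A. \<forall>a'\<in>A. norm (v j a - v j a') \<le> D) \<longrightarrow>
    (\<exists>y\<in>J \<rightarrow>\<^sub>E A. norm (\<Sum>j\<in>J. v j (y j) - (\<Sum>a\<in>A. w a *\<^sub>R v j a)) \<le> e * D * real (card J)))" ..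
  show "\<forall>\<^sub>F k in sequentially. Car X k \<le> ennreal e"
    unfolding eventually_sequentially
  proof (intro exI[of _ N] allI impI)
    fix k assume k: "N \<le> k"
    then have k1: "1 \<le> k" using N by linarith
    show "Car X k \<le> ennreal e"
      unfolding Car_def
    proof (intro SUP_least)
      fix P :: "'a set" and a assume "P \<in> {P. bounded P \<and> 0 < diameter P}" and a: "a \<in> convex hull P"
      then have P: "bounded P" "0 < diameter P" by auto
      obtain S u where S: "finite S" "S \<subseteq> P" "\<forall>x\<in>S. 0 \<le> u x" "sum u S = 1" "(\<Sum>v\<in>S. u v *\<^sub>R v) = a"
        using a unfolding convex_hull_explicit by blast
      have w: "weights S u" using S by unfold_locales auto
      have "norm (x - x') \<le> diameter P" if "x \<in> S" "x' \<in> S" for x x'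
        using that S(2) diameter_bounded_bound[OF P(1), of x x'] by (auto simp: dist_norm)
      then have "\<exists>y\<in>{1..k} \<rightarrow>\<^sub>E S. norm (\<Sum>j\<in>{1..k}. y j - a) \<le> e * diameter P * real (card {1..k})"
        using N[THEN conjunct2, rule_format, of "{1..k}" S u "diameter P" "\<lambda>_ a. a"] w k P(2)
        unfolding S(5) by simp
      then obtain y where y: "y \<in> {1..k} \<rightarrow>\<^sub>E S" "norm (\<Sum>j\<in>{1..k}. y j - a) \<le> e * diameter P * real k"
        by auto
      have "(\<Sum>i=1..k. (1 / real k) *\<^sub>R y i) \<in> conv_k k P"
        unfolding conv_k_def
        by (rule CollectI, rule exI[of _ k], rule exI[of _ "\<lambda>_. 1 / real k"], rule exI[of _ y])
           (use k1 y(1) S(2) in \<open>auto simp: PiE_iff\<close>)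
      moreover have "dist a (\<Sum>i=1..k. (1 / real k) *\<^sub>R y i) \<le> e * diameter P"
      proof -
        have "(\<Sum>i=1..k. (1 / real k) *\<^sub>R y i) - a = (1 / real k) *\<^sub>R (\<Sum>j\<in>{1..k}. y j - a)"
          using k1 by (simp add: sum_subtractf scaleR_sum_right[symmetric] scaleR_diff_right sum_constant_scaleR)
        then have "dist a (\<Sum>i=1..k. (1 / real k) *\<^sub>R y i) = norm (\<Sum>j\<in>{1..k}. y j - a) / real k"
          by (simp add: dist_norm norm_minus_commute[of a])
        also have "\<dots> \<le> e * diameter P" using y(2) k1 by (simp add: field_simps)
        finally show ?thesis .
      qed
      ultimately show "set_edist {a} (conv_k k P) / ennreal (diameter P) \<le> ennreal e"
        using P e by (intro ennreal_divide_le set_edist_le) auto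
    qed
  qed
qed

text \<open>Pair the points of each class as \<open>h j i\<close> and \<open>h j (n + i)\<close>,
  and let a sign decide which of the two goes to which side. Every choice is balanced, and the two
  barycentres differ by the mean of \<open>n * r\<close> signed differences of norm at most
  \<open>D\<close>; so only the product \<open>n * r\<close> matters.\<close>

lemma Radon_le_if_B_convex:
  assumes "B_convex (X :: 'a::real_normed_vector itself)" "0 < e"
  obtains N where "1 \<le> N" "\<And>n r. N \<le> n * r \<Longrightarrow> Radon X n r \<le> ennreal e"
proof -
  from B_convex_sign_average[OF assms, where ?'i = "nat \<times> nat"] obtain N where
    N: "N \<ge> 1 \<and> (\<forall>(J :: (nat \<times> nat) set) (u :: nat \<times> nat \<Rightarrow> 'a) D. finite J \<longrightarrow> N \<le> card J \<longrightarrow> 0 \<le> D \<longrightarrow>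
      (\<forall>j\<in>J. norm (u j) \<le> D) \<longrightarrow>
      savg J (\<lambda>\<theta>. norm (\<Sum>j\<in>J. \<theta> j *\<^sub>R u j)) \<le> e * D * real (card J))" ..
  show ?thesis
  proof (rule that[OF conjunct1[OF N]])
    fix n r assume nr: "N \<le> n * r"
    then have "1 \<le> n * r" using N by linarith
    then have n: "1 \<le> n" and r: "1 \<le> r" by (cases n; simp) (cases r; use \<open>1 \<le> n * r\<close> in simp)
    show "Radon X n r \<le> ennreal e"
      unfolding Radon_def
    proof (rule SUP_least)
      fix Z :: "nat \<Rightarrow> 'a set" assume Z: "Z \<in> colour_classes r (2 * n)"
      define D where "D = max_diameter r Z"
      have D: "D > 0" unfolding D_def by (rule max_diameter_pos[OF Z]) (use n r in auto)
      have Zj: "finite (Z j)" "card (Z j) = 2 * n" if "j \<in> {1..r}" for j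
        using Z that by (auto simp: colour_classes_def)
      have "\<exists>h. bij_betw h {0..<2 * n} (Z j)" if "j \<in> {1..r}" for j
        using ex_bij_betw_nat_finite[OF Zj(1)[OF that]] Zj(2)[OF that] by simp
      then obtain h where h: "\<And>j. j \<in> {1..r} \<Longrightarrow> bij_betw (h j) {0..<2 * n} (Z j)" by metis
      define J where "J = {1..r} \<times> {0..<n}"
      have J: "finite J" "card J = n * r" "J \<noteq> {}" using n r by (auto simp: J_def)
      define u where "u = (\<lambda>(j, i). h j i - h j (n + i))"
      have hZ: "h j i \<in> Z j" if "j \<in> {1..r}" "i < 2 * n" for i j
        using bij_betwE[OF h[OF that(1)]] that(2) by auto
      have "\<forall>p\<in>J. norm (u p) \<le> D"
      proof
        fix p assume "p \<in> J"
        then obtain j i where p: "p = (j, i)" "j \<in> {1..r}" "i < n" by (auto simp: J_def)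
        then show "norm (u p) \<le> D"
          using colour_classes_dist_le[OF Z p(2) hZ hZ, of i "n + i"] by (simp add: u_def dist_norm D_def)
      qed
      then have "savg J (\<lambda>\<theta>. norm (\<Sum>p\<in>J. \<theta> p *\<^sub>R u p)) \<le> e * D * real (card J)"
        using N[THEN conjunct2, rule_format, of J D u] nr J D by simp
      then obtain \<theta> where \<theta>: "\<theta> \<in> signs J" "norm (\<Sum>p\<in>J. \<theta> p *\<^sub>R u p) \<le> e * D * real (card J)"
        by (rule signs.exists_le_pavg[OF J(1)])
      \<comment> \<open>\<open>g s\<close> takes the first point of a pair whose sign is
        \<open>s\<close> and the second one otherwise, so \<open>Q 1\<close> and
        \<open>Q (-1)\<close> make complementary choices.\<close>
      define g where "g s = (\<lambda>(j, i). h j (if \<theta> (j, i) = s then i else n + i))" for s :: real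
      define Q where "Q s = g s ` J" for s
      have gZ: "g s (j, i) \<in> Z j" if "j \<in> {1..r}" "i < n" for s j i
        unfolding g_def using that by (auto intro!: hZ)
      have disjZ: "Z j \<inter> Z j' = {}" if "j \<in> {1..r}" "j' \<in> {1..r}" "j \<noteq> j'" for j j'
        using Z that by (auto simp: colour_classes_def disjoint_family_on_def)
      have geq: "j = j' \<and> i = i' \<and> (\<theta> (j, i) = s \<longleftrightarrow> \<theta> (j', i') = s')"
        if eq: "g s (j, i) = g s' (j', i')" and ij: "j \<in> {1..r}" "i < n" "j' \<in> {1..r}" "i' < n" for s s' j i j' i'
      proof -
        have j: "j = j'"
          using gZ[OF ij(1,2), of s] gZ[OF ij(3,4), of s'] eq disjZ[OF ij(1,3)] by auto
        have inj: "inj_on (h j) {0..<2 * n}" using h[OF ij(1)] by (simp add: bij_betw_def)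
        have "(if \<theta> (j, i) = s then i else n + i) = (if \<theta> (j, i') = s' then i' else n + i')"
          by (rule inj_onD[OF inj]) (use eq ij j in \<open>auto simp: g_def\<close>)
        then show ?thesis using ij j by (auto split: if_splits)
      qed
      have inj: "inj_on (g s) J" for s
        by (rule inj_onI) (use geq[of s _ _ s] in \<open>auto simp: J_def\<close>)
      have disj: "Q 1 \<inter> Q (-1) = {}"
      proof (rule ccontr)
        assume "Q 1 \<inter> Q (-1) \<noteq> {}"
        then obtain j i j' i' where *: "(j, i) \<in> J" "(j', i') \<in> J" "g 1 (j, i) = g (-1) (j', i')"
          unfolding Q_def by (auto simp: image_iff)
        then have "\<theta> (j, i) = 1 \<longleftrightarrow> \<theta> (j, i) = - 1"
          using geq[of 1 j i "-1" j' i'] by (auto simp: J_def)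
        then show False using \<theta>(1) *(1) by (auto simp: PiE_iff)
      qed
      have QZ: "Q s \<inter> Z j = g s ` ({j} \<times> {0..<n})" if j: "j \<in> {1..r}" for s j
      proof
        show "g s ` ({j} \<times> {0..<n}) \<subseteq> Q s \<inter> Z j" using j gZ by (auto simp: Q_def J_def)
        show "Q s \<inter> Z j \<subseteq> g s ` ({j} \<times> {0..<n})"
        proof
          fix z assume z: "z \<in> Q s \<inter> Z j"
          then obtain j' i where ji: "z = g s (j', i)" "j' \<in> {1..r}" "i < n" by (auto simp: Q_def J_def)
          then have "j' = j" using gZ[OF ji(2,3), of s] disjZ[OF ji(2) j] z by auto
          then show "z \<in> g s ` ({j} \<times> {0..<n})" using ji by auto
        qed
      qed
      have cQ: "card (Q s \<inter> Z j) = n" if "j \<in> {1..r}" for s j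
      proof -
        have "inj_on (g s) ({j} \<times> {0..<n})" by (rule inj_on_subset[OF inj]) (use that in \<open>auto simp: J_def\<close>)
        then show ?thesis unfolding QZ[OF that] by (simp add: card_image)
      qed
      have "(Q 1 \<union> Q (-1)) = (\<Union>j\<in>{1..r}. Z j)"
      proof
        show "Q 1 \<union> Q (-1) \<subseteq> (\<Union>j\<in>{1..r}. Z j)" using gZ by (fastforce simp: Q_def J_def)
        show "(\<Union>j\<in>{1..r}. Z j) \<subseteq> Q 1 \<union> Q (-1)"
        proof
          fix z assume "z \<in> (\<Union>j\<in>{1..r}. Z j)"
          then obtain j where j: "j \<in> {1..r}" "z \<in> Z j" by blast
          \<comment> \<open>Two disjoint pieces of size \<open>n\<close> exhaust \<open>Z j\<close>,
            by counting.\<close>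
          have "card ((Q 1 \<inter> Z j) \<union> (Q (-1) \<inter> Z j)) = 2 * n"
            by (subst card_Un_disjoint) (use disj cQ[OF j(1)] Zj(1)[OF j(1)] in auto)
          then have "(Q 1 \<inter> Z j) \<union> (Q (-1) \<inter> Z j) = Z j"
            by (intro card_subset_eq) (use Zj[OF j(1)] in auto)
          then show "z \<in> Q 1 \<union> Q (-1)" using j by blast
        qed
      qed
      then have split: "(Q 1, Q (-1)) \<in> balanced_splits n r Z"
        unfolding balanced_splits_def using disj cQ by simp
      define a where "a s = (1 / real (card J)) *\<^sub>R (\<Sum>p\<in>J. g s p)" for s
      have a: "a s \<in> convex hull (Q s)" for s
        unfolding a_def by (rule mean_in_convex_hull[OF J(1,3)]) (simp add: Q_def)
      have "(\<Sum>p\<in>J. g 1 p) - (\<Sum>p\<in>J. g (-1) p) = (\<Sum>p\<in>J. \<theta> p *\<^sub>R u p)"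
        unfolding sum_subtractf[symmetric]
      proof (rule sum.cong)
        fix p assume "p \<in> J"
        moreover obtain j i where "p = (j, i)" by (cases p)
        moreover have "\<theta> p = 1 \<or> \<theta> p = -1" using \<theta>(1) \<open>p \<in> J\<close> by (auto simp: PiE_iff)
        ultimately show "g 1 p - g (-1) p = \<theta> p *\<^sub>R u p" by (auto simp: g_def u_def)
      qed simp
      then have "a 1 - a (-1) = (1 / real (card J)) *\<^sub>R (\<Sum>p\<in>J. \<theta> p *\<^sub>R u p)"
        unfolding a_def by (simp flip: scaleR_diff_right)
      then have "dist (a 1) (a (-1)) = norm (\<Sum>p\<in>J. \<theta> p *\<^sub>R u p) / real (card J)"
        by (simp add: dist_norm)
      also have "\<dots> \<le> e * D"
      proof -
        have "card J > 0" using J(1,3) by (simp only: card_gt_0_iff) simp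
        then have "real (card J) > 0" by (simp only: of_nat_0_less_iff)
        then show ?thesis using \<theta>(2) by (simp add: pos_divide_le_eq)
      qed
      finally have "set_edist (convex hull (Q 1)) (convex hull (Q (-1))) / ennreal D \<le> ennreal e"
        using D assms(2) by (intro ennreal_divide_le set_edist_le[OF a a]) auto
      then show "(INF (Q0, Q1)\<in>balanced_splits n r Z.
          set_edist (convex hull Q0) (convex hull Q1) / ennreal (max_diameter r Z)) \<le> ennreal e"
        by (intro INF_lower2[OF split]) (simp add: D_def)
    qed
  qed
qed

lemma Radon_tendsto_zero_if_B_convex:
  assumes "B_convex (X :: 'a::real_normed_vector itself)"
  shows "((\<lambda>(n, r). Radon X n r) \<longlongrightarrow> 0) (filtercomap (\<lambda>(n, r). n * r) at_top)"
proof (rule ennreal_tendsto_zeroI)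
  fix e :: real assume "0 < e"
  then obtain N where "\<And>n r. N \<le> n * r \<Longrightarrow> Radon X n r \<le> ennreal e"
    using Radon_le_if_B_convex[OF assms] by metis
  then show "\<forall>\<^sub>F x in filtercomap (\<lambda>(n, r). n * r) at_top. (case x of (n, r) \<Rightarrow> Radon X n r) \<le> ennreal e"
    unfolding eventually_filtercomap
    by (intro exI[of _ "\<lambda>m. N \<le> m"]) (auto simp: eventually_ge_at_top)
qed

text \<open>One transversal is split off at a time. Selection under the uniform law on each class
  gives a transversal \<open>s\<close> whose sum is within \<open>E\<close> of the sum of the class
  means. Removing it moves each mean by \<open>(s j - m Z j) / k\<close>, which sums to norm at most
  \<open>E / k\<close>, so every round adds at most \<open>E\<close> to the error.\<close>

lemma colourful_selection:
  fixes Z :: "nat \<Rightarrow> 'b::real_normed_vector set"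
  assumes sel: "\<And>A (w :: nat \<Rightarrow> real) (v :: nat \<Rightarrow> nat \<Rightarrow> 'b). weights A w \<Longrightarrow>
      (\<And>j a a'. j \<in> J \<Longrightarrow> a \<in> A \<Longrightarrow> a' \<in> A \<Longrightarrow> norm (v j a - v j a') \<le> D) \<Longrightarrow>
      \<exists>y\<in>J \<rightarrow>\<^sub>E A. norm (\<Sum>j\<in>J. v j (y j) - (\<Sum>a\<in>A. w a *\<^sub>R v j a)) \<le> E"
    and "0 \<le> E"
    and Z: "\<And>j. j \<in> J \<Longrightarrow> finite (Z j)" "\<And>j. j \<in> J \<Longrightarrow> card (Z j) = k"
      "\<And>j x y. j \<in> J \<Longrightarrow> x \<in> Z j \<Longrightarrow> y \<in> Z j \<Longrightarrow> norm (x - y) \<le> D"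
  shows "\<exists>h. (\<forall>j\<in>J. bij_betw (h j) {1..k} (Z j)) \<and>
    (\<forall>i\<in>{1..k}. norm (\<Sum>j\<in>J. h j i - (1 / real k) *\<^sub>R (\<Sum>z\<in>Z j. z)) \<le> real k * E)"
  using Z
proof (induction k arbitrary: Z)
  case 0
  then show ?case by (intro exI[of _ "\<lambda>_ _. 0"]) (auto simp: bij_betw_def)
next
  case (Suc k)
  define m where "m Z = (\<lambda>j. (1 / real (card (Z j))) *\<^sub>R (\<Sum>z\<in>Z j. z))" for Z :: "nat \<Rightarrow> 'b set"
  have "\<exists>g. bij_betw g {1..Suc k} (Z j)" if "j \<in> J" for j
    using ex_bij_betw_nat_finite_1[OF Suc.prems(1)[OF that]] Suc.prems(2)[OF that] by simp
  then obtain g where g: "\<And>j. j \<in> J \<Longrightarrow> bij_betw (g j) {1..Suc k} (Z j)" by metis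
  have gZ: "g j i \<in> Z j" if "j \<in> J" "i \<in> {1..Suc k}" for j i
    using bij_betwE[OF g[OF that(1)]] that(2) by auto
  have "\<exists>y\<in>J \<rightarrow>\<^sub>E {1..Suc k}.
      norm (\<Sum>j\<in>J. g j (y j) - (\<Sum>a\<in>{1..Suc k}. (1 / real (card {1..Suc k})) *\<^sub>R g j a)) \<le> E"
    by (rule sel[OF weights_uniform]) (use Suc.prems(3) gZ in auto)
  then obtain y where y: "y \<in> J \<rightarrow>\<^sub>E {1..Suc k}"
    "norm (\<Sum>j\<in>J. g j (y j) - (\<Sum>a\<in>{1..Suc k}. (1 / real (card {1..Suc k})) *\<^sub>R g j a)) \<le> E" by blast
  define s where "s j = g j (y j)" for j
  have s: "s j \<in> Z j" if "j \<in> J" for j using y(1) that by (auto simp: s_def intro!: gZ)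
  have mean: "(\<Sum>a\<in>{1..Suc k}. (1 / real (card {1..Suc k})) *\<^sub>R g j a) = m Z j" if "j \<in> J" for j
    using sum.reindex_bij_betw[OF g[OF that], of "\<lambda>z. z"] Suc.prems(2)[OF that]
    by (simp add: m_def scaleR_sum_right[symmetric])
  have sE: "norm (\<Sum>j\<in>J. s j - m Z j) \<le> E"
  proof -
    have "(\<Sum>j\<in>J. g j (y j) - (\<Sum>a\<in>{1..Suc k}. (1 / real (card {1..Suc k})) *\<^sub>R g j a))
        = (\<Sum>j\<in>J. s j - m Z j)"
      by (rule sum.cong) (simp_all only: s_def mean)
    then show ?thesis using y(2) by (simp only:)
  qed
  define Z' where "Z' j = Z j - {s j}" for j
  have "\<exists>h. (\<forall>j\<in>J. bij_betw (h j) {1..k} (Z' j)) \<and>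
      (\<forall>i\<in>{1..k}. norm (\<Sum>j\<in>J. h j i - (1 / real k) *\<^sub>R (\<Sum>z\<in>Z' j. z)) \<le> real k * E)"
    by (rule Suc.IH) (use Suc.prems s in \<open>auto simp: Z'_def\<close>)
  then obtain h where h: "\<And>j. j \<in> J \<Longrightarrow> bij_betw (h j) {1..k} (Z' j)"
    and hE: "\<And>i. i \<in> {1..k} \<Longrightarrow> norm (\<Sum>j\<in>J. h j i - (1 / real k) *\<^sub>R (\<Sum>z\<in>Z' j. z)) \<le> real k * E"
    by blast
  define H where "H j i = (if i = Suc k then s j else h j i)" for j i
  have eq: "(1 / real (Suc k)) *\<^sub>R (\<Sum>z\<in>Z j. z) = m Z j" if "j \<in> J" for j
    using Suc.prems(2)[OF that] by (simp add: m_def)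
  show ?case
  proof (intro exI[of _ H] conjI ballI)
    fix j assume j: "j \<in> J"
    have "bij_betw (H j) (insert (Suc k) {1..k}) (insert (s j) (Z' j))"
    proof -
      have "bij_betw (H j) {1..k} (Z' j)"
        using h[OF j] by (rule bij_betw_cong[THEN iffD1, rotated]) (auto simp: H_def)
      moreover have "H j (Suc k) = s j" by (simp add: H_def)
      ultimately show ?thesis
        by (auto simp: bij_betw_def Z'_def)
    qed
    moreover have "insert (Suc k) {1..k} = {1..Suc k}" by auto
    moreover have "insert (s j) (Z' j) = Z j" using s[OF j] by (auto simp: Z'_def)
    ultimately show "bij_betw (H j) {1..Suc k} (Z j)" by simp
  next
    fix i assume i: "i \<in> {1..Suc k}"
    have "norm (\<Sum>j\<in>J. H j i - m Z j) \<le> real (Suc k) * E"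
    proof (cases "i = Suc k")
      case True
      have "norm (\<Sum>j\<in>J. H j i - m Z j) \<le> 1 * E" using sE True by (simp add: H_def)
      also have "\<dots> \<le> real (Suc k) * E" using assms by (intro mult_right_mono) auto
      finally show ?thesis .
    next
      case False
      then have ik: "i \<in> {1..k}" using i by auto
      then have k: "1 \<le> k" by auto
      have m': "(1 / real k) *\<^sub>R (\<Sum>z\<in>Z' j. z) = m Z j - (1 / real k) *\<^sub>R (s j - m Z j)" if j: "j \<in> J" for j
      proof -
        have "(\<Sum>z\<in>Z j. z) = s j + (\<Sum>z\<in>Z' j. z)"
          unfolding Z'_def by (rule sum.remove) (use Suc.prems s j in auto)
        moreover have "(\<Sum>z\<in>Z j. z) = real (Suc k) *\<^sub>R m Z j"
          using Suc.prems(2)[OF j] by (simp add: m_def)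
        ultimately have *: "(\<Sum>z\<in>Z' j. z) = real (Suc k) *\<^sub>R m Z j - s j" by (simp add: algebra_simps)
        have "(1 / real k) * real (Suc k) = 1 + 1 / real k" using k by (simp add: field_simps)
        then show ?thesis unfolding * scaleR_diff_right scaleR_scaleR by (simp add: scaleR_add_left)
      qed
      have "(\<Sum>j\<in>J. H j i - m Z j) = (\<Sum>j\<in>J. (h j i - (1 / real k) *\<^sub>R (\<Sum>z\<in>Z' j. z)) - (1 / real k) *\<^sub>R (s j - m Z j))"
        by (rule sum.cong) (use False m' in \<open>auto simp: H_def\<close>)
      also have "\<dots> = (\<Sum>j\<in>J. h j i - (1 / real k) *\<^sub>R (\<Sum>z\<in>Z' j. z)) - (1 / real k) *\<^sub>R (\<Sum>j\<in>J. s j - m Z j)"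
        by (subst sum_subtractf) (simp only: scaleR_sum_right[symmetric])
      finally have split: "(\<Sum>j\<in>J. H j i - m Z j)
          = (\<Sum>j\<in>J. h j i - (1 / real k) *\<^sub>R (\<Sum>z\<in>Z' j. z)) - (1 / real k) *\<^sub>R (\<Sum>j\<in>J. s j - m Z j)" .
      have "norm (\<Sum>j\<in>J. H j i - m Z j)
          \<le> norm (\<Sum>j\<in>J. h j i - (1 / real k) *\<^sub>R (\<Sum>z\<in>Z' j. z)) + norm ((1 / real k) *\<^sub>R (\<Sum>j\<in>J. s j - m Z j))"
        unfolding split by (rule norm_triangle_ineq4)
      \<comment> \<open>The drift \<open>E / k\<close> of the class means is crudely estimated by
        \<open>E\<close>.\<close>
      also have "\<dots> \<le> real k * E + 1 * E"
      proof (rule add_mono[OF hE[OF ik]])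
        have "norm ((1 / real k) *\<^sub>R (\<Sum>j\<in>J. s j - m Z j)) = (1 / real k) * norm (\<Sum>j\<in>J. s j - m Z j)" by simp
        also have "\<dots> \<le> 1 * E" using k sE by (intro mult_mono) auto
        finally show "norm ((1 / real k) *\<^sub>R (\<Sum>j\<in>J. s j - m Z j)) \<le> 1 * E" .
      qed
      finally show ?thesis by (simp add: algebra_simps)
    qed
    then show "norm (\<Sum>j\<in>J. H j i - (1 / real (Suc k)) *\<^sub>R (\<Sum>z\<in>Z j. z)) \<le> real (Suc k) * E"
      by (simp only: eq cong: sum.cong)
  qed
qed

lemma Tv_tendsto_zero_if_B_convex:
  assumes "B_convex (X :: 'a::real_normed_vector itself)" "2 \<le> k"
  shows "(\<lambda>r. Tv X r k) \<longlonglongrightarrow> 0"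
proof (rule ennreal_tendsto_zeroI)
  fix e0 :: real assume e0: "0 < e0"
  \<comment> \<open>\<open>colourful_selection\<close> loses a factor \<open>k\<close>, paid here in
    advance.\<close>
  define e where "e = e0 / real k"
  have e: "0 < e" using e0 assms(2) by (simp add: e_def)
  from B_convex_selection[OF assms(1) e, where ?'i = nat and ?'a = nat] obtain N where
    N: "N \<ge> 1 \<and> (\<forall>(J :: nat set) A (w :: nat \<Rightarrow> real) (v :: nat \<Rightarrow> nat \<Rightarrow> 'a) D.
    finite J \<longrightarrow> N \<le> card J \<longrightarrow> weights A w \<longrightarrow> 0 \<le> D \<longrightarrow>
    (\<forall>j\<in>J. \<forall>a\<in>A. \<forall>a'\<in>A. norm (v j a - v j a') \<le> D) \<longrightarrow>
    (\<exists>y\<in>J \<rightarrow>\<^sub>E A. norm (\<Sum>j\<in>J. v j (y j) - (\<Sum>a\<in>A. w a *\<^sub>R v j a)) \<le> e * D * real (card J)))" ..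
  show "\<forall>\<^sub>F r in sequentially. Tv X r k \<le> ennreal e0"
    unfolding eventually_sequentially
  proof (intro exI[of _ N] allI impI)
    fix r assume rN: "N \<le> r"
    then have r: "1 \<le> r" using N by linarith
    show "Tv X r k \<le> ennreal e0"
      unfolding Tv_def
    proof (rule SUP_least)
      fix Z :: "nat \<Rightarrow> 'a set" assume Z: "Z \<in> colour_classes r k"
      define D where "D = max_diameter r Z"
      have D: "D > 0" unfolding D_def by (rule max_diameter_pos[OF Z assms(2) r])
      have Zj: "finite (Z j)" "card (Z j) = k" if "j \<in> {1..r}" for j
        using Z that by (auto simp: colour_classes_def)
      have disjZ: "Z j \<inter> Z j' = {}" if "j \<in> {1..r}" "j' \<in> {1..r}" "j \<noteq> j'" for j j'
        using Z that by (auto simp: colour_classes_def disjoint_family_on_def)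
      define E where "E = e * D * real r"
      have E0: "0 \<le> E" using e D by (simp add: E_def)
      define z where "z j = (1 / real k) *\<^sub>R (\<Sum>z\<in>Z j. z)" for j
      have "\<exists>h. (\<forall>j\<in>{1..r}. bij_betw (h j) {1..k} (Z j)) \<and>
          (\<forall>i\<in>{1..k}. norm (\<Sum>j\<in>{1..r}. h j i - (1 / real k) *\<^sub>R (\<Sum>z\<in>Z j. z)) \<le> real k * E)"
      proof (rule colourful_selection[where D = D])
        fix A and w :: "nat \<Rightarrow> real" and v :: "nat \<Rightarrow> nat \<Rightarrow> 'a"
        assume "weights A w" "\<And>j a a'. j \<in> {1..r} \<Longrightarrow> a \<in> A \<Longrightarrow> a' \<in> A \<Longrightarrow> norm (v j a - v j a') \<le> D"
        then show "\<exists>y\<in>{1..r} \<rightarrow>\<^sub>E A. norm (\<Sum>j\<in>{1..r}. v j (y j) - (\<Sum>a\<in>A. w a *\<^sub>R v j a)) \<le> E"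
          using N[THEN conjunct2, rule_format, of "{1..r}" A w D v] rN D by (simp add: E_def)
      qed (use Zj E0 colour_classes_dist_le[OF Z] in \<open>auto simp: D_def dist_norm\<close>)
      then obtain h where h: "\<And>j. j \<in> {1..r} \<Longrightarrow> bij_betw (h j) {1..k} (Z j)"
        and hE: "\<And>i. i \<in> {1..k} \<Longrightarrow> norm (\<Sum>j\<in>{1..r}. h j i - z j) \<le> real k * E"
        unfolding z_def by blast
      have hZ: "h j i \<in> Z j" if "j \<in> {1..r}" "i \<in> {1..k}" for i j
        using bij_betwE[OF h[OF that(1)]] that(2) by auto
      have heq: "j = j' \<and> i = i'"
        if "h j i = h j' i'" "j \<in> {1..r}" "j' \<in> {1..r}" "i \<in> {1..k}" "i' \<in> {1..k}" for i j i' j'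
      proof -
        have j: "j = j'" using hZ[of j i] hZ[of j' i'] disjZ[of j j'] that by auto
        have "inj_on (h j) {1..k}" using h[OF that(2)] by (simp add: bij_betw_def)
        then have "i = i'" by (rule inj_onD) (use that j in simp_all)
        with j show ?thesis by simp
      qed
      define S where "S i = (\<lambda>j. h j i) ` {1..r}" for i
      have S: "S \<in> colourful_partitions r k Z"
        unfolding colourful_partitions_def
      proof (intro CollectI conjI ballI)
        have "(\<Union>i\<in>{1..k}. S i) = (\<Union>j\<in>{1..r}. h j ` {1..k})" by (auto simp: S_def)
        also have "\<dots> = (\<Union>j\<in>{1..r}. Z j)" using h by (intro SUP_cong) (auto simp: bij_betw_def)
        finally show "(\<Union>i\<in>{1..k}. S i) = (\<Union>j\<in>{1..r}. Z j)" .
        show "disjoint_family_on S {1..k}"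
          unfolding disjoint_family_on_def
        proof (intro ballI impI, rule ccontr)
          fix i i' assume i: "i \<in> {1..k}" "i' \<in> {1..k}" "i \<noteq> i'" and "S i \<inter> S i' \<noteq> {}"
          then obtain j j' where "j \<in> {1..r}" "j' \<in> {1..r}" "h j i = h j' i'"
            unfolding S_def by blast
          then show False using heq[of j i j' i'] i by blast
        qed
        fix i j assume ij: "i \<in> {1..k}" "j \<in> {1..r}"
        have "S i \<inter> Z j = {h j i}"
        proof
          show "{h j i} \<subseteq> S i \<inter> Z j" using ij hZ by (auto simp: S_def)
          show "S i \<inter> Z j \<subseteq> {h j i}"
          proof
            fix x assume x: "x \<in> S i \<inter> Z j"
            then obtain j' where j': "x = h j' i" "j' \<in> {1..r}" by (auto simp: S_def)
            then have "j' = j" using hZ[OF j'(2) ij(1)] disjZ[OF j'(2) ij(2)] x by auto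
            then show "x \<in> {h j i}" using j' by simp
          qed
        qed
        then show "card (S i \<inter> Z j) = 1" by simp
      qed
      define x where "x = (1 / real r) *\<^sub>R (\<Sum>j\<in>{1..r}. z j)"
      have le: "set_edist {x} (convex hull (S i)) \<le> ennreal (e0 * D)" if i: "i \<in> {1..k}" for i
      proof (rule set_edist_le)
        show "(1 / real (card {1..r})) *\<^sub>R (\<Sum>j\<in>{1..r}. h j i) \<in> convex hull (S i)"
          using r by (intro mean_in_convex_hull) (auto simp: S_def)
        have "(1 / real (card {1..r})) *\<^sub>R (\<Sum>j\<in>{1..r}. h j i) - x = (1 / real r) *\<^sub>R (\<Sum>j\<in>{1..r}. h j i - z j)"
          by (simp add: x_def sum_subtractf scaleR_diff_right)
        then have "dist x ((1 / real (card {1..r})) *\<^sub>R (\<Sum>j\<in>{1..r}. h j i))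
            = norm (\<Sum>j\<in>{1..r}. h j i - z j) / real r"
          by (simp add: dist_norm norm_minus_commute[of x])
        also have "\<dots> \<le> (real k * E) / real r" using hE[OF i] by (rule divide_right_mono) simp
        also have "\<dots> = e0 * D" using r assms(2) by (simp add: E_def e_def)
        finally show "dist x ((1 / real (card {1..r})) *\<^sub>R (\<Sum>j\<in>{1..r}. h j i)) \<le> e0 * D" .
      qed simp
      have "(MAX i\<in>{1..k}. set_edist {x} (convex hull (S i))) \<le> ennreal (e0 * D)"
        using le assms(2) by (subst Max_le_iff) auto
      then have "(MAX i\<in>{1..k}. set_edist {x} (convex hull (S i))) / ennreal D \<le> ennreal e0"
        using D e0 by (intro ennreal_divide_le) auto
      then show "(INF x. INF S\<in>colourful_partitions r k Z.
          (MAX i\<in>{1..k}. set_edist {x} (convex hull (S i))) / ennreal (max_diameter r Z)) \<le> ennreal e0"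
        by (intro INF_lower2[of x] INF_lower2[OF S]) (auto simp: D_def)
    qed
  qed
qed

section \<open>Selection and weak nets by counting\<close>

text \<open>Counting functions instead of subsets makes the bound independent of the size of \<open>Y\<close>.\<close>

lemma card_close_means:
  assumes "B_convex (X :: 'a::real_normed_vector itself)" "0 < e"
  shows "\<exists>N\<ge>1. \<forall>r\<ge>N. \<forall>(Y :: 'a set) D. finite Y \<longrightarrow> Y \<noteq> {} \<longrightarrow> 0 < D \<longrightarrow>
    (\<forall>x\<in>Y. \<forall>y\<in>Y. dist x y \<le> D) \<longrightarrow>
    (\<exists>c. card Y ^ r \<le> 2 * card {y \<in> {1..r} \<rightarrow>\<^sub>E Y. dist c ((1 / real r) *\<^sub>R (\<Sum>j=1..r. y j)) \<le> e * D})"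
proof -
  \<comment> \<open>The average is made half as large as the target, to leave room for Markov's
    inequality.\<close>
  have e: "0 < e / 2" using assms by simp
  from B_convex_weighted_average[OF assms(1) e, where ?'i = nat and ?'a = 'a] obtain N where
    N: "N \<ge> 1 \<and> (\<forall>(J :: nat set) A (w :: 'a \<Rightarrow> real) (v :: nat \<Rightarrow> 'a \<Rightarrow> 'a) D.
    finite J \<longrightarrow> N \<le> card J \<longrightarrow> weights A w \<longrightarrow> 0 \<le> D \<longrightarrow>
    (\<forall>j\<in>J. \<forall>a\<in>A. \<forall>a'\<in>A. norm (v j a - v j a') \<le> D) \<longrightarrow>
    pavg J A w (\<lambda>y. norm (\<Sum>j\<in>J. v j (y j) - (\<Sum>a\<in>A. w a *\<^sub>R v j a))) \<le> (e / 2) * D * real (card J))" ..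
  show ?thesis
  proof (intro exI[of _ N] conjI allI impI)
    show "1 \<le> N" using N by (rule conjunct1)
    fix r and Y :: "'a set" and D :: real
    assume r: "N \<le> r" and Y: "finite Y" "Y \<noteq> {}" and D: "0 < D" "\<forall>x\<in>Y. \<forall>y\<in>Y. dist x y \<le> D"
    have r1: "1 \<le> r" using r N by linarith
    define c where "c = (\<Sum>a\<in>Y. (1 / real (card Y)) *\<^sub>R a)"
    define F where "F y = norm (\<Sum>j\<in>{1..r}. y j - c)" for y :: "nat \<Rightarrow> 'a"
    define V where "V = {1..r} \<rightarrow>\<^sub>E Y"
    have V: "finite V" "card V = card Y ^ r" using Y by (auto simp: V_def finite_PiE card_PiE)
    define G where "G = {y \<in> V. F y \<le> e * D * real r}"
    have yD: "norm (y - y') \<le> D" if "y \<in> Y" "y' \<in> Y" for y y' using that D by (auto simp: dist_norm)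
    have w: "weights Y (\<lambda>_. 1 / real (card Y))" by (rule weights_uniform[OF Y])
    have "pavg {1..r} Y (\<lambda>_. 1 / real (card Y)) F \<le> (e / 2) * D * real (card {1..r})"
      unfolding F_def[abs_def] c_def
      by (rule N[THEN conjunct2, rule_format, OF _ _ w]) (use r D yD in auto)
    then have "(\<Sum>y\<in>V. F y) / real (card V) \<le> (e / 2) * D * real r"
      unfolding pavg_def V(2) unfolding V_def by (simp add: sum_divide_distrib power_divide)
    moreover have "card V > 0" using V Y by (simp add: card_gt_0_iff)
    ultimately have le: "(\<Sum>y\<in>V. F y) \<le> (e / 2) * D * real r * real (card V)"
      by (simp add: pos_divide_le_eq)
    have pos: "e * D * real r > 0" using assms D r1 by simp
    \<comment> \<open>Markov's inequality: outside \<open>G\<close> the value exceeds twice the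
      bound on the average, so at most half of all functions lie there.\<close>
    have "real (card (V - G)) * (e * D * real r) \<le> (\<Sum>y\<in>V - G. F y)"
      using sum_bounded_below[of "V - G" "e * D * real r" F] by (force simp: G_def)
    also have "\<dots> \<le> (\<Sum>y\<in>V. F y)" using V by (intro sum_mono2) (auto simp: F_def)
    also note le
    finally have "(e * D * real r) * (2 * real (card (V - G))) \<le> (e * D * real r) * real (card V)"
      by (simp add: algebra_simps)
    then have "2 * real (card (V - G)) \<le> real (card V)" using pos by (simp only: mult_le_cancel_left_pos)
    moreover have "card V = card G + card (V - G)"
    proof -
      have GV: "G \<subseteq> V" by (auto simp: G_def)
      then show ?thesis using card_Diff_subset[OF finite_subset[OF GV V(1)] GV] card_mono[OF V(1) GV] by linarith
    qed
    ultimately have "card V \<le> 2 * card G" by linarith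
    moreover have "G = {y \<in> V. dist c ((1 / real r) *\<^sub>R (\<Sum>j=1..r. y j)) \<le> e * D}"
    proof -
      have "dist c ((1 / real r) *\<^sub>R (\<Sum>j=1..r. y j)) = F y / real r" for y
      proof -
        have "(1 / real r) *\<^sub>R (\<Sum>j=1..r. y j) - c = (1 / real r) *\<^sub>R (\<Sum>j\<in>{1..r}. y j - c)"
          using r1 by (simp add: sum_subtractf scaleR_diff_right sum_constant_scaleR)
        then show ?thesis by (simp add: dist_norm norm_minus_commute[of c] F_def)
      qed
      then show ?thesis using r1 by (simp add: G_def pos_divide_le_eq)
    qed
    ultimately show "\<exists>c. card Y ^ r \<le> 2 * card {y \<in> {1..r} \<rightarrow>\<^sub>E Y. dist c ((1 / real r) *\<^sub>R (\<Sum>j=1..r. y j)) \<le> e * D}"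
      using V(2) by (auto simp: V_def)
  qed
qed

text \<open>At least half of the \<open>card P ^ r\<close> functions have their mean near
  \<open>c\<close>. Such a function takes its values in some \<open>r\<close>-subset, whose hull
  then comes near \<open>c\<close>, and an \<open>r\<close>-set receives only \<open>r ^ r\<close>
  functions. With \<open>card P choose r \<le> card P ^ r\<close> this gives the fraction
  \<open>1 / (2 * r ^ r)\<close>.\<close>

lemma Sel_tendsto_zero_if_B_convex:
  assumes "B_convex (X :: 'a::real_normed_vector itself)"
  shows "(\<lambda>r. Sel X r (1 / (2 * real r ^ r))) \<longlonglongrightarrow> 0"
proof (rule ennreal_tendsto_zeroI)
  fix e :: real assume e: "0 < e"
  from card_close_means[OF assms e] obtain N where
    N: "N \<ge> 1 \<and> (\<forall>r\<ge>N. \<forall>(Y :: 'a set) D. finite Y \<longrightarrow> Y \<noteq> {} \<longrightarrow> 0 < D \<longrightarrow>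
    (\<forall>x\<in>Y. \<forall>y\<in>Y. dist x y \<le> D) \<longrightarrow>
    (\<exists>c. card Y ^ r \<le> 2 * card {y \<in> {1..r} \<rightarrow>\<^sub>E Y. dist c ((1 / real r) *\<^sub>R (\<Sum>j=1..r. y j)) \<le> e * D}))" ..
  show "\<forall>\<^sub>F r in sequentially. Sel X r (1 / (2 * real r ^ r)) \<le> ennreal e"
    unfolding eventually_sequentially
  proof (intro exI[of _ N] allI impI)
    fix r assume rN: "N \<le> r"
    then have r: "1 \<le> r" using N by linarith
    show "Sel X r (1 / (2 * real r ^ r)) \<le> ennreal e"
      unfolding Sel_def
    proof (rule SUP_least)
      fix P :: "'a set" assume "P \<in> {P. finite P \<and> r \<le> card P \<and> 0 < diameter P}"
      then have P: "finite P" "r \<le> card P" "0 < diameter P" by auto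
      then have "P \<noteq> {}" using r by auto
      define D where "D = diameter P"
      obtain c where c: "card P ^ r \<le> 2 * card {y \<in> {1..r} \<rightarrow>\<^sub>E P. dist c ((1 / real r) *\<^sub>R (\<Sum>j=1..r. y j)) \<le> e * D}"
        using N[THEN conjunct2, rule_format, OF rN P(1) \<open>P \<noteq> {}\<close> P(3)] dist_le_diameter[OF P(1)]
        by (auto simp: D_def)
      define G where "G = {y \<in> {1..r} \<rightarrow>\<^sub>E P. dist c ((1 / real r) *\<^sub>R (\<Sum>j=1..r. y j)) \<le> e * D}"
      define \<A> where "\<A> = {A. A \<subseteq> P \<and> card A = r \<and> convex hull A \<inter> cball c (e * D) \<noteq> {}}"
      have fA: "finite \<A>" unfolding \<A>_def using P(1) by simp
      have "G \<subseteq> (\<Union>A\<in>\<A>. {1..r} \<rightarrow>\<^sub>E A)"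
      proof
        fix y assume y: "y \<in> G"
        have "y ` {1..r} \<subseteq> P" using y by (auto simp: G_def)
        moreover have "card (y ` {1..r}) \<le> r" using card_image_le[of "{1..r}" y] by simp
        \<comment> \<open>Values of \<open>y\<close> may repeat, so the image is enlarged to exactly
          \<open>r\<close> points.\<close>
        ultimately obtain A where A: "y ` {1..r} \<subseteq> A" "A \<subseteq> P" "card A = r"
          using exists_subset_between[of "y ` {1..r}" r P] P by auto
        have "(1 / real (card {1..r})) *\<^sub>R (\<Sum>j\<in>{1..r}. y j) \<in> convex hull A"
          using r A(1) by (intro mean_in_convex_hull) auto
        then have "(1 / real r) *\<^sub>R (\<Sum>j=1..r. y j) \<in> convex hull A \<inter> cball c (e * D)"
          using y by (simp add: G_def)
        then have "A \<in> \<A>" using A by (auto simp: \<A>_def)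
        moreover have "y \<in> {1..r} \<rightarrow>\<^sub>E A" using y A(1) by (auto simp: G_def PiE_iff)
        ultimately show "y \<in> (\<Union>A\<in>\<A>. {1..r} \<rightarrow>\<^sub>E A)" by blast
      qed
      moreover have fin: "finite ({1..r} \<rightarrow>\<^sub>E A)" if "A \<in> \<A>" for A
        using that P(1) finite_subset by (intro finite_PiE) (auto simp: \<A>_def)
      ultimately have "card G \<le> card (\<Union>A\<in>\<A>. {1..r} \<rightarrow>\<^sub>E A)" using fA by (intro card_mono) auto
      also have "\<dots> \<le> (\<Sum>A\<in>\<A>. card ({1..r} \<rightarrow>\<^sub>E A))" by (rule card_UN_le[OF fA])
      also have "\<dots> = (\<Sum>A\<in>\<A>. r ^ r)" by (rule sum.cong) (auto simp: \<A>_def card_PiE)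
      finally have "card G \<le> card \<A> * r ^ r" by simp
      then have "card P ^ r \<le> 2 * (card \<A> * r ^ r)" using c unfolding G_def by linarith
      moreover have "card P choose r \<le> card P ^ r" by (rule binomial_le_pow[OF P(2)])
      ultimately have "card P choose r \<le> 2 * (card \<A> * r ^ r)" by linarith
      then have "real (card P choose r) \<le> real (2 * (card \<A> * r ^ r))" by (rule of_nat_mono)
      then have "1 / (2 * real r ^ r) * real (card P choose r) \<le> real (card \<A>)"
        using r by (simp add: field_simps)
      then show "(INF x. INF \<alpha>\<in>{\<alpha>::real. 0 < \<alpha> \<and>
         1 / (2 * real r ^ r) * real (card P choose r)
         \<le> real (card {A. A \<subseteq> P \<and> card A = r \<and> convex hull A \<inter> cball x (\<alpha> * diameter P) \<noteq> {}})}.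
         ennreal \<alpha>) \<le> ennreal e"
        by (intro INF_lower2[of c] INF_lower2[of e]) (use e in \<open>auto simp: \<A>_def D_def\<close>)
    qed
  qed
qed

text \<open>Greedy construction: while a set \<open>Y\<close> of proportion
  \<open>\<epsilon>\<close> is missed, add the centre \<open>c\<close> supplied by
  \<open>card_close_means\<close>. The functions into \<open>Y\<close> with mean near
  \<open>c\<close> were hit by no earlier net point, because their means lie in
  \<open>convex hull Y\<close>. Each step thus uses up at least
  \<open>(\<epsilon> * card P) ^ r / 2\<close> of the \<open>card P ^ r\<close> functions, which
  bounds the number of steps independently of \<open>P\<close>.\<close>

lemma WeakNet_le_if_B_convex:
  assumes "B_convex (X :: 'a::real_normed_vector itself)" "0 < \<epsilon>" "0 < \<eta>"
  shows "\<exists>M. WeakNet X \<epsilon> M \<le> ennreal \<eta>"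
proof -
  from card_close_means[OF assms(1,3)] obtain r where
    N: "r \<ge> 1 \<and> (\<forall>r'\<ge>r. \<forall>(Y :: 'a set) D. finite Y \<longrightarrow> Y \<noteq> {} \<longrightarrow> 0 < D \<longrightarrow>
    (\<forall>x\<in>Y. \<forall>y\<in>Y. dist x y \<le> D) \<longrightarrow>
    (\<exists>c. card Y ^ r' \<le> 2 * card {y \<in> {1..r'} \<rightarrow>\<^sub>E Y. dist c ((1 / real r') *\<^sub>R (\<Sum>j=1..r'. y j)) \<le> \<eta> * D}))" ..
  have r: "1 \<le> r" using N by (rule conjunct1)
  \<comment> \<open>After \<open>2 / \<epsilon> ^ r\<close> greedy steps all functions would be used
    up.\<close>
  obtain M where M: "2 / \<epsilon> ^ r < real M" using reals_Archimedean2 by blast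
  have "WeakNet X \<epsilon> M \<le> ennreal \<eta>"
    unfolding WeakNet_def
  proof (rule SUP_least)
    fix P :: "'a set" assume "P \<in> {P. finite P \<and> 0 < diameter P}"
    then have P: "finite P" "0 < diameter P" by auto
    then have "P \<noteq> {}" by auto
    then have cP: "real (card P) > 0" using P(1) by (simp add: card_gt_0_iff)
    define D where "D = diameter P"
    define av where "av y = (1 / real r) *\<^sub>R (\<Sum>j=1..r. y j)" for y :: "nat \<Rightarrow> 'a"
    have av: "av y \<in> convex hull Y" if "y \<in> {1..r} \<rightarrow>\<^sub>E Y" for y Y
    proof -
      have "(1 / real (card {1..r})) *\<^sub>R (\<Sum>j\<in>{1..r}. y j) \<in> convex hull Y"
        using r that by (intro mean_in_convex_hull) auto
      then show ?thesis by (simp add: av_def)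
    qed
    have "\<exists>F. finite F \<and> card F \<le> M \<and>
      (\<forall>Y. Y \<subseteq> P \<longrightarrow> \<epsilon> * real (card P) \<le> real (card Y) \<longrightarrow> (\<exists>f\<in>F. \<exists>p\<in>convex hull Y. dist f p \<le> \<eta> * D))"
    proof (rule ccontr)
      assume neg: "\<not> ?thesis"
      define hit where "hit F = {y \<in> {1..r} \<rightarrow>\<^sub>E P. \<exists>f\<in>F. dist f (av y) \<le> \<eta> * D}" for F
      have fin: "finite ({1..r} \<rightarrow>\<^sub>E P)" using P by (intro finite_PiE) auto
      have "\<exists>F. finite F \<and> card F \<le> t \<and> real t * (\<epsilon> * real (card P)) ^ r \<le> 2 * real (card (hit F))"
        if "t \<le> M" for t
        using that
      proof (induction t)
        case 0
        show ?case by (intro exI[of _ "{}"]) auto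
      next
        case (Suc t)
        then obtain F where F: "finite F" "card F \<le> t"
          "real t * (\<epsilon> * real (card P)) ^ r \<le> 2 * real (card (hit F))" by auto
        have FM: "card F \<le> M" using F(2) Suc.prems by linarith
        have "\<not> (\<forall>Y. Y \<subseteq> P \<longrightarrow> \<epsilon> * real (card P) \<le> real (card Y) \<longrightarrow>
            (\<exists>f\<in>F. \<exists>p\<in>convex hull Y. dist f p \<le> \<eta> * D))"
          using neg by (rule contrapos_nn) (intro exI[of _ F] conjI F(1) FM)
        then obtain Y where Y: "Y \<subseteq> P" "\<epsilon> * real (card P) \<le> real (card Y)"
          and "\<not> (\<exists>f\<in>F. \<exists>p\<in>convex hull Y. dist f p \<le> \<eta> * D)"
          unfolding not_all not_imp by (elim exE conjE) (rule that)
        then have far: "\<not> dist f p \<le> \<eta> * D" if "f \<in> F" "p \<in> convex hull Y" for f p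
          using that by blast
        have fY: "finite Y" using Y P finite_subset by blast
        have "0 < \<epsilon> * real (card P)" using assms cP by simp
        then have "Y \<noteq> {}" using Y(2) by auto
        have "\<forall>x\<in>Y. \<forall>y\<in>Y. dist x y \<le> D" using Y(1) dist_le_diameter[OF P(1)] by (auto simp: D_def)
        then obtain c where c: "card Y ^ r \<le> 2 * card {y \<in> {1..r} \<rightarrow>\<^sub>E Y. dist c (av y) \<le> \<eta> * D}"
          using N[THEN conjunct2, rule_format, OF order_refl fY \<open>Y \<noteq> {}\<close>, of D] P(2)
          by (auto simp: D_def av_def)
        define G where "G = {y \<in> {1..r} \<rightarrow>\<^sub>E Y. dist c (av y) \<le> \<eta> * D}"
        have "G \<subseteq> hit (insert c F)" using Y(1) by (auto simp: G_def hit_def PiE_iff)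
        moreover have "hit F \<subseteq> hit (insert c F)" by (auto simp: hit_def)
        ultimately have sub: "hit F \<union> G \<subseteq> hit (insert c F)" by simp
        have fh: "finite (hit F')" for F' using fin by (simp add: hit_def)
        have "hit F \<inter> G = {}" using far av by (auto simp: hit_def G_def)
        then have "card (hit F \<union> G) = card (hit F) + card G"
          using fh finite_subset[OF sub fh] by (intro card_Un_disjoint) auto
        then have "card (hit F) + card G \<le> card (hit (insert c F))"
          using card_mono[OF fh sub] by simp
        moreover have "(\<epsilon> * real (card P)) ^ r \<le> 2 * real (card G)"
        proof -
          have "(\<epsilon> * real (card P)) ^ r \<le> real (card Y) ^ r" using Y(2) assms by (intro power_mono) auto
          also have "\<dots> = real (card Y ^ r)" by simp
          also have "\<dots> \<le> real (2 * card G)" using c unfolding G_def by (rule of_nat_mono)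
          finally show ?thesis by simp
        qed
        ultimately have "real (Suc t) * (\<epsilon> * real (card P)) ^ r \<le> 2 * real (card (hit (insert c F)))"
          using F(3) by (simp add: algebra_simps)
        moreover have "card (insert c F) \<le> Suc t" using F card_insert_le_m1[of "Suc t" F c] by (simp add: card_insert_if)
        ultimately show ?case using F(1) by (intro exI[of _ "insert c F"]) auto
      qed
      from this[OF order_refl] obtain F where
        F: "real M * (\<epsilon> * real (card P)) ^ r \<le> 2 * real (card (hit F))" by blast
      have "card (hit F) \<le> card ({1..r} \<rightarrow>\<^sub>E P)" using fin by (intro card_mono) (auto simp: hit_def)
      also have "\<dots> = card P ^ r" by (simp add: card_PiE)
      finally have hr: "real (card (hit F)) \<le> real (card P) ^ r" by (metis of_nat_mono of_nat_power)
      have "(real M * \<epsilon> ^ r) * real (card P) ^ r \<le> 2 * real (card P) ^ r"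
        using F hr unfolding power_mult_distrib mult.assoc by linarith
      then have "real M * \<epsilon> ^ r \<le> 2" using cP by simp
      then have "real M \<le> 2 / \<epsilon> ^ r" using assms by (simp add: pos_le_divide_eq)
      with M show False by simp
    qed
    then obtain F where F: "finite F" "card F \<le> M" and near: "\<And>Y. Y \<subseteq> P \<Longrightarrow>
        \<epsilon> * real (card P) \<le> real (card Y) \<Longrightarrow> \<exists>f\<in>F. \<exists>p\<in>convex hull Y. dist f p \<le> \<eta> * D" by blast
    have "set_edist F (convex hull Y) / ennreal D \<le> ennreal \<eta>"
      if Y: "Y \<subseteq> P" "\<epsilon> * real (card P) \<le> real (card Y)" for Y
    proof -
      obtain f p where "f \<in> F" "p \<in> convex hull Y" "dist f p \<le> \<eta> * D" using near[OF Y] by blast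
      then show ?thesis using P assms by (intro ennreal_divide_le set_edist_le) (auto simp: D_def)
    qed
    then show "(INF F\<in>{F. finite F \<and> card F \<le> M}. SUP Y\<in>{Y. Y \<subseteq> P \<and> \<epsilon> * real (card P) \<le> real (card Y)}.
        set_edist F (convex hull Y) / ennreal (diameter P)) \<le> ennreal \<eta>"
      by (intro INF_lower2[of F] SUP_least) (use F in \<open>auto simp: D_def\<close>)
  qed
  then show ?thesis by blast
qed

section \<open>Helly\<close>

lemma exists_dist_less_infdist:
  assumes "A \<noteq> {}" "0 < e"
  obtains a where "a \<in> A" "dist x a < infdist x A + e"
proof (rule ccontr)
  assume "\<not> thesis"
  then have "infdist x A + e \<le> dist x a" if "a \<in> A" for a using that \<open>\<And>a. _ \<Longrightarrow> _ \<Longrightarrow> thesis\<close> by force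
  then have "infdist x A + e \<le> infdist x A"
    unfolding infdist_notempty[OF assms(1)] using assms(1) by (intro cINF_greatest) (auto simp: infdist_notempty)
  then show False using assms(2) by simp
qed

text \<open>The distance to a convex set is a convex function; infima may not be attained, so points
  that are optimal up to \<open>e\<close> are averaged instead.\<close>

lemma infdist_mean_le:
  fixes C :: "'a::real_normed_vector set"
  assumes "convex C" "C \<noteq> {}" "0 < T"
  shows "infdist ((1 / real T) *\<^sub>R (\<Sum>t<T. x t)) C \<le> (\<Sum>t<T. infdist (x t) C) / real T"
proof (rule field_le_epsilon)
  fix e :: real assume e: "0 < e"
  have "\<exists>c\<in>C. dist (x t) c < infdist (x t) C + e" for t
    using exists_dist_less_infdist[OF assms(2) e] by metis
  then obtain c where c: "\<And>t. c t \<in> C" "\<And>t. dist (x t) (c t) < infdist (x t) C + e" by metis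
  have "(\<Sum>t<T. (1 / real T) *\<^sub>R c t) \<in> C"
    by (rule convex_sum) (use assms c in auto)
  then have "infdist ((1 / real T) *\<^sub>R (\<Sum>t<T. x t)) C
      \<le> dist ((1 / real T) *\<^sub>R (\<Sum>t<T. x t)) (\<Sum>t<T. (1 / real T) *\<^sub>R c t)"
    by (rule infdist_le)
  also have "\<dots> = norm (\<Sum>t<T. x t - c t) / real T"
    by (simp add: dist_norm scaleR_sum_right[symmetric] sum_subtractf flip: scaleR_diff_right)
  also have "\<dots> \<le> (\<Sum>t<T. infdist (x t) C + e) / real T"
    by (intro divide_right_mono sum_norm_le) (use c(2) in \<open>auto simp: dist_norm intro: less_imp_le\<close>)
  also have "\<dots> = (\<Sum>t<T. infdist (x t) C) / real T + e"
    using assms(3) by (simp add: sum.distrib add_divide_distrib)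
  finally show "infdist ((1 / real T) *\<^sub>R (\<Sum>t<T. x t)) C \<le> (\<Sum>t<T. infdist (x t) C) / real T + e" .
qed

section \<open>From one point for each weighting to one point for the whole family\<close>

text \<open>Multiplicative weights update: each \<open>x t\<close> answers the weights that are proportional to
  \<open>\<Prod>s<t. 1 + d (x s) C\<close>.  This replaces a minimax argument.\<close>

lemma multiplicative_weights:
  fixes d :: "'x \<Rightarrow> 'c \<Rightarrow> real"
  assumes fin: "finite \<F>" "\<F> \<noteq> {}" and "0 \<le> \<alpha>"
    and answer: "\<And>p. weights \<F> p \<Longrightarrow> \<exists>x\<in>K. (\<Sum>C\<in>\<F>. p C * d x C) \<le> \<alpha>"
    and d: "\<And>x C. x \<in> K \<Longrightarrow> C \<in> \<F> \<Longrightarrow> 0 \<le> d x C"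
  shows "\<exists>x :: nat \<Rightarrow> 'x. (\<forall>t<T. x t \<in> K) \<and>
    (\<Sum>C\<in>\<F>. \<Prod>t<T. 1 + d (x t) C) \<le> real (card \<F>) * (1 + \<alpha>) ^ T"
proof (induction T)
  case 0
  show ?case by simp
next
  case (Suc T)
  then obtain x where x: "\<forall>t<T. x t \<in> K"
    and le: "(\<Sum>C\<in>\<F>. \<Prod>t<T. 1 + d (x t) C) \<le> real (card \<F>) * (1 + \<alpha>) ^ T" by blast
  define W where "W C = (\<Prod>t<T. 1 + d (x t) C)" for C
  have W: "0 < W C" if "C \<in> \<F>" for C
    unfolding W_def using x d that by (intro prod_pos) (auto intro: add_pos_nonneg)
  define S where "S = (\<Sum>C\<in>\<F>. W C)"
  have S: "0 < S" unfolding S_def using fin W by (intro sum_pos) auto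
  have "weights \<F> (\<lambda>C. W C / S)"
    by unfold_locales (use fin W S in \<open>auto simp: sum_divide_distrib[symmetric] S_def intro: less_imp_le\<close>)
  from answer[OF this] obtain z where z: "z \<in> K" "(\<Sum>C\<in>\<F>. W C / S * d z C) \<le> \<alpha>" by blast
  have "(\<Sum>C\<in>\<F>. W C * d z C) = S * (\<Sum>C\<in>\<F>. W C / S * d z C)"
    using S by (simp add: sum_distrib_left)
  also have "\<dots> \<le> S * \<alpha>" using S z by (intro mult_left_mono) auto
  finally have zle: "(\<Sum>C\<in>\<F>. W C * d z C) \<le> S * \<alpha>" .
  have "(\<Sum>C\<in>\<F>. \<Prod>t<Suc T. 1 + d ((x(T := z)) t) C) = (\<Sum>C\<in>\<F>. W C * (1 + d z C))"
    by (intro sum.cong) (auto simp: W_def intro!: prod.cong)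
  also have "\<dots> = S + (\<Sum>C\<in>\<F>. W C * d z C)" by (simp add: algebra_simps sum.distrib S_def)
  also have "\<dots> \<le> S * (1 + \<alpha>)" using zle by (simp add: algebra_simps)
  also have "\<dots> \<le> real (card \<F>) * (1 + \<alpha>) ^ T * (1 + \<alpha>)"
    using le assms(3) by (intro mult_right_mono) (auto simp: S_def W_def)
  finally have "(\<Sum>C\<in>\<F>. \<Prod>t<Suc T. 1 + d ((x(T := z)) t) C) \<le> real (card \<F>) * (1 + \<alpha>) ^ Suc T"
    by (simp add: ac_simps)
  then show ?case using x z(1) by (intro exI[of _ "x(T := z)"]) (auto simp: less_Suc_eq)
qed

text \<open>Trades the factors \<open>1 + u\<close> of the multiplicative weights for exponentials;
  this is the source of the factor 2 in the regret bound.\<close>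

lemma exp_half_le:
  assumes "0 \<le> u" "u \<le> (1::real)"
  shows "exp (u / 2) \<le> 1 + u"
proof -
  have "exp (u / 2) \<le> 1 + u / 2 + (u / 2)\<^sup>2" by (rule exp_bound) (use assms in auto)
  also have "(u / 2)\<^sup>2 \<le> u / 2"
    using mult_left_le[of u u] assms by (simp add: power2_eq_square)
  finally show ?thesis by simp
qed

text \<open>The product belonging to one \<open>C\<close> is at most the sum over all of
  \<open>\<F>\<close>. Taking logarithms leaves an error \<open>ln (card \<F>)\<close>, which is
  absorbed once \<open>T\<close> exceeds \<open>2 * ln (card \<F>) / \<epsilon>\<close>.\<close>

lemma multiplicative_weights_regret:
  fixes d :: "'x \<Rightarrow> 'c \<Rightarrow> real"
  assumes fin: "finite \<F>" "\<F> \<noteq> {}" and "0 \<le> \<alpha>" "0 < \<epsilon>"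
    and answer: "\<And>p. weights \<F> p \<Longrightarrow> \<exists>x\<in>K. (\<Sum>C\<in>\<F>. p C * d x C) \<le> \<alpha>"
    and d: "\<And>x C. x \<in> K \<Longrightarrow> C \<in> \<F> \<Longrightarrow> 0 \<le> d x C" "\<And>x C. x \<in> K \<Longrightarrow> C \<in> \<F> \<Longrightarrow> d x C \<le> 1"
  obtains T x where "0 < T" "\<forall>t<T. x t \<in> K" "\<And>C. C \<in> \<F> \<Longrightarrow> (\<Sum>t<T. d (x t) C) \<le> (2 * \<alpha> + \<epsilon>) * real T"
proof -
  obtain T where T: "2 * ln (real (card \<F>)) / \<epsilon> < real T" using reals_Archimedean2 by blast
  have c: "1 \<le> real (card \<F>)" using fin by (simp add: Suc_le_eq card_gt_0_iff)
  then have "0 \<le> 2 * ln (real (card \<F>)) / \<epsilon>" using assms(4) by simp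
  then have T0: "0 < T" using T by (cases T) auto
  obtain x where x: "\<forall>t<T. x t \<in> K"
    and le: "(\<Sum>C\<in>\<F>. \<Prod>t<T. 1 + d (x t) C) \<le> real (card \<F>) * (1 + \<alpha>) ^ T"
    using multiplicative_weights[OF fin assms(3) answer d(1)] by blast
  show ?thesis
  proof (rule that[OF T0 x])
    fix C assume C: "C \<in> \<F>"
    have "exp ((\<Sum>t<T. d (x t) C) / 2) = (\<Prod>t<T. exp (d (x t) C / 2))"
      by (simp add: sum_divide_distrib exp_sum)
    also have "\<dots> \<le> (\<Prod>t<T. 1 + d (x t) C)"
      using x d C by (intro prod_mono) (auto intro: exp_half_le)
    also have "\<dots> \<le> (\<Sum>C\<in>\<F>. \<Prod>t<T. 1 + d (x t) C)"
      using fin C x d by (intro member_le_sum) (auto intro!: prod_nonneg add_nonneg_nonneg)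
    also note le
    also have "real (card \<F>) * (1 + \<alpha>) ^ T \<le> real (card \<F>) * exp \<alpha> ^ T"
      using assms(3) by (intro mult_left_mono power_mono) (auto simp: exp_ge_add_one_self)
    also have "\<dots> = exp (ln (real (card \<F>)) + real T * \<alpha>)"
      using c by (simp add: exp_add exp_of_nat_mult)
    finally have "(\<Sum>t<T. d (x t) C) / 2 \<le> ln (real (card \<F>)) + real T * \<alpha>" by simp
    moreover have "2 * ln (real (card \<F>)) \<le> \<epsilon> * real T"
      using T assms(4) by (simp add: pos_divide_less_eq mult.commute)
    ultimately show "(\<Sum>t<T. d (x t) C) \<le> (2 * \<alpha> + \<epsilon>) * real T"
      by (simp add: algebra_simps)
  qed
qed

text \<open>For \<open>m\<close> independent random members \<open>i 1, \<dots>, i m\<close> of the family and random signs \<open>\<theta>\<close>,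
  pick a point in the intersection of the \<open>i j\<close> with \<open>\<theta> j = 1\<close>.  Its average over \<open>\<theta> j = 1\<close> lies
  in \<open>i j\<close>, and its average over \<open>\<theta> j = -1\<close> is independent of \<open>i j\<close>; for typical \<open>j\<close>
  these two averages are close.\<close>

lemma B_convex_average_Helly:
  assumes "B_convex (X :: 'a::real_normed_vector itself)" "0 < e"
  shows "\<exists>m\<ge>1. \<forall>(\<F> :: 'a set set) p. finite \<F> \<longrightarrow> (\<forall>C\<in>\<F>. convex C \<and> C \<subseteq> cball 0 1) \<longrightarrow>
    (\<forall>\<G>\<subseteq>\<F>. card \<G> \<le> m \<longrightarrow> \<Inter>\<G> \<noteq> {}) \<longrightarrow> weights \<F> p \<longrightarrow>
    (\<exists>x\<in>cball 0 1. (\<Sum>C\<in>\<F>. p C * infdist x C) \<le> 3 * e)"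
proof -
  obtain m where m: "1 \<le> m" and proj:
    "\<And>x :: (nat \<Rightarrow> real) \<Rightarrow> 'a. (\<And>\<theta>. \<theta> \<in> signs {1..m} \<Longrightarrow> norm (x \<theta>) \<le> 1) \<Longrightarrow>
      (\<Sum>l=1..m. norm (savg {1..m} (\<lambda>\<theta>. \<theta> l *\<^sub>R x \<theta>))) \<le> e * real m"
    by (rule B_convex_Rademacher_projection_small[OF assms]) blast
  show ?thesis
  proof (intro exI[of _ m] conjI allI impI m)
    fix \<F> :: "'a set set" and p
    assume fin: "finite \<F>" and conv: "\<forall>C\<in>\<F>. convex C \<and> C \<subseteq> cball 0 1"
      and int: "\<forall>\<G>\<subseteq>\<F>. card \<G> \<le> m \<longrightarrow> \<Inter>\<G> \<noteq> {}" and p: "weights \<F> p"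
    interpret weights \<F> p by (rule p)
    \<comment> \<open>The empty subfamily has intersection \<open>UNIV\<close>; its point is placed
      at 0 so that all chosen points stay in the ball.\<close>
    have "\<exists>z. \<G> \<subseteq> \<F> \<longrightarrow> card \<G> \<le> m \<longrightarrow> z \<in> \<Inter>\<G> \<and> z \<in> cball 0 1" for \<G>
    proof (cases "\<G> = {}")
      case True
      then show ?thesis by (intro exI[of _ 0]) auto
    next
      case False
      then show ?thesis using int conv by blast
    qed
    then obtain pt where pt: "\<And>\<G>. \<G> \<subseteq> \<F> \<Longrightarrow> card \<G> \<le> m \<Longrightarrow> pt \<G> \<in> \<Inter>\<G>"
        "\<And>\<G>. \<G> \<subseteq> \<F> \<Longrightarrow> card \<G> \<le> m \<Longrightarrow> pt \<G> \<in> cball 0 1"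
      by metis
    define Y where "Y i \<theta> = pt (i ` {l \<in> {1..m}. \<theta> l = (1::real)})" for i :: "nat \<Rightarrow> 'a set" and \<theta>
    have sub: "i ` {l \<in> {1..m}. \<theta> l = (1::real)} \<subseteq> \<F>" "card (i ` {l \<in> {1..m}. \<theta> l = (1::real)}) \<le> m"
      if "\<forall>l\<in>{1..m}. \<theta> l = 1 \<longrightarrow> i l \<in> \<F>" for i \<theta>
    proof -
      show "i ` {l \<in> {1..m}. \<theta> l = 1} \<subseteq> \<F>" using that by auto
      have "card (i ` {l \<in> {1..m}. \<theta> l = 1}) \<le> card {l \<in> {1..m}. \<theta> l = 1}" by (rule card_image_le) simp
      also have "\<dots> \<le> card {1..m}" by (rule card_mono) auto
      finally show "card (i ` {l \<in> {1..m}. \<theta> l = 1}) \<le> m" by simp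
    qed
    have Yball: "Y i \<theta> \<in> cball 0 1" if "\<forall>l\<in>{1..m}. \<theta> l = 1 \<longrightarrow> i l \<in> \<F>" for i \<theta>
      unfolding Y_def using sub[OF that] by (rule pt(2))
    have Yin: "Y i \<theta> \<in> i l" if "\<forall>l\<in>{1..m}. \<theta> l = 1 \<longrightarrow> i l \<in> \<F>" "l \<in> {1..m}" "\<theta> l = 1" for i \<theta> l
    proof -
      have "Y i \<theta> \<in> \<Inter>(i ` {l \<in> {1..m}. \<theta> l = 1})" unfolding Y_def using sub[OF that(1)] by (rule pt(1))
      then show ?thesis using that(2,3) by blast
    qed
    show "\<exists>x\<in>cball 0 1. (\<Sum>C\<in>\<F>. p C * infdist x C) \<le> 3 * e"
    proof (rule ccontr)
      assume "\<not> ?thesis"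
      \<comment> \<open>If the claim fails, this lower bound holds at every point of the ball, in
        particular at the random points \<open>z g\<close> below; the contradiction is
        \<open>3 * e\<close> against \<open>2 * e\<close>.\<close>
      then have neg: "3 * e \<le> (\<Sum>C\<in>\<F>. p C * infdist x C)" if "x \<in> cball 0 1" for x
        using that by (meson linear)
      define P where "P j i = norm (savg {1..m} (\<lambda>\<theta>. \<theta> j *\<^sub>R Y i \<theta>))" for j i
      have key: "3 * e \<le> 2 * pavg {1..m} \<F> p (P j)" if j: "j \<in> {1..m}" for j
      proof -
        define R where "R = {1..m} - {j}"
        have R: "finite R" "j \<notin> R" "{1..m} = insert j R" using j by (auto simp: R_def)
        define y where "y i = savg R (\<lambda>\<theta>. Y i (\<theta>(j := 1)))" for i
        define z where "z i = savg R (\<lambda>\<theta>. Y i (\<theta>(j := -1)))" for i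
        \<comment> \<open>With sign \<open>-1\<close> at \<open>j\<close> the member
          \<open>i j\<close> is not among those intersected, so \<open>z\<close> ignores the
          coordinate \<open>j\<close>.\<close>
        have z_upd: "z (g(j := C)) = z g" for g C
        proof -
          have "(g(j := C)) ` {l \<in> {1..m}. (\<theta>(j := -1)) l = 1} = g ` {l \<in> {1..m}. (\<theta>(j := -1)) l = (1::real)}" for \<theta>
            by (rule image_cong) auto
          then show ?thesis unfolding z_def Y_def by presburger
        qed
        have "3 * e \<le> pavg R \<F> p (\<lambda>g. \<Sum>C\<in>\<F>. p C * infdist (z g) C)"
        proof (intro pavg_ge R neg)
          fix g assume g: "g \<in> R \<rightarrow>\<^sub>E \<F>"
          show "z g \<in> cball 0 1"
            unfolding z_def
            by (rule signs.pavg_in_convex[OF R(1) convex_cball], rule Yball) (use g R in \<open>auto simp: R_def PiE_iff\<close>)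
        qed
        \<comment> \<open>Restoring the coordinate \<open>j\<close> turns the weighted sum over
          \<open>C\<close> into an average over the independent member \<open>i j\<close>.\<close>
        also have "\<dots> = (\<Sum>C\<in>\<F>. p C *\<^sub>R pavg R \<F> p (\<lambda>g. infdist (z (g(j := C))) ((g(j := C)) j)))"
          by (simp add: pavg_sum pavg_mult z_upd)
        also have "\<dots> = pavg {1..m} \<F> p (\<lambda>i. infdist (z i) (i j))"
          unfolding R(3) by (rule pavg_insert[OF R(1,2), symmetric])
        also have "\<dots> \<le> pavg {1..m} \<F> p (\<lambda>i. 2 * P j i)"
        proof (rule pavg_mono)
          fix i assume i: "i \<in> {1..m} \<rightarrow>\<^sub>E \<F>"
          then have iF: "\<forall>l\<in>{1..m}. \<theta> l = (1::real) \<longrightarrow> i l \<in> \<F>" for \<theta> by auto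
          have "savg {1..m} (\<lambda>\<theta>. \<theta> j *\<^sub>R Y i \<theta>) = (1/2) *\<^sub>R y i + (1/2) *\<^sub>R savg R (\<lambda>\<theta>. - Y i (\<theta>(j := -1)))"
            unfolding R(3) by (subst savg_insert[OF R(1,2)]) (simp add: y_def)
          also have "\<dots> = (1/2) *\<^sub>R (y i - z i)" by (simp add: pavg_minus z_def scaleR_diff_right)
          finally have P: "P j i = dist (z i) (y i) / 2" by (simp add: P_def dist_norm norm_minus_commute)
          have "convex (i j)" using conv i j by auto
          then have "y i \<in> i j"
            unfolding y_def
          proof (rule signs.pavg_in_convex[OF R(1)])
            fix \<theta> :: "nat \<Rightarrow> real"
            show "Y i (\<theta>(j := 1)) \<in> i j" by (rule Yin[OF iF j]) simp
          qed
          then have "infdist (z i) (i j) \<le> dist (z i) (y i)" by (rule infdist_le)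
          then show "infdist (z i) (i j) \<le> 2 * P j i" by (simp add: P)
        qed
        finally show ?thesis by (simp add: pavg_mult)
      qed
      have "real m * (3 * e) = (\<Sum>j=1..m. 3 * e)" by simp
      also have "\<dots> \<le> (\<Sum>j=1..m. 2 * pavg {1..m} \<F> p (P j))" by (intro sum_mono key)
      also have "\<dots> = 2 * pavg {1..m} \<F> p (\<lambda>i. \<Sum>j=1..m. P j i)"
        by (simp only: pavg_sum sum_distrib_left)
      also have "\<dots> \<le> 2 * (e * real m)"
      proof (intro mult_left_mono pavg_le)
        fix i assume "i \<in> {1..m} \<rightarrow>\<^sub>E \<F>"
        then have iF: "\<forall>l\<in>{1..m}. \<theta> l = (1::real) \<longrightarrow> i l \<in> \<F>" for \<theta> by auto
        show "(\<Sum>j=1..m. P j i) \<le> e * real m"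
          unfolding P_def by (rule proj) (use Yball[OF iF] in simp)
      qed auto
      finally show False using assms(2) m by simp
    qed
  qed
qed

lemma Helly_tendsto_zero_if_B_convex:
  assumes "B_convex (X :: 'a::real_normed_vector itself)"
  shows "(\<lambda>k. Helly X k) \<longlonglongrightarrow> 0"
proof (rule ennreal_tendsto_zeroI)
  fix e :: real assume e: "0 < e"
  \<comment> \<open>Budget: distances from the ball to a member can reach 2 and are halved, so
    \<open>3 * (e/12)\<close> becomes \<open>e/8\<close>; the regret bound
    \<open>2 * (e/8) + e/4 = e/2\<close> is doubled back to \<open>e\<close>.\<close>
  then have "0 < e / 12" by simp
  from B_convex_average_Helly[OF assms this] obtain m where
    m: "m\<ge>1 \<and> (\<forall>(\<F> :: 'a set set) p. finite \<F> \<longrightarrow> (\<forall>C\<in>\<F>. convex C \<and> C \<subseteq> cball 0 1) \<longrightarrow>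
    (\<forall>\<G>\<subseteq>\<F>. card \<G> \<le> m \<longrightarrow> \<Inter>\<G> \<noteq> {}) \<longrightarrow> weights \<F> p \<longrightarrow>
    (\<exists>x\<in>cball 0 1. (\<Sum>C\<in>\<F>. p C * infdist x C) \<le> 3 * (e / 12)))" ..
  show "\<forall>\<^sub>F k in sequentially. Helly X k \<le> ennreal e"
    unfolding eventually_sequentially
  proof (intro exI[of _ m] allI impI)
    fix k assume k: "m \<le> k"
    then have k1: "1 \<le> k" using m by linarith
    have "\<exists>x. \<forall>C\<in>\<F>. set_edist {x} C \<le> ennreal e"
      if fin: "finite \<F>" and conv: "\<forall>C\<in>\<F>. convex C \<and> C \<subseteq> cball 0 1"
        and int: "\<forall>\<G>\<subseteq>\<F>. card \<G> \<le> k \<longrightarrow> \<Inter>\<G> \<noteq> {}" for \<F> :: "'a set set"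
    proof (cases "\<F> = {}")
      case False
      have ne: "C \<noteq> {}" if "C \<in> \<F>" for C
      proof -
        have "{C} \<subseteq> \<F>" "card {C} \<le> k" using that k1 by auto
        then have "\<Inter>{C} \<noteq> {}" using int by blast
        then show ?thesis by simp
      qed
      have int': "\<forall>\<G>\<subseteq>\<F>. card \<G> \<le> m \<longrightarrow> \<Inter>\<G> \<noteq> {}" using int k by auto
      have half: "\<exists>x\<in>cball 0 1. (\<Sum>C\<in>\<F>. p C * (infdist x C / 2)) \<le> e / 8" if p: "weights \<F> p" for p
      proof -
        obtain x where x: "x \<in> cball 0 1" "(\<Sum>C\<in>\<F>. p C * infdist x C) \<le> 3 * (e / 12)"
          using m[THEN conjunct2, rule_format, OF fin _ _ p] conv int' by blast
        have "(\<Sum>C\<in>\<F>. p C * (infdist x C / 2)) = (\<Sum>C\<in>\<F>. p C * infdist x C) / 2"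
          by (simp add: sum_divide_distrib)
        also have "\<dots> \<le> e / 8" using x(2) by simp
        finally show ?thesis using x(1) by blast
      qed
      have le1: "infdist x C / 2 \<le> 1" if x: "x \<in> cball 0 1" and C: "C \<in> \<F>" for x C
      proof -
        obtain c where c: "c \<in> C" using ne[OF C] by blast
        then have "norm c \<le> 1" using conv C by fastforce
        have "infdist x C \<le> dist x c" by (rule infdist_le[OF c])
        also have "\<dots> \<le> norm x + norm c" by (simp add: dist_norm norm_triangle_ineq4)
        also have "\<dots> \<le> 2" using x \<open>norm c \<le> 1\<close> by simp
        finally show ?thesis by simp
      qed
      obtain T x where T: "0 < T" "\<forall>t<T. x t \<in> cball (0::'a) 1"
        and reg: "\<And>C. C \<in> \<F> \<Longrightarrow> (\<Sum>t<T. infdist (x t) C / 2) \<le> (2 * (e / 8) + e / 4) * real T"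
        by (rule multiplicative_weights_regret[OF fin False, of "e / 8" "e / 4" "cball 0 1" "\<lambda>x C. infdist x C / 2"])
           (use e half le1 in \<open>auto simp: infdist_nonneg\<close>)
      define z where "z = (1 / real T) *\<^sub>R (\<Sum>t<T. x t)"
      have "set_edist {z} C \<le> ennreal e" if C: "C \<in> \<F>" for C
      proof -
        have "infdist z C \<le> (\<Sum>t<T. infdist (x t) C) / real T"
          unfolding z_def by (rule infdist_mean_le) (use conv C ne T in auto)
        also have "\<dots> = 2 * ((\<Sum>t<T. infdist (x t) C / 2) / real T)"
          by (simp add: sum_divide_distrib[symmetric])
        also have "\<dots> \<le> e"
        proof -
          have "(\<Sum>t<T. infdist (x t) C / 2) / real T \<le> 2 * (e / 8) + e / 4"
            using reg[OF C] T(1) by (simp add: pos_divide_le_eq)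
          then show ?thesis by linarith
        qed
        finally show ?thesis
          using ne[OF C] by (simp add: set_edist_eq_setdist ennreal_leI flip: infdist_eq_setdist)
      qed
      then show ?thesis by blast
    qed auto
    then show "Helly X k \<le> ennreal e"
      unfolding Helly_def using e by (intro INF_lower) auto
  qed
qed

section \<open>Failure of B-convexity\<close>

text \<open>The image of the unit vector basis in a 2-isomorphic copy of l1 on \<open>J\<close>; the
  upper estimate is the triangle inequality.\<close>

definition l1_system :: "'i set \<Rightarrow> ('i \<Rightarrow> 'a::real_normed_vector) \<Rightarrow> bool" where
  "l1_system J x \<longleftrightarrow> finite J \<and> (\<forall>i\<in>J. norm (x i) \<le> 1) \<and>
     (\<forall>a. (\<Sum>i\<in>J. \<bar>a i\<bar>) / 2 \<le> norm (\<Sum>i\<in>J. a i *\<^sub>R x i))"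

text \<open>Suppose all signed sums of \<open>n\<close> unit ball vectors exceed
  \<open>n - 1/2\<close>. Given coefficients \<open>b\<close> with absolute sum \<open>s\<close>,
  let \<open>\<theta>\<close> be their signs. Since \<open>\<theta> i - b i / s\<close> has absolute
  value \<open>1 - |b i| / s\<close>, these differences account for norm at most
  \<open>n - 1\<close>, and norm at least \<open>1/2\<close> is left for the coefficients
  \<open>b i / s\<close>.\<close>

lemma not_B_convex_l1_system:
  assumes "\<not> B_convex (X :: 'a::real_normed_vector itself)" "finite J"
  obtains x :: "'i \<Rightarrow> 'a::real_normed_vector" where "l1_system J x"
proof -
  \<comment> \<open>\<open>B_convex\<close> speaks of \<open>n \<ge> 2\<close>; if \<open>J\<close>
    is smaller, the surplus vectors receive coefficient 0 below.\<close>
  define n where "n = max 2 (card J)"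
  have n: "2 \<le> n" "card J \<le> n" by (auto simp: n_def)
  \<comment> \<open>The total defect is \<open>\<delta> * n = 1/2\<close>, and the constant of
    \<open>l1_system\<close> is 1 minus this defect.\<close>
  define \<delta> where "\<delta> = 1 / (2 * real n)"
  have \<delta>: "0 < \<delta>" "\<delta> * real n = 1/2" using n by (auto simp: \<delta>_def)
  obtain y :: "nat \<Rightarrow> 'a" where y: "\<And>i. i \<in> {1..n} \<Longrightarrow> norm (y i) \<le> 1"
    and big: "\<And>\<theta>. \<theta> \<in> signs {1..n} \<Longrightarrow> (1 - \<delta>) * real n < norm (\<Sum>i=1..n. \<theta> i *\<^sub>R y i)"
    using assms(1) n(1) \<delta>(1) unfolding B_convex_def by (meson not_le)
  have lower: "(\<Sum>i=1..n. \<bar>b i\<bar>) / 2 \<le> norm (\<Sum>i=1..n. b i *\<^sub>R y i)" for b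
  proof (cases "(\<Sum>i=1..n. \<bar>b i\<bar>) = 0")
    case False
    define s where "s = (\<Sum>i=1..n. \<bar>b i\<bar>)"
    have "0 \<le> s" unfolding s_def by (rule sum_nonneg) simp
    then have s: "0 < s" using False unfolding s_def by linarith
    define \<theta> where "\<theta> = (\<lambda>i\<in>{1..n}. if 0 \<le> b i then 1 else - 1 :: real)"
    have \<theta>: "\<theta> \<in> signs {1..n}" by (auto simp: \<theta>_def)
    have bs: "\<bar>b i\<bar> \<le> s" if "i \<in> {1..n}" for i unfolding s_def using that by (intro member_le_sum) auto
    have diff: "\<bar>\<theta> i - b i / s\<bar> = 1 - \<bar>b i\<bar> / s" if "i \<in> {1..n}" for i
    proof (cases "0 \<le> b i")
      case True
      then show ?thesis using bs[OF that] s that by (simp add: \<theta>_def abs_of_nonneg)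
    next
      case False
      then have "- 1 - b i / s \<le> 0" using bs[OF that] s by (simp add: field_simps)
      then show ?thesis using False that s by (simp add: \<theta>_def abs_of_nonpos)
    qed
    have "norm (\<Sum>i=1..n. (\<theta> i - b i / s) *\<^sub>R y i) \<le> (\<Sum>i=1..n. 1 - \<bar>b i\<bar> / s)"
    proof (rule sum_norm_le)
      fix i assume i: "i \<in> {1..n}"
      have "norm ((\<theta> i - b i / s) *\<^sub>R y i) = (1 - \<bar>b i\<bar> / s) * norm (y i)"
        using diff[OF i] by simp
      also have "\<dots> \<le> 1 - \<bar>b i\<bar> / s"
        using y[OF i] bs[OF i] s by (intro mult_left_le) auto
      finally show "norm ((\<theta> i - b i / s) *\<^sub>R y i) \<le> 1 - \<bar>b i\<bar> / s" .
    qed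
    also have "\<dots> = real n - 1" using s by (simp add: sum_subtractf sum_divide_distrib[symmetric] s_def)
    finally have 1: "norm (\<Sum>i=1..n. (\<theta> i - b i / s) *\<^sub>R y i) \<le> real n - 1" .
    have "(\<Sum>i=1..n. \<theta> i *\<^sub>R y i) = (\<Sum>i=1..n. (\<theta> i - b i / s) *\<^sub>R y i) + (\<Sum>i=1..n. (b i / s) *\<^sub>R y i)"
      unfolding sum.distrib[symmetric] scaleR_add_left[symmetric] by simp
    then have "norm (\<Sum>i=1..n. \<theta> i *\<^sub>R y i)
        \<le> norm (\<Sum>i=1..n. (\<theta> i - b i / s) *\<^sub>R y i) + norm (\<Sum>i=1..n. (b i / s) *\<^sub>R y i)"
      by (simp only: norm_triangle_ineq)
    moreover have "(1 - \<delta>) * real n = real n - 1/2" using \<delta>(2) by (simp add: algebra_simps)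
    ultimately have "1/2 \<le> norm (\<Sum>i=1..n. (b i / s) *\<^sub>R y i)" using big[OF \<theta>] 1 by linarith
    also have "(\<Sum>i=1..n. (b i / s) *\<^sub>R y i) = (\<Sum>i=1..n. b i *\<^sub>R y i) /\<^sub>R s"
      unfolding scaleR_sum_right by (rule sum.cong) (auto simp: field_simps)
    also have "norm ((\<Sum>i=1..n. b i *\<^sub>R y i) /\<^sub>R s) = norm (\<Sum>i=1..n. b i *\<^sub>R y i) / s"
      using s by (simp only: norm_scaleR abs_inverse abs_of_pos divide_inverse mult.commute)
    finally have "1/2 \<le> norm (\<Sum>i=1..n. b i *\<^sub>R y i) / s" .
    then show ?thesis using s unfolding s_def[symmetric] by (simp add: pos_le_divide_eq)
  qed simp
  obtain g where g: "bij_betw g J {1..card J}" 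
    using ex_bij_betw_nat_finite_1[OF assms(2)] bij_betw_inv by blast
  have gn: "g i \<in> {1..n}" if "i \<in> J" for i using bij_betwE[OF g] that n(2) by fastforce
  have inj: "inj_on g J" using g by (simp add: bij_betw_def)
  show ?thesis
  proof (rule that[of "\<lambda>i. y (g i)"])
    show "l1_system J (\<lambda>i. y (g i))"
      unfolding l1_system_def
    proof (intro conjI allI ballI assms(2))
      fix i assume "i \<in> J"
      then show "norm (y (g i)) \<le> 1" using y gn by blast
    next
      fix a :: "'i \<Rightarrow> real"
      define b where "b k = (if k \<in> g ` J then a (inv_into J g k) else 0)" for k
      have sub: "g ` J \<subseteq> {1..n}" using gn by blast
      have "(\<Sum>i=1..n. \<bar>b i\<bar>) = (\<Sum>k\<in>g ` J. \<bar>b k\<bar>)"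
        by (rule sum.mono_neutral_right) (use sub in \<open>auto simp: b_def\<close>)
      also have "\<dots> = (\<Sum>i\<in>J. \<bar>a i\<bar>)" by (subst sum.reindex[OF inj]) (simp add: b_def inj)
      finally have 1: "(\<Sum>i=1..n. \<bar>b i\<bar>) = (\<Sum>i\<in>J. \<bar>a i\<bar>)" .
      have "(\<Sum>i=1..n. b i *\<^sub>R y i) = (\<Sum>k\<in>g ` J. b k *\<^sub>R y k)"
        by (rule sum.mono_neutral_right) (use sub in \<open>auto simp: b_def\<close>)
      also have "\<dots> = (\<Sum>i\<in>J. a i *\<^sub>R y (g i))" by (subst sum.reindex[OF inj]) (simp add: b_def inj)
      finally show "(\<Sum>i\<in>J. \<bar>a i\<bar>) / 2 \<le> norm (\<Sum>i\<in>J. a i *\<^sub>R y (g i))"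
        using lower[of b] 1 by simp
    qed
  qed
qed

section \<open>Points as coefficient vectors\<close>

lemma l1_system_lower: "l1_system J x \<Longrightarrow> (\<Sum>i\<in>J. \<bar>a i\<bar>) \<le> 2 * norm (\<Sum>i\<in>J. a i *\<^sub>R x i)"
proof -
  assume "l1_system J x"
  then have "(\<Sum>i\<in>J. \<bar>a i\<bar>) / 2 \<le> norm (\<Sum>i\<in>J. a i *\<^sub>R x i)" unfolding l1_system_def by blast
  then show ?thesis by simp
qed

lemma l1_system_inj_on:
  assumes "l1_system J x"
  shows "inj_on x J"
proof (rule inj_onI, rule ccontr)
  fix i j assume ij: "i \<in> J" "j \<in> J" "x i = x j" "i \<noteq> j"
  have fJ: "finite J" using assms by (simp add: l1_system_def)
  define a where "a k = (if k = i then 1 else 0) - (if k = j then 1 else 0 :: real)" for k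
  have "(\<Sum>k\<in>J. a k *\<^sub>R x k) = (\<Sum>k\<in>J. (if k = i then x k else 0) - (if k = j then x k else 0))"
    by (rule sum.cong) (auto simp: a_def)
  also have "\<dots> = x i - x j" using ij fJ by (simp add: sum_subtractf)
  also have "\<dots> = 0" using ij by simp
  finally have "(\<Sum>k\<in>J. \<bar>a k\<bar>) \<le> 0" using l1_system_lower[OF assms, of a] by simp
  moreover have "\<bar>a i\<bar> \<le> (\<Sum>k\<in>J. \<bar>a k\<bar>)" using ij fJ by (intro member_le_sum) auto
  ultimately show False using ij by (simp add: a_def)
qed

lemma l1_system_hull:
  assumes "l1_system J x" "I \<subseteq> J" "p \<in> convex hull (x ` I)"
  obtains b where "\<forall>i. 0 \<le> b i" "\<forall>i. i \<notin> I \<longrightarrow> b i = 0" "(\<Sum>i\<in>J. b i) = 1" "p = (\<Sum>i\<in>J. b i *\<^sub>R x i)"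
    "(\<Sum>i\<in>I. b i) = 1"
proof -
  have fJ: "finite J" using assms by (simp add: l1_system_def)
  then have fI: "finite I" using assms finite_subset by blast
  have inj: "inj_on x I" using l1_system_inj_on[OF assms(1)] assms(2) inj_on_subset by blast
  obtain u where u: "\<forall>v\<in>x ` I. 0 \<le> u v" "sum u (x ` I) = 1" "(\<Sum>v\<in>x ` I. u v *\<^sub>R v) = p"
    using assms(3) fI by (auto simp: convex_hull_finite)
  define b where "b i = (if i \<in> I then u (x i) else 0)" for i
  have 1: "(\<Sum>i\<in>I. b i) = 1" using u(2) by (simp add: sum.reindex[OF inj] b_def)
  have 2: "(\<Sum>i\<in>I. b i *\<^sub>R x i) = p" using u(3) by (simp add: sum.reindex[OF inj] b_def)
  have 3: "(\<Sum>i\<in>J. b i) = (\<Sum>i\<in>I. b i)"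
    by (rule sum.mono_neutral_right[OF fJ assms(2)]) (auto simp: b_def)
  have 4: "(\<Sum>i\<in>J. b i *\<^sub>R x i) = (\<Sum>i\<in>I. b i *\<^sub>R x i)"
    by (rule sum.mono_neutral_right[OF fJ assms(2)]) (auto simp: b_def)
  show ?thesis by (rule that[of b]) (use u(1) 1 2 3 4 in \<open>auto simp: b_def\<close>)
qed

lemma l1_system_coeff_dist:
  assumes "l1_system J x" "p = (\<Sum>i\<in>J. b i *\<^sub>R x i)" "q = (\<Sum>i\<in>J. c i *\<^sub>R x i)"
  shows "(\<Sum>i\<in>J. \<bar>b i - c i\<bar>) \<le> 2 * dist p q"
proof -
  have "p - q = (\<Sum>i\<in>J. (b i - c i) *\<^sub>R x i)"
    by (simp add: assms(2,3) sum_subtractf scaleR_diff_left)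
  then show ?thesis using l1_system_lower[OF assms(1), of "\<lambda>i. b i - c i"] by (simp add: dist_norm)
qed

text \<open>Probability vectors with disjoint supports have l1 distance 2, of which the constant of
  \<open>l1_system\<close> leaves 1.\<close>

lemma l1_system_dist_hulls:
  assumes l1: "l1_system J x" and "I \<subseteq> J" "I' \<subseteq> J" "I \<inter> I' = {}"
    and "p \<in> convex hull (x ` I)" "q \<in> convex hull (x ` I')"
  shows "1 \<le> dist p q"
proof -
  have fJ: "finite J" using l1 by (simp add: l1_system_def)
  obtain b where b: "\<forall>i. 0 \<le> b i" "\<forall>i. i \<notin> I \<longrightarrow> b i = 0" "(\<Sum>i\<in>J. b i) = 1" "p = (\<Sum>i\<in>J. b i *\<^sub>R x i)"
    "(\<Sum>i\<in>I. b i) = 1"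
    using l1_system_hull[OF l1 assms(2,5)] by blast
  obtain c where c: "\<forall>i. 0 \<le> c i" "\<forall>i. i \<notin> I' \<longrightarrow> c i = 0" "(\<Sum>i\<in>J. c i) = 1" "q = (\<Sum>i\<in>J. c i *\<^sub>R x i)"
    "(\<Sum>i\<in>I'. c i) = 1"
    using l1_system_hull[OF l1 assms(3,6)] by blast
  have "(2::real) = (\<Sum>i\<in>J. b i + c i)" using b(3) c(3) by (simp add: sum.distrib)
  also have "\<dots> = (\<Sum>i\<in>J. \<bar>b i - c i\<bar>)"
  proof (rule sum.cong)
    fix i
    have "b i = 0 \<or> c i = 0" using b(2) c(2) assms(4) by blast
    then show "b i + c i = \<bar>b i - c i\<bar>" using spec[OF b(1), of i] spec[OF c(1), of i] by auto
  qed simp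
  also have "\<dots> \<le> 2 * dist p q" by (rule l1_system_coeff_dist[OF l1 b(4) c(4)])
  finally show ?thesis by simp
qed

lemma l1_system_diameter_le:
  assumes "l1_system J x" "P \<subseteq> x ` J"
  shows "diameter P \<le> 2"
proof (rule diameter_le)
  fix p q assume "p \<in> P" "q \<in> P"
  then have "norm p \<le> 1" "norm q \<le> 1" using assms by (auto simp: l1_system_def)
  then show "norm (p - q) \<le> 2" using norm_triangle_ineq4[of p q] by linarith
qed simp

section \<open>Lower bounds for the moduli\<close>

lemma le_ennreal_divide:
  assumes "ennreal (e * d') \<le> x" "0 < d" "d \<le> d'" "0 \<le> e"
  shows "ennreal e \<le> x / ennreal d"
proof -
  have "e * d \<le> e * d'" using assms by (intro mult_left_mono) auto
  then have "ennreal (e * d) \<le> x" using assms(1) ennreal_leI order_trans by blast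
  then have "ennreal (e * d) / ennreal d \<le> x / ennreal d" by (rule divide_right_mono_ennreal)
  moreover have "ennreal (e * d) / ennreal d = ennreal e" using assms by (simp add: divide_ennreal)
  ultimately show ?thesis by simp
qed

lemma le_set_edist: "(\<And>a b. a \<in> A \<Longrightarrow> b \<in> B \<Longrightarrow> d \<le> dist a b) \<Longrightarrow> ennreal d \<le> set_edist A B"
  unfolding set_edist_def by (intro INF_greatest ennreal_leI) auto

lemma set_edist_less:
  assumes "set_edist A B < ennreal d"
  obtains a b where "a \<in> A" "b \<in> B" "dist a b < d"
proof -
  obtain a b where "a \<in> A" "b \<in> B" "ennreal (dist a b) < ennreal d"
    using assms unfolding set_edist_def by (auto simp: INF_less_iff)
  then show ?thesis using that by (simp add: ennreal_less_iff)
qed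

text \<open>The barycentre of \<open>2 * k\<close> basis vectors has at least half of its mass on
  vectors that a combination of at most \<open>k\<close> of them does not use. This gives distance
  \<open>1/4\<close> and, as the diameter is at most 2, the ratio \<open>1/8\<close>.\<close>

lemma B_convex_if_Car:
  assumes "(\<lambda>k. Car (X :: 'a::real_normed_vector itself) k) \<longlonglongrightarrow> 0"
  shows "B_convex X"
proof (rule ccontr)
  assume nB: "\<not> B_convex X"
  have "\<forall>\<^sub>F k in sequentially. Car X k < ennreal (1/8)"
    by (rule order_tendstoD(2)[OF assms], rule ennreal_less_zero_iff[THEN iffD2]) simp
  then obtain K where K: "\<And>k. K \<le> k \<Longrightarrow> Car X k < ennreal (1/8)" unfolding eventually_sequentially by blast
  define k where "k = Suc K"
  define J where "J = {..<2 * k}"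
  obtain x :: "nat \<Rightarrow> 'a" where l1: "l1_system J x"
    using not_B_convex_l1_system[OF nB, of J] by (auto simp: J_def)
  define P where "P = x ` J"
  have cP: "card P = 2 * k" unfolding P_def card_image[OF l1_system_inj_on[OF l1]] by (simp add: J_def)
  have P: "finite P" "0 < diameter P"
    using cP by (auto simp: P_def J_def k_def intro!: diameter_pos)
  have dP: "diameter P \<le> 2" using l1_system_diameter_le[OF l1] by (simp add: P_def)
  define a where "a = (1 / real (card J)) *\<^sub>R (\<Sum>i\<in>J. x i)"
  have a: "a \<in> convex hull P"
    unfolding a_def by (rule mean_in_convex_hull) (auto simp: J_def P_def k_def)
  have far: "1/4 \<le> dist a b" if b: "b \<in> conv_k k P" for b
  proof -
    obtain s l z where s: "1 \<le> s" "s \<le> k" and z: "\<forall>i\<in>{1..s}. z i \<in> P \<and> 0 \<le> l i" "(\<Sum>i=1..s. l i) = 1"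
      and beq: "b = (\<Sum>i=1..s. l i *\<^sub>R z i)"
      using b unfolding conv_k_def by blast
    have "\<forall>i\<in>{1..s}. \<exists>j\<in>J. z i = x j" using z(1) by (auto simp: P_def)
    then obtain \<pi> where \<pi>: "\<And>i. i \<in> {1..s} \<Longrightarrow> \<pi> i \<in> J" "\<And>i. i \<in> {1..s} \<Longrightarrow> z i = x (\<pi> i)" by metis
    define I where "I = \<pi> ` {1..s}"
    have I: "I \<subseteq> J" "finite I" using \<pi>(1) by (auto simp: I_def)
    have "card I \<le> card {1..s}" unfolding I_def by (rule card_image_le) simp
    then have cI: "card I \<le> k" using s by simp
    have "b \<in> convex hull (x ` I)"
      unfolding beq
      by (rule convex_sum) (use z \<pi> in \<open>auto simp: I_def intro!: hull_inc\<close>)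
    then obtain c where c: "\<forall>i. i \<notin> I \<longrightarrow> c i = 0" "b = (\<Sum>i\<in>J. c i *\<^sub>R x i)"
      using l1_system_hull[OF l1 I(1)] by blast
    have aeq: "a = (\<Sum>i\<in>J. (1 / real (2 * k)) *\<^sub>R x i)" by (simp add: a_def J_def scaleR_sum_right)
    have "1/2 = real k * (1 / real (2 * k))" by (simp add: k_def)
    also have "\<dots> \<le> real (card (J - I)) * (1 / real (2 * k))"
    proof (rule mult_right_mono)
      have "card (J - I) = 2 * k - card I" using I by (simp add: card_Diff_subset J_def)
      then show "real k \<le> real (card (J - I))" using cI by simp
    qed simp
    also have "\<dots> = (\<Sum>i\<in>J - I. \<bar>1 / real (2 * k) - c i\<bar>)" by (simp add: c(1))
    also have "\<dots> \<le> (\<Sum>i\<in>J. \<bar>1 / real (2 * k) - c i\<bar>)" by (rule sum_mono2) (auto simp: J_def)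
    also have "\<dots> \<le> 2 * dist a b" by (rule l1_system_coeff_dist[OF l1 aeq c(2)])
    finally show ?thesis by simp
  qed
  have "ennreal (1/8) \<le> set_edist {a} (conv_k k P) / ennreal (diameter P)"
    by (rule le_ennreal_divide[where d' = 2]) (use far P dP in \<open>auto intro!: le_set_edist\<close>)
  also have "\<dots> \<le> Car X k"
    unfolding Car_def by (intro SUP_upper2[of P] SUP_upper2[OF a]) (use P finite_imp_bounded in auto)
  also have "\<dots> < ennreal (1/8)" by (rule K) (simp add: k_def)
  finally show False by simp
qed

lemma l1_system_dist_hulls_subsets:
  assumes l1: "l1_system J x" and "A \<subseteq> x ` J" "B \<subseteq> x ` J" "A \<inter> B = {}"
    and "p \<in> convex hull A" "q \<in> convex hull B"
  shows "1 \<le> dist p q"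
proof -
  define I I' where "I = {i \<in> J. x i \<in> A}" and "I' = {i \<in> J. x i \<in> B}"
  have "A = x ` I" "B = x ` I'" using assms(2,3) by (auto simp: I_def I'_def)
  then show ?thesis
    using assms(4-6) by (intro l1_system_dist_hulls[OF l1, of I I']) (auto simp: I_def I'_def)
qed

text \<open>One class of \<open>2 * n\<close> basis vectors already fails: \<open>n * r\<close>
  tends to infinity along \<open>r = 1\<close>, and the two sides of a split have disjoint
  supports.\<close>

lemma B_convex_if_Radon:
  assumes "((\<lambda>(n, r). Radon (X :: 'a::real_normed_vector itself) n r) \<longlongrightarrow> 0) (filtercomap (\<lambda>(n, r). n * r) at_top)"
  shows "B_convex X"
proof (rule ccontr)
  assume nB: "\<not> B_convex X"
  have "\<forall>\<^sub>F z in filtercomap (\<lambda>(n, r). n * r) at_top. (\<lambda>(n, r). Radon X n r) z < ennreal (1/2)"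
    by (rule order_tendstoD(2)[OF assms], rule ennreal_less_zero_iff[THEN iffD2]) simp
  then obtain Q :: "nat \<Rightarrow> bool" where Q: "eventually Q at_top"
    "\<And>n r. Q (n * r) \<Longrightarrow> Radon X n r < ennreal (1/2)"
    unfolding eventually_filtercomap by auto
  then obtain N where N: "\<And>n. N \<le> n \<Longrightarrow> Q n" unfolding eventually_at_top_linorder by blast
  define n where "n = Suc N"
  define J where "J = {..<2 * n}"
  obtain x :: "nat \<Rightarrow> 'a" where l1: "l1_system J x"
    using not_B_convex_l1_system[OF nB, of J] by (auto simp: J_def)
  define P where "P = x ` J"
  define Z where "Z = (\<lambda>_::nat. P)"
  have cP: "card P = 2 * n" unfolding P_def card_image[OF l1_system_inj_on[OF l1]] by (simp add: J_def)
  have fP: "finite P" by (simp add: P_def J_def)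
  have Z: "Z \<in> colour_classes 1 (2 * n)"
    by (auto simp: colour_classes_def Z_def cP fP disjoint_family_on_def)
  have mx: "max_diameter 1 Z = diameter P" by (simp add: max_diameter_def Z_def)
  have P: "0 < diameter P" using cP fP by (intro diameter_pos) (auto simp: n_def)
  have dP: "diameter P \<le> 2" using l1_system_diameter_le[OF l1] by (simp add: P_def)
  have "ennreal (1/2) \<le> (INF (Q0, Q1)\<in>balanced_splits n 1 Z.
       set_edist (convex hull Q0) (convex hull Q1) / ennreal (max_diameter 1 Z))"
  proof (rule INF_greatest, clarify)
    fix Q0 Q1 assume "(Q0, Q1) \<in> balanced_splits n 1 Z"
    then have Q01: "Q0 \<union> Q1 = P" "Q0 \<inter> Q1 = {}" by (auto simp: balanced_splits_def Z_def)
    have sub: "Q0 \<subseteq> x ` J" "Q1 \<subseteq> x ` J" using Q01(1) by (auto simp: P_def)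
    have "ennreal (1/2 * 2) \<le> set_edist (convex hull Q0) (convex hull Q1)"
      by (rule le_set_edist) (use l1_system_dist_hulls_subsets[OF l1 sub Q01(2)] in simp)
    then show "ennreal (1/2) \<le> set_edist (convex hull Q0) (convex hull Q1) / ennreal (max_diameter 1 Z)"
      unfolding mx by (rule le_ennreal_divide) (use P dP in auto)
  qed
  also have "\<dots> \<le> Radon X n 1" unfolding Radon_def by (intro SUP_upper Z)
  also have "\<dots> < ennreal (1/2)" by (rule Q(2), rule N) (simp add: n_def)
  finally show False by simp
qed

text \<open>Two parts already fail: their hulls are at distance at least 1, so no point is within
  less than \<open>1/2\<close> of both, while the diameters are at most 2.\<close>

lemma B_convex_if_Tv:
  assumes "(\<lambda>r. Tv (X :: 'a::real_normed_vector itself) r 2) \<longlonglongrightarrow> 0"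
  shows "B_convex X"
proof (rule ccontr)
  assume nB: "\<not> B_convex X"
  have "\<forall>\<^sub>F r in sequentially. Tv X r 2 < ennreal (1/4)"
    by (rule order_tendstoD(2)[OF assms], rule ennreal_less_zero_iff[THEN iffD2]) simp
  then obtain R where R: "\<And>r. R \<le> r \<Longrightarrow> Tv X r 2 < ennreal (1/4)" unfolding eventually_sequentially by blast
  define r where "r = Suc R"
  define J where "J = {1..r} \<times> {..<2::nat}"
  obtain x :: "nat \<times> nat \<Rightarrow> 'a" where l1: "l1_system J x"
    using not_B_convex_l1_system[OF nB, of J] by (auto simp: J_def)
  have inj: "inj_on x J" by (rule l1_system_inj_on[OF l1])
  define Z where "Z j = x ` ({j} \<times> {..<2})" for j
  have ZJ: "Z j \<subseteq> x ` J" if "j \<in> {1..r}" for j using that by (auto simp: Z_def J_def)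
  have Z: "Z \<in> colour_classes r 2"
    unfolding colour_classes_def
  proof (intro CollectI conjI ballI)
    show "disjoint_family_on Z {1..r}"
      unfolding disjoint_family_on_def
    proof (intro ballI impI)
      fix i j assume ij: "i \<in> {1..r}" "j \<in> {1..r}" "i \<noteq> j"
      have "Z i \<inter> Z j = x ` (({i} \<times> {..<2}) \<inter> ({j} \<times> {..<2}))"
        unfolding Z_def by (rule inj_on_image_Int[OF inj, symmetric]) (use ij in \<open>auto simp: J_def\<close>)
      then show "Z i \<inter> Z j = {}" using ij by auto
    qed
    fix j assume j: "j \<in> {1..r}"
    show "finite (Z j)" by (simp add: Z_def)
    have "inj_on x ({j} \<times> {..<2})" by (rule inj_on_subset[OF inj]) (use j in \<open>auto simp: J_def\<close>)
    then show "card (Z j) = 2" by (simp add: Z_def card_image)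
  qed
  have D0: "0 < max_diameter r Z" by (rule max_diameter_pos[OF Z]) (auto simp: r_def)
  have D2: "max_diameter r Z \<le> 2"
    unfolding max_diameter_def
    by (subst Max_le_iff) (use l1_system_diameter_le[OF l1 ZJ] in \<open>auto simp: r_def\<close>)
  have "ennreal (1/4) \<le> (INF x. INF S\<in>colourful_partitions r 2 Z.
       (MAX i\<in>{1..2}. set_edist {x} (convex hull (S i))) / ennreal (max_diameter r Z))"
  proof (intro INF_greatest)
    fix y S assume "S \<in> colourful_partitions r 2 Z"
    then have S: "(\<Union>i\<in>{1..2}. S i) = (\<Union>j\<in>{1..r}. Z j)" "disjoint_family_on S {1..2}"
      by (auto simp: colourful_partitions_def)
    define M where "M = (MAX i\<in>{1..2}. set_edist {y} (convex hull (S i)))"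
    have SJ: "S i \<subseteq> x ` J" if "i \<in> {1..2}" for i
    proof -
      have "S i \<subseteq> (\<Union>j\<in>{1..r}. Z j)" using S(1) that by blast
      then show ?thesis using ZJ by blast
    qed
    have disj: "S 1 \<inter> S 2 = {}" using S(2) by (simp add: disjoint_family_on_def)
    have "ennreal (1/4 * 2) \<le> M"
    proof (rule ccontr)
      assume "\<not> ennreal (1/4 * 2) \<le> M"
      then have M: "M < ennreal (1/2)" by simp
      have near: "\<exists>p\<in>convex hull (S i). dist y p < 1/2" if i: "i \<in> {1..2}" for i
      proof -
        have "set_edist {y} (convex hull (S i)) \<le> M" unfolding M_def using i by (intro Max_ge) auto
        then have "set_edist {y} (convex hull (S i)) < ennreal (1/2)" using M by (rule le_less_trans)
        then show ?thesis by (rule set_edist_less) auto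
      qed
      obtain p where p: "p \<in> convex hull (S 1)" "dist y p < 1/2" using near[of 1] by auto
      obtain q where q: "q \<in> convex hull (S 2)" "dist y q < 1/2" using near[of 2] by auto
      have "1 \<le> dist p q"
        by (rule l1_system_dist_hulls_subsets[OF l1 SJ SJ disj p(1) q(1)]) auto
      also have "\<dots> \<le> dist y p + dist y q" by (rule dist_triangle3)
      finally show False using p q by simp
    qed
    then show "ennreal (1/4) \<le> M / ennreal (max_diameter r Z)"
      by (rule le_ennreal_divide) (use D0 D2 in auto)
  qed
  also have "\<dots> \<le> Tv X r 2" unfolding Tv_def by (intro SUP_upper Z)
  also have "\<dots> < ennreal (1/4)" by (rule R) (simp add: r_def)
  finally show False by simp
qed

text \<open>The sets whose convex hull is close to a given point pairwise intersect, so they are a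
  fraction of at most \<open>r\<^sup>2 / N\<close> of all \<open>r\<close>-subsets of an \<open>N\<close>-element set.\<close>

lemma B_convex_if_Sel:
  assumes \<theta>: "\<And>r. 0 < \<theta> r" and lim: "(\<lambda>r. Sel (X :: 'a::real_normed_vector itself) r (\<theta> r)) \<longlonglongrightarrow> 0"
  shows "B_convex X"
proof (rule ccontr)
  assume nB: "\<not> B_convex X"
  have "\<forall>\<^sub>F r in sequentially. Sel X r (\<theta> r) < ennreal (1/4)"
    by (rule order_tendstoD(2)[OF lim], rule ennreal_less_zero_iff[THEN iffD2]) simp
  then obtain R where R: "\<And>r. R \<le> r \<Longrightarrow> Sel X r (\<theta> r) < ennreal (1/4)" unfolding eventually_sequentially by blast
  define r where "r = Suc R"
  \<comment> \<open>\<open>N\<close> has to push the fraction \<open>r * r / N\<close> below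
    \<open>\<theta> r\<close>.\<close>
  obtain N0 where N0: "real (r * r) / \<theta> r < real N0" using reals_Archimedean2 by blast
  define N where "N = max (max r 2) N0"
  have "real (r * r) / \<theta> r < real N" using N0 by (simp add: N_def less_le_trans)
  then have N: "real (r * r) < \<theta> r * real N" "r \<le> N" "2 \<le> N"
    using \<theta>[of r] by (auto simp: pos_divide_less_eq mult.commute N_def)
  define J where "J = {..<N}"
  obtain x :: "nat \<Rightarrow> 'a" where l1: "l1_system J x"
    using not_B_convex_l1_system[OF nB, of J] by (auto simp: J_def)
  define P where "P = x ` J"
  have cP: "card P = N" unfolding P_def card_image[OF l1_system_inj_on[OF l1]] by (simp add: J_def)
  have P: "finite P" "0 < diameter P"
    using cP N by (auto simp: P_def J_def intro!: diameter_pos)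
  have dP: "diameter P \<le> 2" using l1_system_diameter_le[OF l1] by (simp add: P_def)
  have "Sel X r (\<theta> r) < ennreal (1/4)" by (rule R) (simp add: r_def)
  moreover have "P \<in> {P :: 'a set. finite P \<and> r \<le> card P \<and> 0 < diameter P}" using P cP N by simp
  ultimately have "(INF x. INF \<alpha>\<in>{\<alpha>::real. 0 < \<alpha> \<and> \<theta> r * real (card P choose r)
         \<le> real (card {A. A \<subseteq> P \<and> card A = r \<and> convex hull A \<inter> cball x (\<alpha> * diameter P) \<noteq> {}})}.
       ennreal \<alpha>) < ennreal (1/4)"
    unfolding Sel_def by (meson SUP_upper le_less_trans)
  then obtain y \<alpha> where \<alpha>: "0 < \<alpha>" "ennreal \<alpha> < ennreal (1/4)" and
    many: "\<theta> r * real (card P choose r)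
         \<le> real (card {A. A \<subseteq> P \<and> card A = r \<and> convex hull A \<inter> cball y (\<alpha> * diameter P) \<noteq> {}})"
    unfolding INF_less_iff by auto
  have "\<alpha> < 1/4" using \<alpha> by (simp add: ennreal_less_iff)
  define \<A> where "\<A> = {A. A \<subseteq> P \<and> card A = r \<and> convex hull A \<inter> cball y (\<alpha> * diameter P) \<noteq> {}}"
  have bpos: "0 < N choose r" using N by simp
  \<comment> \<open>Disjoint sets have hulls at distance at least 1, but each hull comes within
    \<open>\<alpha> * diameter P < 1/2\<close> of \<open>y\<close>.\<close>
  have meet: "A \<inter> B \<noteq> {}" if A: "A \<in> \<A>" and B: "B \<in> \<A>" for A B
  proof
    assume "A \<inter> B = {}"
    obtain p where p: "p \<in> convex hull A" "dist y p \<le> \<alpha> * diameter P" using A by (auto simp: \<A>_def)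
    obtain q where q: "q \<in> convex hull B" "dist y q \<le> \<alpha> * diameter P" using B by (auto simp: \<A>_def)
    have "1 \<le> dist p q"
      by (rule l1_system_dist_hulls_subsets[OF l1 _ _ \<open>A \<inter> B = {}\<close> p(1) q(1)])
         (use A B in \<open>auto simp: \<A>_def P_def\<close>)
    also have "\<dots> \<le> dist y p + dist y q" by (rule dist_triangle3)
    also have "\<dots> \<le> 2 * (\<alpha> * diameter P)" using p q by simp
    also have "\<alpha> * diameter P \<le> \<alpha> * 2" using \<alpha>(1) dP by (intro mult_left_mono) auto
    finally show False using \<open>\<alpha> < 1/4\<close> by simp
  qed
  have "\<A> \<noteq> {}"
  proof
    assume "\<A> = {}"
    then have "\<theta> r * real (N choose r) \<le> 0" using many unfolding \<A>_def[symmetric] cP by simp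
    then show False using bpos \<theta>[of r] by (simp add: mult_le_0_iff not_le)
  qed
  then obtain A where A: "A \<in> \<A>" by blast
  have fA: "finite A" "card A = r" "A \<subseteq> P" using A P(1) finite_subset by (auto simp: \<A>_def)
  \<comment> \<open>With one member \<open>A\<close> fixed, every member contains one of its
    \<open>r\<close> points, and each point lies in \<open>(N - 1) choose (r - 1)\<close>
    candidates.\<close>
  have "\<A> \<subseteq> (\<Union>a\<in>A. insert a ` {B. B \<subseteq> P - {a} \<and> card B = r - 1})"
  proof
    fix B assume B: "B \<in> \<A>"
    then obtain a where a: "a \<in> A" "a \<in> B" using meet[OF A B] by blast
    have "B \<subseteq> P" "card B = r" using B by (auto simp: \<A>_def)
    moreover have "finite B" using \<open>B \<subseteq> P\<close> P(1) finite_subset by blast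
    ultimately have "B = insert a (B - {a})" "B - {a} \<subseteq> P - {a}" "card (B - {a}) = r - 1" using a by auto
    then show "B \<in> (\<Union>a\<in>A. insert a ` {B. B \<subseteq> P - {a} \<and> card B = r - 1})" using a(1) by blast
  qed
  then have "card \<A> \<le> card (\<Union>a\<in>A. insert a ` {B. B \<subseteq> P - {a} \<and> card B = r - 1})"
    by (rule card_mono[rotated]) (use fA P(1) in auto)
  also have "\<dots> \<le> (\<Sum>a\<in>A. card (insert a ` {B. B \<subseteq> P - {a} \<and> card B = r - 1}))"
    by (rule card_UN_le[OF fA(1)])
  also have "\<dots> \<le> (\<Sum>a\<in>A. (N - 1) choose (r - 1))"
  proof (rule sum_mono)
    fix a assume "a \<in> A"
    then have "card (P - {a}) = N - 1" using fA P cP by auto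
    then have "card {B. B \<subseteq> P - {a} \<and> card B = r - 1} = (N - 1) choose (r - 1)"
      using n_subsets[of "P - {a}" "r - 1"] P(1) by simp
    then show "card (insert a ` {B. B \<subseteq> P - {a} \<and> card B = r - 1}) \<le> (N - 1) choose (r - 1)"
      using card_image_le[of "{B. B \<subseteq> P - {a} \<and> card B = r - 1}" "insert a"] P(1) by simp
  qed
  also have "\<dots> = r * ((N - 1) choose (r - 1))" using fA by simp
  finally have "card \<A> \<le> r * ((N - 1) choose (r - 1))" .
  then have "card \<A> * N \<le> r * (N * ((N - 1) choose (r - 1)))" by (simp add: mult_le_mono algebra_simps)
  also have "N * ((N - 1) choose (r - 1)) = r * (N choose r)"
    using times_binomial_minus1_eq[of r N] by (simp add: r_def)
  finally have "real (card \<A> * N) \<le> real (r * (r * (N choose r)))" by (rule of_nat_mono)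
  moreover have "\<theta> r * real (N choose r) * real N \<le> real (card \<A>) * real N"
    using many unfolding \<A>_def[symmetric] cP by (intro mult_right_mono) auto
  ultimately have "(\<theta> r * real N) * real (N choose r) \<le> real (r * r) * real (N choose r)"
    by (simp add: algebra_simps)
  then show False using N(1) bpos by simp
qed

text \<open>The signs are chosen one by one: by the parallelogram identity the two options for a new
  sign average to the old sum of squares plus the new squares, so one option does not exceed it. All
  \<open>f\<close> in \<open>F\<close> are served together because only the total over
  \<open>F\<close> is controlled.\<close>

lemma exists_signs_small_sums:
  fixes b :: "'f \<Rightarrow> 'i \<Rightarrow> real"
  assumes "finite J"
  shows "\<exists>\<epsilon>. (\<forall>i. \<epsilon> i = 1 \<or> \<epsilon> i = -1) \<and>
    (\<Sum>f\<in>F. (\<Sum>i\<in>J. \<epsilon> i * b f i)\<^sup>2) \<le> (\<Sum>f\<in>F. \<Sum>i\<in>J. (b f i)\<^sup>2)"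
  using assms
proof (induction J)
  case empty
  show ?case by (intro exI[of _ "\<lambda>_. 1"]) auto
next
  case (insert k J)
  then obtain \<epsilon> where \<epsilon>: "\<forall>i. \<epsilon> i = 1 \<or> \<epsilon> i = -1"
    and le: "(\<Sum>f\<in>F. (\<Sum>i\<in>J. \<epsilon> i * b f i)\<^sup>2) \<le> (\<Sum>f\<in>F. \<Sum>i\<in>J. (b f i)\<^sup>2)" by blast
  define s where "s f = (\<Sum>i\<in>J. \<epsilon> i * b f i)" for f
  have upd: "(\<Sum>i\<in>insert k J. (\<epsilon>(k := t)) i * b f i) = s f + t * b f k" for t f
  proof -
    have "(\<Sum>i\<in>J. (\<epsilon>(k := t)) i * b f i) = s f"
      unfolding s_def by (rule sum.cong) (use insert in auto)
    then show ?thesis using insert by simp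
  qed
  have "(\<Sum>f\<in>F. (s f + b f k)\<^sup>2) + (\<Sum>f\<in>F. (s f - b f k)\<^sup>2) = 2 * ((\<Sum>f\<in>F. (s f)\<^sup>2) + (\<Sum>f\<in>F. (b f k)\<^sup>2))"
    unfolding sum.distrib[symmetric] sum_distrib_left
    by (rule sum.cong) (auto simp: power2_eq_square algebra_simps)
  then have "(\<Sum>f\<in>F. (s f + 1 * b f k)\<^sup>2) \<le> (\<Sum>f\<in>F. (s f)\<^sup>2) + (\<Sum>f\<in>F. (b f k)\<^sup>2) \<or>
      (\<Sum>f\<in>F. (s f + (-1) * b f k)\<^sup>2) \<le> (\<Sum>f\<in>F. (s f)\<^sup>2) + (\<Sum>f\<in>F. (b f k)\<^sup>2)"
    by simp linarith
  then obtain t :: real where t: "t = 1 \<or> t = -1"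
    "(\<Sum>f\<in>F. (s f + t * b f k)\<^sup>2) \<le> (\<Sum>f\<in>F. (s f)\<^sup>2) + (\<Sum>f\<in>F. (b f k)\<^sup>2)" by blast
  have "(\<Sum>f\<in>F. (\<Sum>i\<in>insert k J. (\<epsilon>(k := t)) i * b f i)\<^sup>2) \<le> (\<Sum>f\<in>F. (s f)\<^sup>2) + (\<Sum>f\<in>F. (b f k)\<^sup>2)"
    unfolding upd by (rule t(2))
  also have "\<dots> \<le> (\<Sum>f\<in>F. \<Sum>i\<in>J. (b f i)\<^sup>2) + (\<Sum>f\<in>F. (b f k)\<^sup>2)" using le by (simp add: s_def)
  also have "\<dots> = (\<Sum>f\<in>F. \<Sum>i\<in>insert k J. (b f i)\<^sup>2)" using insert by (simp add: sum.distrib)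
  finally show ?case using \<epsilon> t(1) by (intro exI[of _ "\<epsilon>(k := t)"]) auto
qed

text \<open>After the atoms of mass above \<open>1 / L\<close> are removed, signs with small signed sums split the
  remaining points into two parts, each of mass at most \<open>3/4\<close> under every \<open>b f\<close>.\<close>

lemma exists_large_set_of_small_mass:
  fixes b :: "'f \<Rightarrow> 'i \<Rightarrow> real"
  assumes fin: "finite J" "finite F" and M: "card F \<le> M" and large: "2 * M * (4 * (M + 1)) \<le> card J"
    and b: "\<And>f i. 0 \<le> b f i" "\<And>f. (\<Sum>i\<in>J. b f i) \<le> 1"
  obtains I where "I \<subseteq> J" "card J \<le> 4 * card I" "\<And>f. f \<in> F \<Longrightarrow> (\<Sum>i\<in>I. b f i) \<le> 3/4"
proof -
  \<comment> \<open>Chosen so that \<open>card F / L \<le> 1/4\<close>; this caps the total of the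
    squared signed sums, hence each signed sum by \<open>1/2\<close>.\<close>
  define L where "L = 4 * (M + 1)"
  have L: "0 < L" by (simp add: L_def)
  define H where "H f = {i \<in> J. 1 / real L < b f i}" for f
  have H: "card (H f) \<le> L" for f
  proof -
    have "real (card (H f)) * (1 / real L) \<le> (\<Sum>i\<in>H f. b f i)"
      by (rule sum_bounded_below) (auto simp: H_def)
    also have "\<dots> \<le> (\<Sum>i\<in>J. b f i)" using fin b by (intro sum_mono2) (auto simp: H_def)
    also have "\<dots> \<le> 1" by (rule b)
    finally have "real (card (H f)) \<le> real L" using L by (simp add: pos_divide_le_eq)
    then show ?thesis by simp
  qed
  define J' where "J' = J - (\<Union>f\<in>F. H f)"
  have "card (\<Union>f\<in>F. H f) \<le> (\<Sum>f\<in>F. card (H f))" by (rule card_UN_le[OF fin(2)])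
  also have "\<dots> \<le> card F * L" using sum_bounded_above[of F "\<lambda>f. card (H f)" L] H by simp
  also have "\<dots> \<le> M * L" using M by (rule mult_le_mono1)
  finally have "card (\<Union>f\<in>F. H f) \<le> M * L" .
  moreover have "card J - card (\<Union>f\<in>F. H f) \<le> card J'"
    unfolding J'_def by (rule diff_card_le_card_Diff) (use fin in \<open>auto simp: H_def\<close>)
  moreover have "2 * (M * L) \<le> card J" using large by (simp add: L_def mult.assoc)
  \<comment> \<open>At most \<open>M * L\<close> atoms are removed, and \<open>large\<close> makes
    this at most half of \<open>J\<close>.\<close>
  ultimately have cJ': "card J \<le> 2 * card J'" by linarith
  have J': "finite J'" "J' \<subseteq> J" using fin by (auto simp: J'_def)
  obtain \<epsilon> where \<epsilon>: "\<forall>i. \<epsilon> i = 1 \<or> \<epsilon> i = -1"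
    and le: "(\<Sum>f\<in>F. (\<Sum>i\<in>J'. \<epsilon> i * b f i)\<^sup>2) \<le> (\<Sum>f\<in>F. \<Sum>i\<in>J'. (b f i)\<^sup>2)"
    using exists_signs_small_sums[OF J'(1)] by blast
  have "(\<Sum>f\<in>F. \<Sum>i\<in>J'. (b f i)\<^sup>2) \<le> (\<Sum>f\<in>F. 1 / real L)"
  proof (rule sum_mono)
    fix f assume f: "f \<in> F"
    have "(\<Sum>i\<in>J'. (b f i)\<^sup>2) \<le> (\<Sum>i\<in>J'. (1 / real L) * b f i)"
    proof (rule sum_mono)
      fix i assume "i \<in> J'"
      then have "b f i \<le> 1 / real L" using f by (auto simp: J'_def H_def)
      then show "(b f i)\<^sup>2 \<le> (1 / real L) * b f i"
        unfolding power2_eq_square using b(1) by (rule mult_right_mono)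
    qed
    also have "\<dots> = (1 / real L) * (\<Sum>i\<in>J'. b f i)" by (simp add: sum_distrib_left)
    also have "\<dots> \<le> (1 / real L) * 1"
    proof (rule mult_left_mono)
      have "(\<Sum>i\<in>J'. b f i) \<le> (\<Sum>i\<in>J. b f i)" using fin b J' by (intro sum_mono2) auto
      then show "(\<Sum>i\<in>J'. b f i) \<le> 1" using b(2)[of f] by linarith
    qed simp
    finally show "(\<Sum>i\<in>J'. (b f i)\<^sup>2) \<le> 1 / real L" by simp
  qed
  also have "\<dots> = real (card F) / real L" by simp
  also have "\<dots> \<le> 1/4" using M by (simp add: L_def field_simps)
  finally have total: "(\<Sum>f\<in>F. (\<Sum>i\<in>J'. \<epsilon> i * b f i)\<^sup>2) \<le> 1/4" using le by linarith
  have small: "\<bar>\<Sum>i\<in>J'. \<epsilon> i * b f i\<bar> \<le> 1/2" if f: "f \<in> F" for f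
  proof -
    have "(\<Sum>i\<in>J'. \<epsilon> i * b f i)\<^sup>2 \<le> (\<Sum>f\<in>F. (\<Sum>i\<in>J'. \<epsilon> i * b f i)\<^sup>2)"
      using fin f by (intro member_le_sum) auto
    also have "\<dots> \<le> (1/2)\<^sup>2" using total by (simp add: power2_eq_square)
    finally show ?thesis by (simp only: abs_le_square_iff[symmetric])
  qed
  define I where "I s = {i \<in> J'. \<epsilon> i = s}" for s
  have fI: "finite (I s)" for s using J' by (simp add: I_def)
  have split: "J' = I 1 \<union> I (-1)" using \<epsilon> by (auto simp: I_def)
  have "I 1 \<inter> I (-1) = {}" by (auto simp: I_def)
  then have "card J' = card (I 1) + card (I (-1))"
    unfolding split by (rule card_Un_disjoint[OF fI fI])
  then have "card J' \<le> 2 * card (I 1) \<or> card J' \<le> 2 * card (I (-1))" by linarith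
  then obtain s :: real where s: "s = 1 \<or> s = -1" "card J' \<le> 2 * card (I s)" by blast
  show ?thesis
  proof (rule that[of "I s"])
    show "I s \<subseteq> J" using J' by (auto simp: I_def)
    show "card J \<le> 4 * card (I s)" using cJ' s(2) by linarith
    fix f assume f: "f \<in> F"
    \<comment> \<open>A part carries half of the mass plus or minus half of the signed sum, so at
      most \<open>(1 + 1/2) / 2\<close>.\<close>
    have "2 * (\<Sum>i\<in>I s. b f i) = (\<Sum>i\<in>J'. if \<epsilon> i = s then 2 * b f i else 0)"
      unfolding I_def sum_distrib_left using J'(1) by (simp add: sum.inter_filter)
    also have "\<dots> = (\<Sum>i\<in>J'. b f i + s * (\<epsilon> i * b f i))"
    proof (rule sum.cong)
      fix i
      show "(if \<epsilon> i = s then 2 * b f i else 0) = b f i + s * (\<epsilon> i * b f i)"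
        using s(1) spec[OF \<epsilon>, of i] by auto
    qed simp
    also have "\<dots> = (\<Sum>i\<in>J'. b f i) + s * (\<Sum>i\<in>J'. \<epsilon> i * b f i)" by (simp add: sum.distrib sum_distrib_left)
    also have "s * (\<Sum>i\<in>J'. \<epsilon> i * b f i) \<le> 1/2" using s(1) small[OF f] by auto
    also have "(\<Sum>i\<in>J'. b f i) \<le> (\<Sum>i\<in>J. b f i)" using fin b J' by (intro sum_mono2) auto
    also have "\<dots> \<le> 1" by (rule b)
    finally show "(\<Sum>i\<in>I s. b f i) \<le> 3/4" by simp
  qed
qed

text \<open>\<open>q\<close> has a representation with mass 1 on \<open>I\<close>, and the l1
  estimate lets this mass change by at most \<open>2 * dist p q\<close> on the way to
  \<open>p\<close>.\<close>

lemma l1_system_mass_ge: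
  assumes l1: "l1_system J x" and I: "I \<subseteq> J" and p: "p = (\<Sum>i\<in>J. b i *\<^sub>R x i)" "(\<Sum>i\<in>J. b i) = 1"
    and q: "q \<in> convex hull (x ` I)"
  shows "1 - 2 * dist p q \<le> (\<Sum>i\<in>I. b i)"
proof -
  have fJ: "finite J" using l1 by (simp add: l1_system_def)
  obtain c where c: "q = (\<Sum>i\<in>J. c i *\<^sub>R x i)" "(\<Sum>i\<in>I. c i) = 1"
    using l1_system_hull[OF l1 I q] by blast
  have "1 - (\<Sum>i\<in>I. b i) = (\<Sum>i\<in>I. c i - b i)" using c(2) by (simp add: sum_subtractf)
  also have "\<dots> \<le> (\<Sum>i\<in>I. \<bar>b i - c i\<bar>)" by (rule sum_mono) auto
  also have "\<dots> \<le> (\<Sum>i\<in>J. \<bar>b i - c i\<bar>)" by (rule sum_mono2) (use fJ I in auto)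
  also have "\<dots> \<le> 2 * dist p q" by (rule l1_system_coeff_dist[OF l1 p(1) c(1)])
  finally show ?thesis by simp
qed

text \<open>Replace the net points by nearby probability vectors on \<open>J\<close>. By
  \<open>exists_large_set_of_small_mass\<close> a quarter of the points can be chosen on which all
  these vectors have mass at most \<open>3/4\<close>. A net point within \<open>1/25\<close> of the
  hull of that quarter would have its vector within \<open>2/25\<close> of the hull, hence mass
  above \<open>1 - 4/25\<close>, which exceeds \<open>3/4\<close>.\<close>

lemma B_convex_if_WeakNet:
  assumes "WeakNet (X :: 'a::real_normed_vector itself) (1/4) M \<le> ennreal (1/100)"
  shows "B_convex X"
proof (rule ccontr)
  assume nB: "\<not> B_convex X"
  \<comment> \<open>The first term is the size that \<open>exists_large_set_of_small_mass\<close>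
    asks for; the 2 makes the diameter positive even for \<open>M = 0\<close>.\<close>
  define N where "N = 2 * M * (4 * (M + 1)) + 2"
  define J where "J = {..<N}"
  obtain x :: "nat \<Rightarrow> 'a" where l1: "l1_system J x"
    using not_B_convex_l1_system[OF nB, of J] by (auto simp: J_def)
  have inj: "inj_on x J" by (rule l1_system_inj_on[OF l1])
  define P where "P = x ` J"
  have cP: "card P = N" unfolding P_def card_image[OF inj] by (simp add: J_def)
  have P: "finite P" "0 < diameter P"
    using cP by (auto simp: P_def J_def N_def intro!: diameter_pos)
  have dP: "diameter P \<le> 2" using l1_system_diameter_le[OF l1] by (simp add: P_def)
  \<comment> \<open>A strict bound lets the infimum and the supremum below yield witnesses.\<close>
  have lt: "WeakNet X (1/4) M < ennreal (1/50)"
    using assms by (rule le_less_trans) (simp add: ennreal_less_iff)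
  have Pin: "P \<in> {P :: 'a set. finite P \<and> 0 < diameter P}" using P by simp
  have "(INF F\<in>{F. finite F \<and> card F \<le> M}.
       SUP Y\<in>{Y. Y \<subseteq> P \<and> 1/4 * real (card P) \<le> real (card Y)}.
         set_edist F (convex hull Y) / ennreal (diameter P)) < ennreal (1/50)"
    by (rule SUP_lessD[OF lt[unfolded WeakNet_def] Pin])
  then obtain F where F: "finite F" "card F \<le> M"
    and sup: "(SUP Y\<in>{Y. Y \<subseteq> P \<and> 1/4 * real (card P) \<le> real (card Y)}.
         set_edist F (convex hull Y) / ennreal (diameter P)) < ennreal (1/50)"
    unfolding INF_less_iff by blast
  have near: "\<exists>f\<in>F. \<exists>q\<in>convex hull Y. dist f q < 1/25"
    if Y: "Y \<subseteq> P" "1/4 * real (card P) \<le> real (card Y)" for Y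
  proof -
    have "set_edist F (convex hull Y) / ennreal (diameter P) < ennreal (1/50)"
      by (rule SUP_lessD[OF sup]) (use Y in blast)
    then have "\<not> ennreal (1/50 * 2) \<le> set_edist F (convex hull Y)"
      using le_ennreal_divide[of "1/50" 2 "set_edist F (convex hull Y)" "diameter P"] P dP by force
    then have "set_edist F (convex hull Y) < ennreal (1/25)" by simp
    then show ?thesis by (rule set_edist_less) auto
  qed
  define good where "good f b \<longleftrightarrow> (\<forall>i. 0 \<le> b i) \<and> (\<Sum>i\<in>J. b i) = 1 \<and> dist f (\<Sum>i\<in>J. b i *\<^sub>R x i) < 1/25"
    for f b
  \<comment> \<open>A net point far from the hull of \<open>P\<close> is near no smaller hull
    either, so the zero vector serves as its default.\<close>
  define b where "b f = (if \<exists>b. good f b then SOME b. good f b else (\<lambda>_. 0))" for f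
  have b_good: "good f (b f)" if "good f c" for f c
    using that someI_ex[of "good f"] unfolding b_def by auto
  have b_cases: "good f (b f) \<or> b f = (\<lambda>_. 0)" for f
    using someI_ex[of "good f"] unfolding b_def by auto
  have b: "0 \<le> b f i" "(\<Sum>i\<in>J. b f i) \<le> 1" for f i
    using b_cases[of f] by (auto simp: good_def)
  obtain I where I: "I \<subseteq> J" "card J \<le> 4 * card I" "\<And>f. f \<in> F \<Longrightarrow> (\<Sum>i\<in>I. b f i) \<le> 3/4"
    by (rule exists_large_set_of_small_mass[of J F M b]) (use F b in \<open>auto simp: J_def N_def\<close>)
  have "card (x ` I) = card I" by (rule card_image) (rule inj_on_subset[OF inj I(1)])
  then have "1/4 * real (card P) \<le> real (card (x ` I))" using I(2) by (simp add: cP J_def)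
  then obtain f q where f: "f \<in> F" and q: "q \<in> convex hull (x ` I)" "dist f q < 1/25"
    using near[of "x ` I"] I(1) by (auto simp: P_def)
  obtain c where c: "\<forall>i. 0 \<le> c i" "(\<Sum>i\<in>J. c i) = 1" "q = (\<Sum>i\<in>J. c i *\<^sub>R x i)"
    using l1_system_hull[OF l1 I(1) q(1)] by blast
  have "good f c" using c q(2) by (simp add: good_def)
  then have g: "good f (b f)" by (rule b_good)
  define p where "p = (\<Sum>i\<in>J. b f i *\<^sub>R x i)"
  have "dist p q \<le> dist f p + dist f q" by (rule dist_triangle3)
  also have "\<dots> < 2/25" using g q(2) by (simp add: good_def p_def)
  finally have "dist p q < 2/25" .
  moreover have "1 - 2 * dist p q \<le> (\<Sum>i\<in>I. b f i)"
    by (rule l1_system_mass_ge[OF l1 I(1) p_def _ q(1)]) (use g in \<open>simp add: good_def\<close>)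
  ultimately show False using I(3)[OF f] by simp
qed

text \<open>Any \<open>k\<close> of the sets \<open>C j\<close> have a common vertex, but a point close to all of them would have
  mass at least \<open>3/4\<close> on each \<open>S j\<close>, whereas only half of the \<open>S j\<close> contain a given \<open>\<sigma>\<close>.\<close>

lemma B_convex_if_Helly:
  assumes "(\<lambda>k. Helly (X :: 'a::real_normed_vector itself) k) \<longlonglongrightarrow> 0"
  shows "B_convex X"
proof (rule ccontr)
  assume nB: "\<not> B_convex X"
  have "\<forall>\<^sub>F k in sequentially. Helly X k < ennreal (1/16)"
    by (rule order_tendstoD(2)[OF assms], rule ennreal_less_zero_iff[THEN iffD2]) simp
  then obtain K where K: "\<And>k. K \<le> k \<Longrightarrow> Helly X k < ennreal (1/16)" unfolding eventually_sequentially by blast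
  define k where "k = Suc K"
  define J where "J = {\<sigma>. \<sigma> \<subseteq> {..<2 * k} \<and> card \<sigma> = k}"
  have fJ: "finite J" unfolding J_def by simp
  obtain x :: "nat set \<Rightarrow> 'a" where l1: "l1_system J x"
    using not_B_convex_l1_system[OF nB fJ] by blast
  define S where "S j = {\<sigma> \<in> J. j \<in> \<sigma>}" for j
  have SJ: "S j \<subseteq> J" for j by (auto simp: S_def)
  define C where "C j = convex hull (x ` S j)" for j
  define \<F> where "\<F> = C ` {..<2 * k}"
  have "Helly X k < ennreal (1/16)" by (rule K) (simp add: k_def)
  then obtain \<alpha> where "ennreal \<alpha> < ennreal (1/16)" and
    H: "\<forall>\<F> :: 'a set set. finite \<F> \<longrightarrow> (\<forall>C\<in>\<F>. convex C \<and> C \<subseteq> cball 0 1) \<longrightarrow>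
        (\<forall>\<G>\<subseteq>\<F>. card \<G> \<le> k \<longrightarrow> \<Inter>\<G> \<noteq> {}) \<longrightarrow>
        (\<exists>x. \<forall>C\<in>\<F>. set_edist {x} C \<le> ennreal \<alpha>)"
    unfolding Helly_def INF_less_iff by blast
  have "\<exists>y. \<forall>C\<in>\<F>. set_edist {y} C \<le> ennreal \<alpha>"
  proof (rule H[rule_format])
    show "finite \<F>" by (simp add: \<F>_def)
    fix D assume "D \<in> \<F>"
    then obtain j where D: "D = C j" by (auto simp: \<F>_def)
    have "x ` S j \<subseteq> cball 0 1" using l1 SJ by (force simp: l1_system_def)
    then show "convex D \<and> D \<subseteq> cball 0 1"
      unfolding D C_def by (simp add: hull_minimal)
  next
    fix \<G> assume \<G>: "\<G> \<subseteq> \<F>" "card \<G> \<le> k"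
    \<comment> \<open>\<open>T\<close> lists each member of \<open>\<G>\<close> once, so
      \<open>card T = card \<G>\<close> even if some of the \<open>C j\<close> coincide.\<close>
    then obtain T where T: "T \<subseteq> {..<2 * k}" "inj_on C T" "\<G> = C ` T"
      unfolding \<F>_def subset_image_inj by blast
    then have "card T \<le> k" using \<G>(2) by (simp add: card_image)
    then obtain \<sigma> where \<sigma>: "T \<subseteq> \<sigma>" "\<sigma> \<subseteq> {..<2 * k}" "card \<sigma> = k"
      using exists_subset_between[of T k "{..<2 * k}"] T(1) by auto
    have "x \<sigma> \<in> C j" if "j \<in> T" for j
      unfolding C_def using \<sigma> that by (intro hull_inc) (auto simp: S_def J_def)
    then show "\<Inter>\<G> \<noteq> {}" using T(3) by blast
  qed
  then obtain y where y: "\<And>j. j < 2 * k \<Longrightarrow> set_edist {y} (C j) \<le> ennreal \<alpha>" by (auto simp: \<F>_def)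
  have near: "\<exists>q\<in>C j. dist y q < 1/16" if "j < 2 * k" for j
  proof -
    have "set_edist {y} (C j) < ennreal (1/16)" using y[OF that] \<open>ennreal \<alpha> < _\<close> by (rule le_less_trans)
    then show ?thesis by (rule set_edist_less) auto
  qed
  \<comment> \<open>\<open>y\<close> itself may lie outside the span of the system; the nearby point
    \<open>p\<close> of \<open>C 0\<close> has coefficients.\<close>
  obtain p where p: "p \<in> C 0" "dist y p < 1/16" using near[of 0] by (auto simp: k_def)
  obtain b where b: "(\<Sum>\<sigma>\<in>J. b \<sigma>) = 1" "p = (\<Sum>\<sigma>\<in>J. b \<sigma> *\<^sub>R x \<sigma>)"
    using l1_system_hull[OF l1 SJ p(1)[unfolded C_def]] by blast
  have mass: "3/4 \<le> (\<Sum>\<sigma>\<in>S j. b \<sigma>)" if j: "j < 2 * k" for j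
  proof -
    obtain q where q: "q \<in> C j" "dist y q < 1/16" using near[OF j] by blast
    have "dist p q \<le> dist y p + dist y q" by (rule dist_triangle3)
    also have "\<dots> < 1/8" using p q by simp
    finally have "dist p q < 1/8" .
    moreover have "1 - 2 * dist p q \<le> (\<Sum>\<sigma>\<in>S j. b \<sigma>)"
      by (rule l1_system_mass_ge[OF l1 SJ b(2,1) q(1)[unfolded C_def]])
    ultimately show ?thesis by simp
  qed
  \<comment> \<open>Double counting: each \<open>\<sigma>\<close> lies in \<open>k\<close> of the
    \<open>2 * k\<close> sets, so the masses add up to \<open>k\<close>, whereas \<open>mass\<close>
    demands \<open>3/2 * k\<close>.\<close>
  have "(\<Sum>j<2 * k. \<Sum>\<sigma>\<in>S j. b \<sigma>) = (\<Sum>j<2 * k. \<Sum>\<sigma>\<in>J. if j \<in> \<sigma> then b \<sigma> else 0)"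
    unfolding S_def using fJ by (simp add: sum.inter_filter)
  also have "\<dots> = (\<Sum>\<sigma>\<in>J. \<Sum>j<2 * k. if j \<in> \<sigma> then b \<sigma> else 0)" by (rule sum.swap)
  also have "\<dots> = (\<Sum>\<sigma>\<in>J. real k * b \<sigma>)"
  proof (rule sum.cong)
    fix \<sigma> assume "\<sigma> \<in> J"
    then have "{j \<in> {..<2 * k}. j \<in> \<sigma>} = \<sigma>" "card \<sigma> = k" by (auto simp: J_def)
    then show "(\<Sum>j<2 * k. if j \<in> \<sigma> then b \<sigma> else 0) = real k * b \<sigma>"
      by (simp flip: sum.inter_filter)
  qed simp
  also have "\<dots> = real k" using b(1) by (simp flip: sum_distrib_left)
  finally have "(\<Sum>j<2 * k. \<Sum>\<sigma>\<in>S j. b \<sigma>) = real k" .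
  moreover have "real (card {..<2 * k}) * (3/4) \<le> (\<Sum>j<2 * k. \<Sum>\<sigma>\<in>S j. b \<sigma>)"
    by (rule sum_bounded_below) (use mass in auto)
  ultimately show False by (simp add: k_def)
qed

theorem theorem1p1:
  fixes X :: "'a::banach itself"
  shows
    "(nontrivial_type X \<longleftrightarrow> nontrivial_infratype X) \<and>
     (nontrivial_type X \<longleftrightarrow> (\<lambda>k. Car X k) \<longlonglongrightarrow> 0) \<and>
     (nontrivial_type X \<longleftrightarrow>
        ((\<lambda>(n, r). Radon X n r) \<longlongrightarrow> 0) (filtercomap (\<lambda>(n, r). n * r) at_top)) \<and>
     (nontrivial_type X \<longleftrightarrow> (\<forall>k\<ge>2. (\<lambda>r. Tv X r k) \<longlonglongrightarrow> 0)) \<and>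
     (nontrivial_type X \<longleftrightarrow>
        (\<exists>\<theta> :: nat \<Rightarrow> real. (\<forall>r. 0 < \<theta> r \<and> \<theta> r < 1) \<and> (\<lambda>r. Sel X r (\<theta> r)) \<longlonglongrightarrow> 0)) \<and>
     (nontrivial_type X \<longleftrightarrow>
        (\<forall>\<epsilon>::real. 0 < \<epsilon> \<and> \<epsilon> < 1 \<longrightarrow>
           (\<forall>\<eta>::real. 0 < \<eta> \<longrightarrow> (\<exists>M::nat. WeakNet X \<epsilon> M \<le> ennreal \<eta>)))) \<and>
     (nontrivial_type X \<longleftrightarrow> (\<lambda>k. Helly X k) \<longlonglongrightarrow> 0)"
proof (unfold nontrivial_type_iff_B_convex nontrivial_infratype_iff_B_convex, intro conjI iffI)
  show "B_convex X \<Longrightarrow> (\<lambda>k. Car X k) \<longlonglongrightarrow> 0" by (rule Car_tendsto_zero_if_B_convex)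
  show "(\<lambda>k. Car X k) \<longlonglongrightarrow> 0 \<Longrightarrow> B_convex X" by (rule B_convex_if_Car)
  show "B_convex X \<Longrightarrow> ((\<lambda>(n, r). Radon X n r) \<longlongrightarrow> 0) (filtercomap (\<lambda>(n, r). n * r) at_top)"
    by (rule Radon_tendsto_zero_if_B_convex)
  show "((\<lambda>(n, r). Radon X n r) \<longlongrightarrow> 0) (filtercomap (\<lambda>(n, r). n * r) at_top) \<Longrightarrow> B_convex X"
    by (rule B_convex_if_Radon)
  show "B_convex X \<Longrightarrow> \<forall>k\<ge>2. (\<lambda>r. Tv X r k) \<longlonglongrightarrow> 0"
    by (intro allI impI Tv_tendsto_zero_if_B_convex)
  show "B_convex X" if "\<forall>k\<ge>2. (\<lambda>r. Tv X r k) \<longlonglongrightarrow> 0"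
    by (rule B_convex_if_Tv) (use that in blast)
  show "\<exists>\<theta> :: nat \<Rightarrow> real. (\<forall>r. 0 < \<theta> r \<and> \<theta> r < 1) \<and> (\<lambda>r. Sel X r (\<theta> r)) \<longlonglongrightarrow> 0" if "B_convex X"
  proof (intro exI[of _ "\<lambda>r. 1 / (2 * real r ^ r)"] conjI allI Sel_tendsto_zero_if_B_convex[OF that])
    fix r :: nat
    \<comment> \<open>At \<open>r = 0\<close> the convention \<open>0 ^ 0 = 1\<close> gives the
      fraction 1/2.\<close>
    have "1 \<le> real r ^ r" by (cases "r = 0") (auto intro: one_le_power)
    then have "1 < 2 * real r ^ r" by linarith
    moreover have "0 < 1 / x" "1 / x < 1" if "1 < x" for x :: real using that by auto
    ultimately show "0 < 1 / (2 * real r ^ r)" "1 / (2 * real r ^ r) < 1" by blast+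
  qed
  show "B_convex X" if "\<exists>\<theta> :: nat \<Rightarrow> real. (\<forall>r. 0 < \<theta> r \<and> \<theta> r < 1) \<and> (\<lambda>r. Sel X r (\<theta> r)) \<longlonglongrightarrow> 0"
    using that B_convex_if_Sel by blast
  show "\<forall>\<epsilon>::real. 0 < \<epsilon> \<and> \<epsilon> < 1 \<longrightarrow> (\<forall>\<eta>::real. 0 < \<eta> \<longrightarrow> (\<exists>M::nat. WeakNet X \<epsilon> M \<le> ennreal \<eta>))"
    if "B_convex X"
    using WeakNet_le_if_B_convex[OF that] by blast
  show "B_convex X"
    if net: "\<forall>\<epsilon>::real. 0 < \<epsilon> \<and> \<epsilon> < 1 \<longrightarrow> (\<forall>\<eta>::real. 0 < \<eta> \<longrightarrow> (\<exists>M::nat. WeakNet X \<epsilon> M \<le> ennreal \<eta>))"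
  proof -
    obtain M where "WeakNet X (1/4) M \<le> ennreal (1/100)"
      using net[rule_format, of "1/4" "1/100"] by auto
    then show ?thesis by (rule B_convex_if_WeakNet)
  qed
  show "B_convex X \<Longrightarrow> (\<lambda>k. Helly X k) \<longlonglongrightarrow> 0" by (rule Helly_tendsto_zero_if_B_convex)
  show "(\<lambda>k. Helly X k) \<longlonglongrightarrow> 0 \<Longrightarrow> B_convex X" by (rule B_convex_if_Helly)
qed

end
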